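(* Let $h$ be a dimension function. (1) If $$\limsup_{\varepsilon\to 0}\frac{|\log h(\varepsilon)|}{\log|\log\varepsilon|}<3,$$ then $\mathcal{H}^h(K_3)=\infty$. (2) If $$\limsup_{\varepsilon\to 0}\frac{|\log h(\varepsilon)|}{\log|\log\varepsilon|}>3,$$ then $\mathcal{H}^h(K_3)=0$.
   Context: A dimension function is a nondecreasing, right continuous function $h:(0,\infty)\to(0,\infty)$ with $h(r)\to 0$ as $r\to 0$; we set $h(0)=0$. The associated Hausdorff measure on subsets $E\subset\mathbb{R}$ is $$\mathcal{H}^h(E)=\lim_{\delta\to 0}\inf\Big\{\sum_i h(\operatorname{diam}(U_i)) : E\subset\bigcup_i U_i,\ \operatorname{diam}(U_i)<\delta\Big\},$$ the infimum being over countable covers. The set $K_3$ is the set of all real numbers with infinite continued fraction expansion $[0;a_1,a_2,\dots,a_n,\dots]$ ($a_i$ positive integers) for which there exists a sequence of positive integers $(a_{-n})_{n\ge 0}$ such that the bi-infinite sequence $(a_n)_{n\in\mathbb{Z}}$ satisfies $$[a_k;a_{k+1},a_{k+2},\dots]+[0;a_{k-1},a_{k-2},\dots]\le 3\quad\text{for all }k\in\mathbb{Z}.$$ Here $[c_0;c_1,c_2,\dots]=c_0+\frac{1}{c_1+\frac{1}{c_2+\cdots}}$. *)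

theory Defs
  imports "HOL-Analysis.Analysis"
begin

(* Gauge functions live on all of real; only their values on {0..} matter, and the
   convention h(0) = 0 is part of the predicate. *)
definition dimension_function :: "(real \<Rightarrow> real) \<Rightarrow> bool" where
  "dimension_function h \<longleftrightarrow>
     h 0 = 0 \<and>
     (\<forall>r>0. h r > 0) \<and>
     mono_on {0<..} h \<and>
     (\<forall>r>0. continuous (at_right r) h) \<and>
     (h \<longlongrightarrow> 0) (at_right 0)"

(* Boundedness is explicit because diameter is unspecified on unbounded sets of reals.
   Finite covers are included: they can be padded by empty sets, of cost h 0 = 0. *)
definition hausdorff_premeasure :: "(real \<Rightarrow> real) \<Rightarrow> real \<Rightarrow> real set \<Rightarrow> ennreal" where
  "hausdorff_premeasure h \<delta> E =
     (INF U \<in> {U :: nat \<Rightarrow> real set.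
                 E \<subseteq> (\<Union>i. U i) \<and> (\<forall>i. bounded (U i) \<and> diameter (U i) < \<delta>)}.
        \<Sum>i. ennreal (h (diameter (U i))))"

definition hausdorff_measure :: "(real \<Rightarrow> real) \<Rightarrow> real set \<Rightarrow> ennreal" where
  "hausdorff_measure h E = Lim (at_right 0) (\<lambda>\<delta>. hausdorff_premeasure h \<delta> E)"

lemma hausdorff_premeasure_antimono:
  assumes "\<delta> \<le> \<delta>'"
  shows "hausdorff_premeasure h \<delta>' E \<le> hausdorff_premeasure h \<delta> E"
  unfolding hausdorff_premeasure_def
  using assms by (auto intro!: INF_superset_mono intro: less_le_trans)

lemma hausdorff_premeasure_tendsto:
  "((\<lambda>\<delta>. hausdorff_premeasure h \<delta> E) \<longlongrightarrow> (SUP \<delta>\<in>{0<..}. hausdorff_premeasure h \<delta> E)) (at_right 0)"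
proof (rule order_tendstoI)
  fix a assume "a < (SUP \<delta>\<in>{0<..}. hausdorff_premeasure h \<delta> E)"
  then obtain d where d: "d > 0" "a < hausdorff_premeasure h d E"
    by (auto simp: less_SUP_iff)
  show "\<forall>\<^sub>F \<delta> in at_right 0. a < hausdorff_premeasure h \<delta> E"
    unfolding eventually_at_right_field
  proof (intro exI[of _ d] conjI allI impI)
    fix y :: real assume "y < d"
    then show "a < hausdorff_premeasure h y E"
      using d(2) hausdorff_premeasure_antimono[of y d h E] by simp
  qed (use d in simp)
next
  fix a assume a: "(SUP \<delta>\<in>{0<..}. hausdorff_premeasure h \<delta> E) < a"
  have "hausdorff_premeasure h y E < a" if "y > 0" for y
    using a SUP_upper[of y "{0<..}" "\<lambda>\<delta>. hausdorff_premeasure h \<delta> E"] that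
    by (auto intro: le_less_trans)
  then show "\<forall>\<^sub>F \<delta> in at_right 0. hausdorff_premeasure h \<delta> E < a"
    by (auto simp: eventually_at_right_field intro!: exI[of _ 1])
qed

lemma hausdorff_measure_eq_SUP:
  "hausdorff_measure h E = (SUP \<delta>\<in>{0<..}. hausdorff_premeasure h \<delta> E)"
  unfolding hausdorff_measure_def
  by (rule tendsto_Lim[OF _ hausdorff_premeasure_tendsto]) simp

primrec cfrac_convergent :: "nat \<Rightarrow> (nat \<Rightarrow> nat) \<Rightarrow> real" where
  "cfrac_convergent 0 c = real (c 0)"
| "cfrac_convergent (Suc n) c = real (c 0) + 1 / cfrac_convergent n (\<lambda>i. c (Suc i))"

(* Only used when c i > 0 for all i \<ge> 1; the limit exists then (cfrac_LIMSEQ). *)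
definition cfrac :: "(nat \<Rightarrow> nat) \<Rightarrow> real" where
  "cfrac c = lim (\<lambda>n. cfrac_convergent n c)"

lemma cfrac_convergent_bounds:
  assumes "\<And>i. i > 0 \<Longrightarrow> c i > 0"
  shows "cfrac_convergent n c \<ge> real (c 0)" "cfrac_convergent n c \<le> real (c 0) + 1"
proof -
  have "real (c 0) \<le> cfrac_convergent n c \<and> cfrac_convergent n c \<le> real (c 0) + 1"
    using assms
  proof (induction n arbitrary: c)
    case (Suc n)
    have "real (c (Suc 0)) \<le> cfrac_convergent n (\<lambda>i. c (Suc i))"
      using Suc.IH[of "\<lambda>i. c (Suc i)"] Suc.prems by simp
    moreover have "real (c (Suc 0)) \<ge> 1"
      using Suc.prems[of "Suc 0"] by simp
    ultimately have "cfrac_convergent n (\<lambda>i. c (Suc i)) \<ge> 1" by linarith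
    then show ?case by simp
  qed simp
  then show "cfrac_convergent n c \<ge> real (c 0)" "cfrac_convergent n c \<le> real (c 0) + 1"
    by auto
qed

lemma cfrac_convergent_diff:
  assumes "\<And>i. i > 0 \<Longrightarrow> c i > 0" "m \<ge> 2 * k" "n \<ge> 2 * k"
  shows "\<bar>cfrac_convergent m c - cfrac_convergent n c\<bar> \<le> (1/4) ^ k"
  using assms
proof (induction k arbitrary: m n c)
  case 0
  then show ?case
    using cfrac_convergent_bounds[of c m] cfrac_convergent_bounds[of c n] by simp
next
  case (Suc k)
  obtain m' where m: "m = Suc (Suc m')" "m' \<ge> 2 * k"
    using Suc.prems(2) by (intro that[of "m - 2"]) auto
  obtain n' where n: "n = Suc (Suc n')" "n' \<ge> 2 * k"
    using Suc.prems(3) by (intro that[of "n - 2"]) auto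
  define d where "d = (\<lambda>i. c (Suc (Suc i)))"
  define x y q where "x = cfrac_convergent m' d" "y = cfrac_convergent n' d" "q = real (c (Suc 0))"
  note xyq = this
  have dpos: "d i > 0" for i unfolding d_def by (rule Suc.prems(1)) simp
  have IH: "\<bar>x - y\<bar> \<le> (1/4) ^ k"
    unfolding xyq by (rule Suc.IH) (use dpos m n in auto)
  have d0: "real (d 0) \<ge> 1" using dpos[of 0] by simp
  have x: "x \<ge> 1" and y: "y \<ge> 1"
    using d0 cfrac_convergent_bounds(1)[of d m'] cfrac_convergent_bounds(1)[of d n'] dpos
    unfolding xyq by auto
  have q: "q \<ge> 1" using Suc.prems(1)[of "Suc 0"] unfolding xyq by simp
  have qx: "q * x \<ge> 1" "q * y \<ge> 1"
    using q x y mult_mono[of 1 q 1 x] mult_mono[of 1 q 1 y] by auto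
  have ex: "1 / (q + 1 / x) = x / (q * x + 1)" if "x \<ge> 1" for x :: real
    using that by (simp add: field_simps)
  have "cfrac_convergent m c - cfrac_convergent n c = 1 / (q + 1 / x) - 1 / (q + 1 / y)"
    unfolding m n xyq d_def by simp
  also have "\<dots> = x / (q * x + 1) - y / (q * y + 1)"
    using ex x y by simp
  also have "\<dots> = (x - y) / ((q * x + 1) * (q * y + 1))"
  proof -
    have "q * x + 1 \<noteq> 0" "q * y + 1 \<noteq> 0" using qx by auto
    then show ?thesis by (simp add: diff_frac_eq) (simp add: algebra_simps)
  qed
  finally have "\<bar>cfrac_convergent m c - cfrac_convergent n c\<bar>
      = \<bar>x - y\<bar> / ((q * x + 1) * (q * y + 1))"
    using qx by (simp add: abs_mult)
  also have "\<dots> \<le> \<bar>x - y\<bar> / 4"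
    using mult_mono[of 2 "q * x + 1" 2 "q * y + 1"] qx by (intro divide_left_mono) auto
  also have "\<dots> \<le> (1/4) ^ Suc k" using IH by simp
  finally show ?case .
qed

lemma cfrac_LIMSEQ:
  assumes "\<And>i. i > 0 \<Longrightarrow> c i > 0"
  shows "(\<lambda>n. cfrac_convergent n c) \<longlonglongrightarrow> cfrac c"
proof -
  have "Cauchy (\<lambda>n. cfrac_convergent n c)"
  proof (rule CauchyI)
    fix e :: real assume "e > 0"
    then obtain k where k: "(1/4 :: real) ^ k < e"
      using real_arch_pow_inv[of e "1/4"] by auto
    show "\<exists>M. \<forall>m\<ge>M. \<forall>n\<ge>M. norm (cfrac_convergent m c - cfrac_convergent n c) < e"
    proof (intro exI[of _ "2 * k"] allI impI)
      fix m n assume "m \<ge> 2 * k" "n \<ge> 2 * k"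
      with cfrac_convergent_diff[of c k m n] assms k
      show "norm (cfrac_convergent m c - cfrac_convergent n c) < e" by simp
    qed
  qed
  then show ?thesis
    unfolding cfrac_def using Cauchy_convergent_iff convergent_LIMSEQ_iff by blast
qed

definition K3 :: "real set" where
  "K3 = {x. \<exists>a :: int \<Rightarrow> nat.
              (\<forall>n. a n > 0) \<and>
              x = cfrac (\<lambda>n. if n = 0 then 0 else a (int n)) \<and>
              (\<forall>k. cfrac (\<lambda>n. a (k + int n)) +
                   cfrac (\<lambda>n. if n = 0 then 0 else a (k - int n)) \<le> 3)}"

end

(* A Markov-bounded sequence has digits 1 and 2 only, and comparing continued fractions at each
   boundary 2|1 shows that it is a concatenation of pairs a = 22 (False) and b = 11 (True) which, as a word over two
   letters, contains no factor y m~ y y' m y' (m~ the reversal of m, y' the other letter).  Such words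
   cannot contain both squares aa and bb, so they can be desubstituted under a -> a, b -> ab (or with the
   letters exchanged), and by induction every finite factor is a coding of a line: the number of letters
   b in its prefix of length i is floor (t + beta i).  There are O(n^3) such words of length n, which
   covers K3 by O(|log eps|^3) intervals of length eps; this gives the upper bound.

   Conversely every line (beta, t) codes a point of K3.  Fix beta outside small neighbourhoods of the
   rationals, chosen so that the remaining set has positive measure.  If p/q is a Dirichlet approximation
   of beta, summing the floors over a period q shows that all lines sharing the first n letters with
   (beta, t) lie in a box of area O(1/(q^2 n)), and here q is almost as large as n.  So the image of
   Lebesgue measure gives an interval of length eps mass at most |log eps|^(-3+d), and the mass
   distribution principle yields the lower bound. *)

theory Submission
  imports Defs "HOL-Library.Sublist"
begin

section \<open>Continued fractions\<close>

text \<open>The threshold 3 turns on one identity, [0;1,1,x] + [0;2,x] = 1: around 22|11 the Markov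
  condition says exactly that the tail behind 11 is at most the mirrored tail before 22. Letters can
  be read off only after the digits have been cut into pairs consistently, which is a parity
  statement about runs. A bi-infinite word that satisfies the condition need not code a line itself:
  a single b among letters a satisfies it. Therefore only finite factors are coded, with parameters
  that depend on the factor, and desubstitution acts on sets of finite words. The exponent 3 has the
  same origin in both bounds. A Dirichlet denominator q leaves about q numerators, q heights and n/q
  positions of one jump; q n choices, summed over q up to n, give n^3. Conversely the lines that
  share n letters fill a box of sides about 1/q in t and 1/(q n) in the slope, which is as small as
  n^(-3) only if q is about n. Slopes close to rationals of small denominator have far larger boxes
  and must be removed; the price is the exponent d. Areas of Borel sets that cover preimages take
  the place of the image measure.\<close>

definition cf_tail :: "(nat \<Rightarrow> nat) \<Rightarrow> real" where
  "cf_tail u = 1 / cfrac u"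

lemma cfrac_bounds: 
  assumes "\<And>i. u i > 0"
  shows "cfrac u \<ge> real (u 0)" "cfrac u \<le> real (u 0) + 1"
proof -
  have *: "(\<lambda>n. cfrac_convergent n u) \<longlonglongrightarrow> cfrac u"
    using assms by (intro cfrac_LIMSEQ)
  show "cfrac u \<ge> real (u 0)"
    by (rule LIMSEQ_le_const[OF *]) (use assms cfrac_convergent_bounds in blast)
  show "cfrac u \<le> real (u 0) + 1"
    by (rule LIMSEQ_le_const2[OF *]) (use assms cfrac_convergent_bounds in blast)
qed

lemma cfrac_Suc:
  assumes "\<And>i. i > 0 \<Longrightarrow> u i > 0"
  shows "cfrac u = real (u 0) + cf_tail (\<lambda>i. u (Suc i))"
proof -
  have *: "(\<lambda>n. cfrac_convergent n (\<lambda>i. u (Suc i))) \<longlonglongrightarrow> cfrac (\<lambda>i. u (Suc i))"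
    using assms by (intro cfrac_LIMSEQ) auto
  have "cfrac (\<lambda>i. u (Suc i)) \<ge> real (u (Suc 0))"
    using assms by (intro cfrac_bounds) auto
  moreover have "real (u (Suc 0)) > 0" using assms by simp
  ultimately have nz: "cfrac (\<lambda>i. u (Suc i)) \<noteq> 0" by linarith
  have "(\<lambda>n. cfrac_convergent (Suc n) u) \<longlonglongrightarrow> real (u 0) + 1 / cfrac (\<lambda>i. u (Suc i))"
    unfolding cfrac_convergent.simps by (intro tendsto_intros * nz)
  moreover have "(\<lambda>n. cfrac_convergent (Suc n) u) \<longlonglongrightarrow> cfrac u"
    using assms by (intro LIMSEQ_Suc cfrac_LIMSEQ)
  ultimately show ?thesis
    unfolding cf_tail_def using LIMSEQ_unique by blast
qed

lemma cf_tail_pos: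
  assumes "\<And>i. u i > 0"
  shows "cf_tail u > 0"
proof -
  have "cfrac u \<ge> real (u 0)" using assms by (intro cfrac_bounds)
  moreover have "real (u 0) > 0" using assms by simp
  ultimately show ?thesis unfolding cf_tail_def by simp
qed

lemma cf_tail_Suc:
  assumes "\<And>i. u i > 0"
  shows "cf_tail u = 1 / (real (u 0) + cf_tail (\<lambda>i. u (Suc i)))"
  using cfrac_Suc[of u] assms unfolding cf_tail_def by simp

lemma cf_tail_less_1:
  assumes "\<And>i. u i > 0"
  shows "cf_tail u < 1"
proof -
  have "real (u 0) \<ge> 1" using assms[of 0] by simp
  moreover have "cf_tail (\<lambda>i. u (Suc i)) > 0" using assms by (intro cf_tail_pos)
  ultimately have "real (u 0) + cf_tail (\<lambda>i. u (Suc i)) > 1" by linarith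
  then show ?thesis using cf_tail_Suc[of u] assms by simp
qed

lemma cf_tail_bounds:
  assumes "\<And>i. u i > 0"
  shows "1 / (real (u 0) + 1) < cf_tail u" "cf_tail u < 1 / real (u 0)"
proof -
  have "cf_tail (\<lambda>i. u (Suc i)) > 0" "cf_tail (\<lambda>i. u (Suc i)) < 1" "real (u 0) > 0"
    using assms by (auto intro!: cf_tail_pos cf_tail_less_1)
  moreover have "cf_tail u = 1 / (real (u 0) + cf_tail (\<lambda>i. u (Suc i)))"
    using assms by (intro cf_tail_Suc)
  ultimately show "1 / (real (u 0) + 1) < cf_tail u" "cf_tail u < 1 / real (u 0)"
    by (auto intro!: divide_strict_left_mono mult_pos_pos)
qed

text \<open>Each map x -> 1 / (c + x) reverses the order, so every common digit flips the
  comparison. At the first difference the larger digit gives the smaller value, since a leading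
  digit c confines the value between 1 / (c + 1) and 1 / c.\<close>

lemma cf_tail_less_iff_parity:
  assumes "\<And>i. u i > 0" "\<And>i. v i > 0"
    and "\<And>i. i < n \<Longrightarrow> u i = v i" "u n < v n"
  shows "if even n then cf_tail v < cf_tail u else cf_tail u < cf_tail v"
  using assms
proof (induction n arbitrary: u v)
  case 0
  have "real (u 0) + 1 \<le> real (v 0)" "real (u 0) > 0" using 0 by auto
  then have "1 / real (v 0) \<le> 1 / (real (u 0) + 1)" by (intro divide_left_mono) auto
  then show ?case using cf_tail_bounds[of u] cf_tail_bounds[of v] 0 by force
next
  case (Suc n)
  let ?u = "\<lambda>i. u (Suc i)" and ?v = "\<lambda>i. v (Suc i)"
  have IH: "if even n then cf_tail ?v < cf_tail ?u else cf_tail ?u < cf_tail ?v"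
    using Suc by simp
  have eq: "u 0 = v 0" using Suc.prems(3)[of 0] by simp
  have pos: "cf_tail ?u > 0" "cf_tail ?v > 0" "real (v 0) > 0"
    using Suc.prems by (auto intro!: cf_tail_pos)
  then show ?case
    using IH cf_tail_Suc[of u] cf_tail_Suc[of v] Suc.prems(1,2) eq
    by (auto intro!: divide_strict_left_mono mult_pos_pos)
qed

lemma first_difference:
  fixes u v :: "nat \<Rightarrow> 'a"
  assumes "u \<noteq> v"
  obtains n where "\<And>i. i < n \<Longrightarrow> u i = v i" "u n \<noteq> v n"
proof -
  from assms obtain k where "u k \<noteq> v k" by auto
  then show thesis
    using that[of "LEAST n. u n \<noteq> v n"] LeastI[of "\<lambda>n. u n \<noteq> v n" k] not_less_Least by blast
qed

lemma cfrac_convergent_cong: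
  assumes "\<And>i. i \<le> n \<Longrightarrow> u i = v i"
  shows "cfrac_convergent n u = cfrac_convergent n v"
  using assms
proof (induction n arbitrary: u v)
  case (Suc n)
  have "cfrac_convergent n (\<lambda>i. u (Suc i)) = cfrac_convergent n (\<lambda>i. v (Suc i))"
    by (rule Suc.IH) (rule Suc.prems, simp)
  moreover have "u 0 = v 0" by (rule Suc.prems) simp
  ultimately show ?case by simp
qed simp

text \<open>Both values lie within (1/4)^k of the convergent of index 2 * k, which they share. This
  bounds the lengths of the covering sets in the upper bound.\<close>

lemma cfrac_close:
  assumes "\<And>i. i > 0 \<Longrightarrow> u i > 0" "\<And>i. i > 0 \<Longrightarrow> v i > 0"
    and "\<And>i. i \<le> 2 * k \<Longrightarrow> u i = v i"
  shows "\<bar>cfrac u - cfrac v\<bar> \<le> 2 * (1/4) ^ k"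
proof -
  have *: "\<bar>cfrac w - cfrac_convergent (2 * k) w\<bar> \<le> (1/4) ^ k" if "\<And>i. i > 0 \<Longrightarrow> w i > 0" for w
  proof (rule LIMSEQ_le_const2)
    show "(\<lambda>n. \<bar>cfrac_convergent n w - cfrac_convergent (2 * k) w\<bar>) \<longlonglongrightarrow>
      \<bar>cfrac w - cfrac_convergent (2 * k) w\<bar>"
      using that by (intro tendsto_intros cfrac_LIMSEQ)
    show "\<exists>N. \<forall>n\<ge>N. \<bar>cfrac_convergent n w - cfrac_convergent (2 * k) w\<bar> \<le> (1/4) ^ k"
      using cfrac_convergent_diff[of w k _ "2 * k"] that by auto
  qed
  show ?thesis
    using *[of u] *[of v] assms cfrac_convergent_cong[of "2 * k" u v] by fastforce
qed

text \<open>A converse of \<open>cfrac_close\<close> that rests on bounded digits: a common digit c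
  \<le> 2 divides the distance by (c + x) * (c + y) \<le> 9. The initial 1/14 is 1/2 - 3/7: a
  leading 1 gives at least 1/2, a leading 2 at most 1 / (2 + 1/3), because the tail behind it
  exceeds 1/3.\<close>

lemma cf_tail_separated:
  assumes "\<And>i. u i = 1 \<or> u i = 2" "\<And>i. v i = 1 \<or> v i = 2"
    and "\<And>i. i < n \<Longrightarrow> u i = v i" "u n \<noteq> v n"
  shows "\<bar>cf_tail u - cf_tail v\<bar> \<ge> (1/14) * (1/9) ^ n"
  using assms
proof (induction n arbitrary: u v)
  case 0
  have *: "\<bar>cf_tail u - cf_tail v\<bar> \<ge> 1/14"
    if "\<And>i. u i = 1 \<or> u i = 2" "\<And>i. v i = 1 \<or> v i = 2" "u 0 = 1" "v 0 = 2" for u v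
  proof -
    have pos: "u i > 0" "v i > 0" for i by (metis that(1) gr0I zero_neq_one zero_neq_numeral, metis that(2) gr0I zero_neq_one zero_neq_numeral)
    have u: "cf_tail (\<lambda>i. u (Suc i)) < 1"
      using pos by (intro cf_tail_less_1) auto
    have "real (v (Suc 0)) + 1 \<le> 3" using that(2)[of "Suc 0"] by auto
    then have "1 / 3 \<le> 1 / (real (v (Suc 0)) + 1)"
      by (intro divide_left_mono) simp_all
    then have v: "cf_tail (\<lambda>i. v (Suc i)) > 1 / 3"
      using cf_tail_bounds(1)[of "\<lambda>i. v (Suc i)"] pos by (meson order_le_less_trans)
    have ineq: "1 / (1 + x) \<ge> 1 / 2" if "0 < x" "x < 1" for x :: real
      using that by (simp add: field_simps)
    have ineq': "1 / (2 + x) \<le> 3 / 7" if "x > 1 / 3" for x :: real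
      using that by (simp add: field_simps)
    have "cf_tail u \<ge> 1 / 2"
      using ineq[OF cf_tail_pos u] pos cf_tail_Suc[of u] that(3) by simp
    moreover have "cf_tail v \<le> 3 / 7"
      using ineq'[OF v] pos cf_tail_Suc[of v] that(4) by simp
    ultimately have "cf_tail u - cf_tail v \<ge> 1 / 2 - 3 / 7" by linarith
    then show ?thesis by linarith
  qed
  have "u 0 = 1 \<and> v 0 = 2 \<or> u 0 = 2 \<and> v 0 = 1"
    using 0(1)[of 0] 0(2)[of 0] 0(4) by metis
  then have "1/14 \<le> \<bar>cf_tail u - cf_tail v\<bar>"
  proof
    assume "u 0 = 1 \<and> v 0 = 2"
    then show ?thesis using *[of u v, OF 0(1) 0(2)] by blast
  next
    assume "u 0 = 2 \<and> v 0 = 1"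
    then show ?thesis using *[of v u, OF 0(2) 0(1)] by (simp only: abs_minus_commute)
  qed
  then show ?case by simp
next
  case (Suc n)
  define x y where "x = cf_tail (\<lambda>i. u (Suc i))" and "y = cf_tail (\<lambda>i. v (Suc i))"
  have IH: "\<bar>x - y\<bar> \<ge> (1/14) * (1/9) ^ n"
    unfolding x_def y_def by (rule Suc.IH) (simp_all only: Suc.prems Suc_less_eq not_False_eq_True)
  have pos: "u i > 0" "v i > 0" for i by (metis Suc.prems(1) gr0I zero_neq_one zero_neq_numeral, metis Suc.prems(2) gr0I zero_neq_one zero_neq_numeral)
  have xy: "0 < x" "x < 1" "0 < y" "y < 1"
    unfolding x_def y_def using pos by (auto intro!: cf_tail_pos cf_tail_less_1)
  define c where "c = real (u 0)"
  have c: "c \<ge> 1" "c \<le> 2" "real (v 0) = c"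
    using Suc.prems(1)[of 0] Suc.prems(3)[of 0] unfolding c_def
    by (simp_all, linarith+)
  have u: "cf_tail u = 1 / (c + x)" "cf_tail v = 1 / (c + y)"
    using cf_tail_Suc[of u] cf_tail_Suc[of v] pos c(3) unfolding x_def y_def c_def by simp_all
  have "1 / (c + x) - 1 / (c + y) = (y - x) / ((c + x) * (c + y))"
    using xy c(1) by (simp add: field_simps)
  then have "cf_tail u - cf_tail v = (y - x) / ((c + x) * (c + y))"
    unfolding u .
  then have "\<bar>cf_tail u - cf_tail v\<bar> = \<bar>x - y\<bar> / ((c + x) * (c + y))"
    using xy c(1) by (simp add: abs_mult abs_minus_commute)
  moreover have "(c + x) * (c + y) \<le> 3 * 3"
    using xy c by (intro mult_mono) auto
  then have "\<bar>x - y\<bar> / ((c + x) * (c + y)) \<ge> \<bar>x - y\<bar> / 9"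
    using xy c by (intro divide_left_mono) auto
  ultimately show ?case using IH by simp
qed

section \<open>Digits of Markov-bounded sequences\<close>

definition markov_bounded :: "(int \<Rightarrow> nat) \<Rightarrow> bool" where
  "markov_bounded a \<longleftrightarrow> (\<forall>n. a n > 0) \<and>
     (\<forall>k. real (a k) + cf_tail (\<lambda>n. a (k + 1 + int n)) + cf_tail (\<lambda>n. a (k - 1 - int n)) \<le> 3)"

lemma mem_K3_iff: "x \<in> K3 \<longleftrightarrow> (\<exists>a. markov_bounded a \<and> x = cf_tail (\<lambda>n. a (1 + int n)))"
proof -
  have *: "cfrac (\<lambda>n. if n = 0 then 0 else a (f n)) = cf_tail (\<lambda>n. a (f (Suc n)))"
    if "\<And>n. a n > 0" for a :: "int \<Rightarrow> nat" and f
    using that by (subst cfrac_Suc) simp_all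
  have **: "cfrac (\<lambda>n. a (k + int n)) = real (a k) + cf_tail (\<lambda>n. a (k + 1 + int n))"
    if "\<And>n. a n > 0" for a :: "int \<Rightarrow> nat" and k
    using that by (subst cfrac_Suc) (simp_all add: algebra_simps)
  have "(\<forall>n. a n > 0) \<and> x = cfrac (\<lambda>n. if n = 0 then 0 else a (int n)) \<and>
      (\<forall>k. cfrac (\<lambda>n. a (k + int n)) + cfrac (\<lambda>n. if n = 0 then 0 else a (k - int n)) \<le> 3)
    \<longleftrightarrow> markov_bounded a \<and> x = cf_tail (\<lambda>n. a (1 + int n))" for a :: "int \<Rightarrow> nat"
  proof (cases "\<forall>n. a n > 0")
    case True
    then have pos: "\<And>n. a n > 0" by blast
    have 1: "cfrac (\<lambda>n. if n = 0 then 0 else a (int n)) = cf_tail (\<lambda>n. a (1 + int n))"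
      using *[of a int] pos by simp
    have 2: "cfrac (\<lambda>n. if n = 0 then 0 else a (k - int n)) = cf_tail (\<lambda>n. a (k - 1 - int n))" for k
      using *[of a "\<lambda>n. k - int n"] pos by (simp add: algebra_simps)
    show ?thesis using **[of a] pos unfolding markov_bounded_def 1 2 by auto
  next
    case False
    then show ?thesis unfolding markov_bounded_def by blast
  qed
  then show ?thesis unfolding K3_def by blast
qed

lemma markov_bounded_reflect:
  assumes "markov_bounded a"
  shows "markov_bounded (\<lambda>k. a (- k))"
  unfolding markov_bounded_def
proof (intro conjI allI)
  fix k
  have "real (a (- k)) + cf_tail (\<lambda>n. a (- k + 1 + int n)) + cf_tail (\<lambda>n. a (- k - 1 - int n)) \<le> 3"
    using assms unfolding markov_bounded_def by blast
  moreover have "- k + 1 + int n = - (k - 1 - int n)" "- k - 1 - int n = - (k + 1 + int n)" for n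
    by auto
  ultimately show "real (a (- k)) + cf_tail (\<lambda>n. a (- (k + 1 + int n))) + cf_tail (\<lambda>n. a (- (k - 1 - int n))) \<le> 3"
    by (simp only: add.commute add.left_commute)
qed (use assms in \<open>auto simp: markov_bounded_def\<close>)

context
  fixes a :: "int \<Rightarrow> nat"
  assumes a: "markov_bounded a"
begin

private definition R where "R k = cf_tail (\<lambda>n. a (k + 1 + int n))"
private definition L where "L k = cf_tail (\<lambda>n. a (k - 1 - int n))"

lemma markov_bounded_pos: "a k > 0"
  using a unfolding markov_bounded_def by blast

private lemma sum_le: "real (a k) + R k + L k \<le> 3"
  using a unfolding markov_bounded_def R_def L_def by blast

private lemma R_bounds: "0 < R k" "R k < 1"
  unfolding R_def by (auto intro!: cf_tail_pos cf_tail_less_1 markov_bounded_pos)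

private lemma L_bounds: "0 < L k" "L k < 1"
  unfolding L_def by (auto intro!: cf_tail_pos cf_tail_less_1 markov_bounded_pos)

private lemma R_rec: "R k = 1 / (real (a (k + 1)) + R (k + 1))"
  unfolding R_def by (subst cf_tail_Suc) (simp_all add: markov_bounded_pos algebra_simps)

private lemma L_rec: "L k = 1 / (real (a (k - 1)) + L (k - 1))"
  unfolding L_def by (subst cf_tail_Suc) (simp_all add: markov_bounded_pos algebra_simps)

private lemma R_rec2: "R k = 1 / (real (a (k + 1)) + 1 / (real (a (k + 2)) + R (k + 2)))"
  using R_rec[of k] R_rec[of "k + 1"] by (simp add: add.assoc)

lemma markov_bounded_digits: "a k = 1 \<or> a k = 2"
proof -
  have "real (a k) < 3" using sum_le[of k] R_bounds[of k] L_bounds[of k] by linarith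
  then have "a k < 3" by simp
  then show ?thesis using markov_bounded_pos[of k] by linarith
qed

text \<open>Two tails beginning with 1 exceed 1/2 each, which is too much beside a digit 2. The form
  is the one used at a boundary 2|1: it puts a second 2 on the left.\<close>

lemma markov_bounded_no_121: "a k = 2 \<Longrightarrow> a (k + 1) = 1 \<Longrightarrow> a (k - 1) = 2"
proof (rule ccontr)
  assume 1: "a k = 2" "a (k + 1) = 1" "a (k - 1) \<noteq> 2"
  then have 2: "a (k - 1) = 1" using markov_bounded_digits by blast
  have *: "1 / (1 + x) > 1 / 2" if "0 < x" "x < 1" for x :: real
    using that by (simp add: field_simps)
  have "R k > 1 / 2" "L k > 1 / 2"
    using *[OF R_bounds[of "k + 1"]] *[OF L_bounds[of "k - 1"]] R_rec[of k] L_rec[of k] 1 2 by simp_all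
  then show False using sum_le[of k] 1(1) by simp
qed

text \<open>The tails [0;1,2,...] > 2/3 and [0;2,...] > 1/3 are together too large. Hence every
  boundary 2|1 sits inside 22|11.\<close>

lemma markov_bounded_no_212: "a k = 2 \<Longrightarrow> a (k + 1) = 1 \<Longrightarrow> a (k + 2) = 1"
proof (rule ccontr)
  assume 1: "a k = 2" "a (k + 1) = 1" "a (k + 2) \<noteq> 1"
  then have 2: "a (k + 2) = 2" using markov_bounded_digits by blast
  have *: "1 / (1 + 1 / (2 + x)) > 2 / 3" "1 / (2 + x) > 1 / 3" if "0 < x" "x < 1" for x :: real
    using that by (simp_all add: field_simps)
  have "R k = 1 / (1 + 1 / (2 + R (k + 2)))" using R_rec2[of k] 1 2 by simp
  then have "R k > 2 / 3" using *(1)[OF R_bounds[of "k + 2"]] by simp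
  moreover have "L k > 1 / 3"
    using *(2)[OF L_bounds[of "k - 1"]] L_rec[of k] markov_bounded_no_121[OF 1(1,2)] by simp
  ultimately show False using sum_le[of k] 1(1) by simp
qed

text \<open>Since 1 / (1 + 1 / (1 + x)) = 1 - 1 / (2 + x), the excess over 3 at the digit 2 is 1 /
  (2 + y) - 1 / (2 + x), and its sign compares the two tails outside 22|11.\<close>

lemma markov_bounded_boundary:
  assumes "a k = 2" "a (k + 1) = 1"
  shows "cf_tail (\<lambda>n. a (k + 3 + int n)) \<le> cf_tail (\<lambda>n. a (k - 2 - int n))"
proof -
  define x y where "x = R (k + 2)" and "y = L (k - 1)"
  have xy: "0 < x" "0 < y" unfolding x_def y_def by (rule R_bounds L_bounds)+
  have "R k = 1 / (1 + 1 / (1 + x))"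
    using R_rec2[of k] assms markov_bounded_no_212[OF assms] unfolding x_def by simp
  also have "\<dots> = 1 - 1 / (2 + x)" using xy by (simp add: field_simps)
  finally have "R k = 1 - 1 / (2 + x)" .
  moreover have "L k = 1 / (2 + y)"
    using L_rec[of k] markov_bounded_no_121[OF assms] unfolding y_def by simp
  ultimately have "1 / (2 + y) \<le> 1 / (2 + x)" using sum_le[of k] assms by simp
  then have "x \<le> y" using xy by (simp add: field_simps)
  then show ?thesis unfolding x_def y_def R_def L_def by (simp add: algebra_simps)
qed

lemma markov_bounded_first_difference:
  assumes "a k = 2" "a (k + 1) = 1"
    and "\<And>i. i < l \<Longrightarrow> a (k + 3 + int i) = a (k - 2 - int i)"
    and "a (k + 3 + int l) \<noteq> a (k - 2 - int l)"
  shows "a (k - 2 - int l) = (if even l then 1 else 2)"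
proof (rule ccontr)
  assume neg: "a (k - 2 - int l) \<noteq> (if even l then 1 else 2)"
  let ?x = "\<lambda>n. a (k + 3 + int n)" and ?y = "\<lambda>n. a (k - 2 - int n)"
  have le: "cf_tail ?x \<le> cf_tail ?y" by (rule markov_bounded_boundary[OF assms(1,2)])
  show False
  proof (cases "even l")
    case True
    then have "?y l = 2" using neg markov_bounded_digits[of "k - 2 - int l"] by simp
    then have "?x l = 1" using assms(4) markov_bounded_digits[of "k + 3 + int l"] by simp
    then have "cf_tail ?y < cf_tail ?x"
      using cf_tail_less_iff_parity[of ?x ?y l] True assms(3) markov_bounded_pos \<open>?y l = 2\<close> by simp
    then show False using le by simp
  next
    case False
    then have "?y l = 1" using neg markov_bounded_digits[of "k - 2 - int l"] by simp
    then have "?x l = 2" using assms(4) markov_bounded_digits[of "k + 3 + int l"] by simp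
    then have "cf_tail ?y < cf_tail ?x"
      using cf_tail_less_iff_parity[of ?y ?x l] False assms(3) markov_bounded_pos \<open>?y l = 1\<close> by simp
    then show False using le by simp
  qed
qed

end

lemma least_counterexample:
  fixes P :: "nat \<Rightarrow> bool"
  assumes "\<not> (\<forall>i\<le>n. P i)"
  shows "\<exists>l\<le>n. \<not> P l \<and> (\<forall>i<l. P i)"
proof -
  obtain i where "i \<le> n" "\<not> P i" using assms by blast
  then show ?thesis
    using LeastI[of "\<lambda>i. \<not> P i" i] Least_le[of "\<lambda>i. \<not> P i" i] not_less_Least[of _ "\<lambda>i. \<not> P i"]
    by (meson le_trans)
qed

text \<open>A shortest run of odd length would be cut, at its boundary, against an equally odd but shorter run.\<close>

lemma markov_bounded_even_runs:
  assumes a: "markov_bounded a"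
    and "m \<ge> 1" "a k \<noteq> a (k + 1)" "a (k + int m) \<noteq> a (k + int m + 1)"
    and "\<And>i. 1 \<le> i \<Longrightarrow> i \<le> m \<Longrightarrow> a (k + int i) = a (k + 1)"
  shows "even m"
  using assms(2-)
proof (induction m arbitrary: k rule: less_induct)
  case (less m)
  note dig = markov_bounded_digits[OF a]
  show ?case
  proof (rule ccontr)
    assume odd: "odd m"
    have IH: False if "odd l" "l < m" "a j \<noteq> a (j + 1)" "a (j + int l) \<noteq> a (j + int l + 1)"
      "\<And>i. 1 \<le> i \<Longrightarrow> i \<le> l \<Longrightarrow> a (j + int i) = a (j + 1)" for l j
      using less.IH[of l j] that odd_pos[of l] by (simp add: Suc_le_eq)
    \<comment> \<open>The two digits on either side of a boundary 2|1 are forced, so the mirror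
      comparison starts at distance two and sees only the remaining m - 2 digits of the run.\<close>
    define n where "n = m - 2"
    show False
    proof (cases "a k = 2")
      case True
      then have k1: "a (k + 1) = 1" using less.prems(2) dig by metis
      note k2 = markov_bounded_no_212[OF a True k1]
      note k0 = markov_bounded_no_121[OF a True k1]
      have end2: "a (k + int m + 1) = 2"
        using less.prems(1,3) less.prems(4)[of m] k1 dig[of "k + int m + 1"] by auto
      have "m \<noteq> 1" using end2 k2 by (auto simp: algebra_simps)
      then have m: "m = n + 2" "odd n" using odd less.prems(1) unfolding n_def by (auto elim!: oddE)
      have x1: "a (k + 3 + int i) = 1" if "i < n" for i
        using less.prems(4)[of "i + 3"] that k1 m by (simp add: algebra_simps)
      have x2: "a (k + 3 + int n) = 2" using end2 m by (simp add: algebra_simps)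
      define y where "y i = a (k - 2 - int i)" for i :: nat
      \<comment> \<open>The mirrored digits start beside \<open>a (k - 1) = 2\<close>. Ones up to a
        first 2 at odd index l \<le> n are therefore a complete run of odd length l < m.\<close>
      have shorter: False if "l \<le> n" "odd l" "\<And>i. i < l \<Longrightarrow> y i = 1" "y l = 2" for l
      proof (rule IH[of l "k - 2 - int l"])
        have l: "l > 0" using that(2) by (rule odd_pos)
        have yl: "a (k - 2 - int l + int i) = 1" if "1 \<le> i" "i \<le> l" for i
          using \<open>\<And>i. i < l \<Longrightarrow> y i = 1\<close>[of "l - i"] that unfolding y_def
          by (simp add: of_nat_diff algebra_simps)
        show "a (k - 2 - int l) \<noteq> a (k - 2 - int l + 1)"
          using that(4) yl[of 1] l unfolding y_def by simp
        show "a (k - 2 - int l + int l) \<noteq> a (k - 2 - int l + int l + 1)"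
          using yl[of l] l k0 by (simp add: algebra_simps)
        show "a (k - 2 - int l + int i) = a (k - 2 - int l + 1)" if "1 \<le> i" "i \<le> l" for i
          using yl[OF that] yl[of 1] l by simp
      qed (use that m in auto)
      show False
      proof (cases "\<forall>i\<le>n. a (k + 3 + int i) = y i")
        case True
        then show False using shorter[of n] x1 x2 m(2) by auto
      next
        case False
        obtain l where l: "l \<le> n" "a (k + 3 + int l) \<noteq> y l" "\<And>i. i < l \<Longrightarrow> a (k + 3 + int i) = y i"
          using least_counterexample[OF False] by blast
        have d: "y l = (if even l then 1 else 2)"
          using markov_bounded_first_difference[OF a True k1, of l] l unfolding y_def by blast
        have "l \<noteq> n" using d l(2) x2 m(2) by auto
        then have "l < n" using l(1) by simp
        then have "y l = 2" "odd l" using d l(2) x1[of l] by (auto split: if_splits)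
        moreover have "y i = 1" if "i < l" for i using l(3)[OF that] x1[of i] that \<open>l < n\<close> by simp
        ultimately show False using shorter[of l] l(1) by blast
      qed
    next
      case False
      then have k: "a k = 1" "a (k + 1) = 2" using less.prems(2) dig by metis+
      \<comment> \<open>For a run of twos the boundary 2|1 is its right end, and the digits beyond
        that boundary are compared with the run; left and right change roles.\<close>
      define K where "K = k + int m"
      have run: "a (k + int i) = 2" if "1 \<le> i" "i \<le> m" for i using less.prems(4)[OF that] k by simp
      have K: "a K = 2" "a (K + 1) = 1"
        using run[of m] less.prems(1,3) dig[of "K + 1"] unfolding K_def by auto
      note K2 = markov_bounded_no_212[OF a K]
      note K0 = markov_bounded_no_121[OF a K]
      have "m \<noteq> 1" using K0 k unfolding K_def by (auto simp: algebra_simps)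
      then have m: "m = n + 2" "odd n" using odd less.prems(1) unfolding n_def by (auto elim!: oddE)
      have y1: "a (K - 2 - int i) = 2" if "i < n" for i
        using run[of "n - i"] that m unfolding K_def by (simp add: of_nat_diff algebra_simps)
      have y2: "a (K - 2 - int n) = 1" using k m unfolding K_def by simp
      define x where "x i = a (K + 3 + int i)" for i :: nat
      have shorter: False if "l \<le> n" "odd l" "\<And>i. i < l \<Longrightarrow> x i = 2" "x l = 1" for l
      proof (rule IH[of l "K + 2"])
        have l: "l > 0" using that(2) by (rule odd_pos)
        have xl: "a (K + 2 + int i) = 2" if "1 \<le> i" "i \<le> l" for i
          using \<open>\<And>i. i < l \<Longrightarrow> x i = 2\<close>[of "i - 1"] that unfolding x_def
          by (simp add: of_nat_diff algebra_simps)
        show "a (K + 2) \<noteq> a (K + 2 + 1)"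
          using xl[of 1] l K2 by simp
        show "a (K + 2 + int l) \<noteq> a (K + 2 + int l + 1)"
          using xl[of l] l that(4) unfolding x_def by (simp add: algebra_simps)
        show "a (K + 2 + int i) = a (K + 2 + 1)" if "1 \<le> i" "i \<le> l" for i
          using xl[OF that] xl[of 1] l by simp
      qed (use that m in auto)
      show False
      proof (cases "\<forall>i\<le>n. x i = a (K - 2 - int i)")
        case True
        then show False using shorter[of n] y1 y2 m(2) by auto
      next
        case False
        obtain l where l: "l \<le> n" "x l \<noteq> a (K - 2 - int l)" "\<And>i. i < l \<Longrightarrow> x i = a (K - 2 - int i)"
          using least_counterexample[OF False] by blast
        have d: "a (K - 2 - int l) = (if even l then 1 else 2)"
          using markov_bounded_first_difference[OF a K, of l] l unfolding x_def by blast
        have "l \<noteq> n" using d y2 m(2) by auto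
        then have "l < n" using l(1) by simp
        then have "odd l" using d y1[of l] by (auto split: if_splits)
        moreover have "x l = 1" using y1[OF \<open>l < n\<close>] l(2) dig unfolding x_def by metis
        moreover have "x i = 2" if "i < l" for i using l(3)[OF that] y1[of i] that \<open>l < n\<close> by simp
        ultimately show False using shorter[of l] l(1) by blast
      qed
    qed
  qed
qed

text \<open>The distance between two arbitrary switches is a sum of lengths of complete runs, each
  of which is even.\<close>

lemma markov_bounded_switches:
  assumes a: "markov_bounded a"
    and "a k \<noteq> a (k + 1)" "a (k + int m) \<noteq> a (k + int m + 1)"
  shows "even m"
  using assms(2-)
proof (induction m arbitrary: k rule: less_induct)
  case (less m)
  show ?case
  proof (cases "m = 0")
    case False
    show ?thesis
    proof (cases "\<exists>j. 0 < j \<and> j < m \<and> a (k + int j) \<noteq> a (k + int j + 1)")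
      case True
      then obtain j where j: "0 < j" "j < m" "a (k + int j) \<noteq> a (k + int j + 1)" by blast
      have "even j" using less.IH[of j k] j less.prems by blast
      moreover have "even (m - j)"
        using less.IH[of "m - j" "k + int j"] j less.prems by (simp add: of_nat_diff)
      ultimately show ?thesis using j by simp
    next
      case False
      have "a (k + int i) = a (k + 1)" if "1 \<le> i" "i \<le> m" for i
        using that
      proof (induction i rule: dec_induct)
        case (step i)
        then have "0 < i \<and> i < m" by simp
        then have "a (k + int i) = a (k + int i + 1)" using False by blast
        moreover have "k + int (Suc i) = k + int i + 1" by simp
        moreover have "a (k + int i) = a (k + 1)" using step by simp
        ultimately show ?case by metis
      qed simp
      then show ?thesis
        using markov_bounded_even_runs[OF a, of m k] less.prems \<open>m \<noteq> 0\<close> by simp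
    qed
  qed simp
qed

lemma markov_bounded_pairs:
  assumes a: "markov_bounded a"
  obtains e where "e = 0 \<or> e = 1" "\<And>k. a (e + 2 * k) = a (e + 2 * k + 1)"
proof (cases "\<exists>j. a j \<noteq> a (j + 1)")
  case True
  then obtain j where j: "a j \<noteq> a (j + 1)" by blast
  \<comment> \<open>No pair may straddle a switch, so a pair has to start right after the switch at
    j.\<close>
  define e where "e = (j + 1) mod 2"
  show thesis
  proof (rule that)
    show "e = 0 \<or> e = 1" unfolding e_def by presburger
    fix k
    show "a (e + 2 * k) = a (e + 2 * k + 1)"
    proof (rule ccontr)
      assume neq: "a (e + 2 * k) \<noteq> a (e + 2 * k + 1)"
      define i where "i = e + 2 * k"
      have odd: "odd (i - j)" unfolding i_def e_def by presburger
      show False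
      proof (cases "j \<le> i")
        case True
        then show False using markov_bounded_switches[OF a j, of "nat (i - j)"] neq odd
          unfolding i_def by (simp add: even_nat_iff)
      next
        case False
        then show False using markov_bounded_switches[OF a neq, of "nat (j - i)"] j odd
          unfolding i_def by (simp add: even_nat_iff algebra_simps)
      qed
    qed
  qed
next
  case False
  then show thesis using that[of 0] by blast
qed

section \<open>Languages with the Markov property\<close>

text \<open>Extendability on both sides replaces the bi-infinite word, so that decoding a
  substitution involves neither a choice of origin nor a limit and the induction can run on the
  length of a single word.\<close>

definition markov_language :: "bool list set \<Rightarrow> bool" where
  "markov_language L \<longleftrightarrow>
     (\<forall>v w. w \<in> L \<longrightarrow> sublist v w \<longrightarrow> v \<in> L) \<and>
     (\<forall>w\<in>L. (\<exists>y. y # w \<in> L) \<and> (\<exists>y. w @ [y] \<in> L)) \<and>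
     (\<forall>y m. y # rev m @ [y, \<not> y] @ m @ [\<not> y] \<notin> L)"

lemma markov_languageD:
  assumes "markov_language L"
  shows "w \<in> L \<Longrightarrow> sublist v w \<Longrightarrow> v \<in> L"
    and "w \<in> L \<Longrightarrow> \<exists>y. y # w \<in> L"
    and "w \<in> L \<Longrightarrow> \<exists>y. w @ [y] \<in> L"
    and "y # rev m @ [y, \<not> y] @ m @ [\<not> y] \<notin> L"
  using assms unfolding markov_language_def by blast+

lemma markov_languageI:
  assumes "\<And>v w. w \<in> L \<Longrightarrow> sublist v w \<Longrightarrow> v \<in> L"
    and "\<And>w. w \<in> L \<Longrightarrow> \<exists>y. y # w \<in> L"
    and "\<And>w. w \<in> L \<Longrightarrow> \<exists>y. w @ [y] \<in> L"
    and "\<And>y m. y # rev m @ [y, \<not> y] @ m @ [\<not> y] \<in> L \<Longrightarrow> False"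
  shows "markov_language L"
  using assms unfolding markov_language_def by blast

section \<open>Alternating words and double letters\<close>

primrec alternating :: "bool \<Rightarrow> nat \<Rightarrow> bool list" where
  "alternating x 0 = []"
| "alternating x (Suc n) = x # alternating (\<not> x) n"

lemma length_alternating [simp]: "length (alternating x n) = n"
  by (induction n arbitrary: x) auto

lemma alternating_snoc: "alternating x (Suc n) = alternating x n @ [if even n then x else \<not> x]"
proof (induction n arbitrary: x)
  case (Suc n)
  have "alternating x (Suc (Suc n)) = x # alternating (\<not> x) (Suc n)"
    by (rule alternating.simps)
  also have "\<dots> = alternating x (Suc n) @ [if even n then \<not> x else \<not> \<not> x]"
    by (subst Suc) simp
  finally show ?case by (cases "even n") (simp_all only: even_Suc simp_thms if_True if_False)
qed simp

lemma nth_alternating: "i < n \<Longrightarrow> alternating x n ! i = (if even i then x else \<not> x)"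
  by (induction n arbitrary: x i) (auto simp: nth_Cons split: nat.splits)

lemma rev_alternating: "rev (alternating x n) = alternating (if even n then \<not> x else x) n"
proof (induction n)
  case (Suc n)
  have "rev (alternating x (Suc n)) = (if even n then x else \<not> x) # rev (alternating x n)"
    unfolding alternating_snoc by simp
  then show ?case unfolding Suc by simp
qed simp

lemma take_alternating: "m \<le> n \<Longrightarrow> take m (alternating x n) = alternating x m"
  by (induction n arbitrary: x m) (auto simp: take_Cons split: nat.splits)

lemma bool_list_compare:
  fixes u v :: "bool list"
  assumes "length v \<le> length u"
  shows "prefix v u \<or> (\<exists>m y u' v'. u = m @ [y] @ u' \<and> v = m @ [\<not> y] @ v')"
  using assms
proof (induction v arbitrary: u)
  case (Cons b v)
  then obtain c u1 where u: "u = c # u1" by (cases u) auto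
  show ?case
  proof (cases "b = c")
    case True
    have "prefix v u1 \<or> (\<exists>m y u' v'. u1 = m @ [y] @ u' \<and> v = m @ [\<not> y] @ v')"
      using Cons u by auto
    then show ?thesis
    proof
      assume "\<exists>m y u' v'. u1 = m @ [y] @ u' \<and> v = m @ [\<not> y] @ v'"
      then obtain m y u' v' where "u1 = m @ [y] @ u'" "v = m @ [\<not> y] @ v'" by blast
      then have "u = (b # m) @ [y] @ u'" "b # v = (b # m) @ [\<not> y] @ v'" using u True by auto
      then show ?thesis by blast
    qed (use u True in auto)
  next
    case False
    then have "u = [] @ [c] @ u1" "b # v = [] @ [\<not> c] @ v" using u by auto
    then show ?thesis by blast
  qed
qed simp

lemma markov_language_extend_left:
  assumes "markov_language L" "w \<in> L"
  shows "\<exists>p. length p = n \<and> p @ w \<in> L"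
proof (induction n)
  case (Suc n)
  then obtain p where "length p = n" "p @ w \<in> L" by blast
  then show ?case using markov_languageD(2)[OF assms(1), of "p @ w"]
    by (metis append_Cons length_Cons)
qed (use assms in simp)

text \<open>Descent on k. Read outwards from the first change
  \<open>x\<close>|\<open>\<not> x\<close>: the right side is \<open>v\<close>, and the left side
  must agree with \<open>v\<close> until a letter that the forbidden factor fixes to be
  \<open>\<not> x\<close>. Either full agreement or this first difference exhibits on the left a
  shorter word of the same shape with the letters exchanged. The descent cannot reach k = 0, since
  the left side begins with \<open>x\<close> and then \<open>v\<close> would begin with
  \<open>\<not> x\<close>.\<close>

lemma markov_language_no_alternating:
  assumes L: "markov_language L" and "k \<ge> 1"
  shows "x # alternating x (2 * k) @ [\<not> x] \<notin> L"
  using assms(2)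
proof (induction k arbitrary: x rule: less_induct)
  case (less k)
  show ?case
  proof
    assume Z: "x # alternating x (2 * k) @ [\<not> x] \<in> L"
    define v where "v = alternating x (2 * (k - 1)) @ [\<not> x]"
    have len: "2 * k = Suc (Suc (2 * (k - 1)))" using less.prems by simp
    have Zv: "x # alternating x (2 * k) @ [\<not> x] = x # [x, \<not> x] @ v"
      unfolding len v_def by simp
    obtain p where p: "length p = length v" "p @ x # [x, \<not> x] @ v \<in> L"
      using markov_language_extend_left[OF L, of "x # [x, \<not> x] @ v" "length v"] Z unfolding Zv by auto
    define u where "u = x # rev p"
    have rev_alt: "rev (alternating x (2 * j) @ [\<not> x]) = (\<not> x) # alternating (\<not> x) (2 * j)" for j
      by (simp add: rev_alternating)
    from bool_list_compare[of v u] consider "prefix v u"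
      | m y u' v' where "u = m @ [y] @ u'" "v = m @ [\<not> y] @ v'"
      using p(1) unfolding u_def by auto
    then show False
    proof cases
      case 1
      then obtain u' where u': "u = v @ u'" by (auto simp: prefix_def)
      have "k - 1 \<noteq> 0"
      proof
        assume "k - 1 = 0"
        then show False using u' unfolding u_def v_def by simp
      qed
      have pu: "p @ [x] = rev u' @ rev v" using arg_cong[OF u', of rev] unfolding u_def by simp
      have "p @ x # [x, \<not> x] @ v = (p @ [x]) @ [x, \<not> x] @ v" by simp
      also have "\<dots> = rev u' @ (rev v @ [x]) @ [\<not> x] @ v" unfolding pu by simp
      finally have *: "p @ x # [x, \<not> x] @ v = rev u' @ (rev v @ [x]) @ [\<not> x] @ v" .
      have "rev v @ [x] \<in> L"
        by (rule markov_languageD(1)[OF L p(2)]) (unfold *, rule sublist_appendI)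
      then have "(\<not> x) # alternating (\<not> x) (2 * (k - 1)) @ [\<not> \<not> x] \<in> L"
        unfolding v_def rev_alt by simp
      moreover have "k - 1 < k" "1 \<le> k - 1" using \<open>k - 1 \<noteq> 0\<close> by linarith+
      ultimately show False using less.IH[of "k - 1" "\<not> x"] by blast
    next
      case 2
      have pu: "p @ [x] = rev u' @ [y] @ rev m"
        using arg_cong[OF 2(1), of rev] unfolding u_def by simp
      have "p @ x # [x, \<not> x] @ v = (p @ [x]) @ [x, \<not> x] @ v" by simp
      also have "\<dots> = rev u' @ ([y] @ rev m @ [x, \<not> x] @ m @ [\<not> y]) @ v'"
        unfolding pu 2(2) by simp
      finally have eq: "p @ x # [x, \<not> x] @ v = rev u' @ ([y] @ rev m @ [x, \<not> x] @ m @ [\<not> y]) @ v'" .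
      have in_L: "[y] @ rev m @ [x, \<not> x] @ m @ [\<not> y] \<in> L"
        by (rule markov_languageD(1)[OF L p(2)]) (unfold eq, rule sublist_appendI)
      have y: "y = (\<not> x)"
      proof (rule ccontr)
        assume "y \<noteq> (\<not> x)"
        then have "y = x" by auto
        then show False using in_L markov_languageD(4)[OF L, of x m] by simp
      qed
      have lm: "length m < length v" using 2(2) by simp
      have vm: "v ! length m = x" using 2(2) y by simp
      have lm': "length m < 2 * (k - 1)"
        using lm vm unfolding v_def by (auto simp: nth_append less_Suc_eq)
      then have "even (length m)"
        using vm unfolding v_def by (auto simp: nth_append nth_alternating split: if_splits)
      then obtain j where j: "length m = 2 * j" by (elim evenE)
      have "m = take (length m) v" using 2(2) by simp
      also have "\<dots> = alternating x (2 * j)"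
        using lm' unfolding v_def j by (simp add: take_alternating)
      finally have m: "m = alternating x (2 * j)" .
      have "j \<noteq> 0"
      proof
        assume "j = 0"
        then have "m = []" using m by simp
        then show False using 2(1) y unfolding u_def by simp
      qed
      have "[y] @ rev m @ [x] \<in> L"
        using markov_languageD(1)[OF L in_L, of "[y] @ rev m @ [x]"]
        by (metis append.assoc append_Cons append_Nil sublist_append_rightI)
      then have "(\<not> x) # alternating (\<not> x) (2 * j) @ [\<not> \<not> x] \<in> L"
        unfolding y m by (simp add: rev_alternating)
      moreover have "j < k" "1 \<le> j" using lm' \<open>j \<noteq> 0\<close> unfolding j by linarith+
      ultimately show False using less.IH[of j "\<not> x"] by blast
    qed
  qed
qed

text \<open>Follow the alternation that starts at the double \<open>x\<close>. Where it breaks, a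
  letter is repeated: a repeated \<open>\<not> x\<close> closes the desired factor, a repeated
  \<open>x\<close> is a new start with n = 1. The parameter n records how far the alternation has
  been read.\<close>

lemma alternating_between_doubles:
  assumes "n \<ge> 1"
  shows "\<exists>k\<ge>1. sublist (x # alternating x (2 * k) @ [\<not> x]) (x # alternating x n @ q @ [\<not> x, \<not> x])"
  using assms
proof (induction q arbitrary: n)
  case Nil
  show ?case
  proof (cases "even n")
    case True
    then obtain k where k: "n = 2 * k" by (elim evenE)
    then have "x # alternating x n @ [] @ [\<not> x, \<not> x] = [] @ (x # alternating x (2 * k) @ [\<not> x]) @ [\<not> x]"
      by simp
    then show ?thesis using k Nil by (metis (no_types, lifting) One_nat_def Suc_leI gr0I mult_is_0 not_one_le_zero sublist_appendI)
  next
    case False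
    then obtain k where k: "Suc n = 2 * k" by (metis evenE even_Suc)
    have "alternating x (Suc n) = alternating x n @ [\<not> x]"
      using False by (subst alternating_snoc) simp
    then have "x # alternating x n @ [] @ [\<not> x, \<not> x] = [] @ (x # alternating x (2 * k) @ [\<not> x]) @ []"
      unfolding k by simp
    moreover have "k \<ge> 1" using k by linarith
    ultimately show ?thesis by (metis sublist_appendI)
  qed
next
  case (Cons y q)
  show ?case
  proof (cases "y = (if even n then x else \<not> x)")
    case True
    have "x # alternating x n @ (y # q) @ [\<not> x, \<not> x] = x # alternating x (Suc n) @ q @ [\<not> x, \<not> x]"
      unfolding True by (subst alternating_snoc) simp
    then show ?thesis using Cons.IH[of "Suc n"] by (metis le_add1 plus_1_eq_Suc)
  next
    case False
    show ?thesis
    proof (cases "even n")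
      case True
      then obtain k where k: "n = 2 * k" by (elim evenE)
      have "y = (\<not> x)" using False True by auto
      then have "x # alternating x n @ (y # q) @ [\<not> x, \<not> x] = [] @ (x # alternating x (2 * k) @ [\<not> x]) @ (q @ [\<not> x, \<not> x])"
        using k by simp
      moreover have "k \<ge> 1" using k Cons.prems by linarith
      ultimately show ?thesis by (metis sublist_appendI)
    next
      case odd: False
      then have y: "y = x" using False by auto
      obtain l where l: "n = Suc l" "even l" using odd by (cases n) auto
      have "alternating x n = alternating x l @ [x]"
        unfolding l(1) using l(2) by (subst alternating_snoc) simp
      then have "x # alternating x n @ (y # q) @ [\<not> x, \<not> x]
          = (x # alternating x l) @ (x # alternating x 1 @ q @ [\<not> x, \<not> x])"
        using y by simp
      then have "sublist (x # alternating x 1 @ q @ [\<not> x, \<not> x])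
          (x # alternating x n @ (y # q) @ [\<not> x, \<not> x])"
        by (simp only: sublist_append_leftI)
      then show ?thesis using Cons.IH[of 1] sublist_order.order_trans by blast
    qed
  qed
qed

lemma markov_language_doubles:
  assumes L: "markov_language L" and "w \<in> L" "sublist [x, x] w"
  shows "\<not> sublist [\<not> x, \<not> x] w"
proof
  assume "sublist [\<not> x, \<not> x] w"
  then obtain p' s' where w': "w = p' @ [\<not> x, \<not> x] @ s'" by (auto simp: sublist_def)
  obtain p s where w: "w = p @ [x, x] @ s" using assms(3) by (auto simp: sublist_def)
  \<comment> \<open>The two letters play symmetric roles, so the double \<open>x\<close> may be
    taken to be the left one.\<close>
  have *: False if eq: "p @ [x, x] @ s = p' @ [\<not> x, \<not> x] @ s'" and le: "length p \<le> length p'"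
    and mem: "p @ [x, x] @ s \<in> L" for p p' s s' x
  proof -
    obtain r where r: "p' = p @ r" "[x, x] @ s = r @ [\<not> x, \<not> x] @ s'"
    proof -
      from eq consider us where "p = p' @ us" "us @ [x, x] @ s = [\<not> x, \<not> x] @ s'"
        | us where "p @ us = p'" "[x, x] @ s = us @ [\<not> x, \<not> x] @ s'"
        unfolding append_eq_append_conv2 by blast
      then show thesis
      proof cases
        case 1
        then have "us = []" using le by simp
        then show thesis using 1 by simp
      qed (use that in blast)
    qed
    then obtain q where q: "s = q @ [\<not> x, \<not> x] @ s'"
      by (cases r; cases "tl r") auto
    have "p @ [x, x] @ s = p @ (x # alternating x 1 @ q @ [\<not> x, \<not> x]) @ s'" unfolding q by simp
    then have "x # alternating x 1 @ q @ [\<not> x, \<not> x] \<in> L"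
      using markov_languageD(1)[OF L mem] by (metis sublist_appendI)
    then show False
      using alternating_between_doubles[of 1 x q] markov_language_no_alternating[OF L]
        markov_languageD(1)[OF L] by blast
  qed
  show False
  proof (cases "length p \<le> length p'")
    case True
    then show False using * w w' assms(2) by metis
  next
    case False
    then show False using *[of p' "\<not> x" s' p s] w w' assms(2) by auto
  qed
qed

section \<open>Codings of lines as walks, and the substitution\<close>

primrec walk :: "real \<Rightarrow> real \<Rightarrow> real \<Rightarrow> bool list \<Rightarrow> bool" where
  "walk \<beta> \<gamma> t [] \<longleftrightarrow> 0 < t \<and> t < \<beta> + \<gamma>"
| "walk \<beta> \<gamma> t (x # w) \<longleftrightarrow> 0 < t \<and> t < \<beta> + \<gamma> \<and> walk \<beta> \<gamma> (if x then t - \<gamma> else t + \<beta>) w"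

primrec walk_end :: "real \<Rightarrow> real \<Rightarrow> real \<Rightarrow> bool list \<Rightarrow> real" where
  "walk_end \<beta> \<gamma> t [] = t"
| "walk_end \<beta> \<gamma> t (x # w) = walk_end \<beta> \<gamma> (if x then t - \<gamma> else t + \<beta>) w"

text \<open>A walk is an orbit of the rotation by \<beta> on a circle of length \<beta> + \<gamma>:
  \<open>False\<close> moves by \<beta>, while \<open>True\<close> moves by \<beta> and wraps
  around. Keeping the two step lengths separate, instead of normalising the circle, makes a
  substitution act by adding one length to the other. The parameters may depend on the finite
  word.\<close>

definition linear_word :: "bool list \<Rightarrow> bool" where
  "linear_word w \<longleftrightarrow> (\<exists>\<beta> \<gamma> t. \<beta> > 0 \<and> \<gamma> > 0 \<and> walk \<beta> \<gamma> t w)"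

lemma walk_start: "walk \<beta> \<gamma> t w \<Longrightarrow> 0 < t \<and> t < \<beta> + \<gamma>"
  by (cases w) auto

lemma walk_append:
  "walk \<beta> \<gamma> t (u @ v) \<longleftrightarrow> walk \<beta> \<gamma> t u \<and> walk \<beta> \<gamma> (walk_end \<beta> \<gamma> t u) v"
proof (induction u arbitrary: t)
  case Nil
  then show ?case using walk_start by auto
qed auto

lemma linear_word_sublist:
  assumes "linear_word w" "sublist v w"
  shows "linear_word v"
  using assms unfolding linear_word_def sublist_def walk_append by (fastforce simp: walk_append)

definition spread :: "bool \<Rightarrow> bool list \<Rightarrow> bool list" where
  "spread x w = concat (map (\<lambda>y. if y = x then [x] else [x, \<not> x]) w)"

lemma spread_simps [simp]:
  "spread x [] = []"
  "spread x (y # w) = (if y = x then [x] else [x, \<not> x]) @ spread x w"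
  "spread x (u @ v) = spread x u @ spread x v"
  unfolding spread_def by auto

text \<open>Only with a final \<open>x\<close> appended does the substitution commute with reversal.
  This is why \<open>spread x w @ [x]\<close> rather than \<open>spread x w\<close> appears
  below.\<close>

lemma spread_rev: "spread x (rev w) @ [x] = x # rev (spread x w)"
proof (induction w)
  case (Cons y w)
  have *: "spread x (rev w) @ x # r = x # rev (spread x w) @ r" for r
    using arg_cong[OF Cons, of "\<lambda>l. l @ r"] by simp
  show ?case by (auto simp: *)
qed simp

lemma spread_snoc_starts: "\<exists>r. spread x w @ [x] = x # r"
  by (cases w) auto

text \<open>The block \<open>[False, True]\<close> moves by \<beta> - (\<gamma> + \<beta>) = -
  \<gamma>, so the positions at block starts are unchanged. The circle has grown by \<beta>, which
  leaves room for the intermediate positions and for the final \<open>False\<close>.\<close>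

lemma walk_spread_False:
  assumes "walk \<beta> \<gamma> t w" "\<beta> > 0" "\<gamma> > 0"
  shows "walk \<beta> (\<gamma> + \<beta>) t (spread False w @ [False])"
  using assms by (induction w arbitrary: t) (auto split: if_splits)

text \<open>Here a block \<open>[True, False]\<close> moves by - \<gamma> + (\<beta> + \<gamma>) =
  \<beta>. All block starts are shifted by \<gamma>, so that the leading step down by \<gamma> stays
  positive.\<close>

lemma walk_spread_True:
  assumes "walk \<beta> \<gamma> t w" "\<beta> > 0" "\<gamma> > 0"
  shows "walk (\<beta> + \<gamma>) \<gamma> (t + \<gamma>) (spread True w @ [True])"
  using assms
proof (induction w arbitrary: t)
  case (Cons x w)
  have "0 < t" "t < \<beta> + \<gamma>" "walk \<beta> \<gamma> (if x then t - \<gamma> else t + \<beta>) w" using Cons.prems by auto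
  with Cons.IH[OF this(3)] Cons.prems(2,3) show ?case
    by (cases x) (auto simp: algebra_simps)
qed auto

lemma linear_word_spread:
  assumes "linear_word w"
  shows "linear_word (spread x w @ [x])"
proof -
  from assms obtain \<beta> \<gamma> t where w: "\<beta> > 0" "\<gamma> > 0" "walk \<beta> \<gamma> t w"
    unfolding linear_word_def by blast
  show ?thesis
  proof (cases x)
    case True
    then show ?thesis using walk_spread_True[OF w(3,1,2)] w(1,2) unfolding linear_word_def
      by (metis add_pos_pos)
  next
    case False
    then show ?thesis using walk_spread_False[OF w(3,1,2)] w(1,2) unfolding linear_word_def
      by (metis add_pos_pos)
  qed
qed

lemma spread_decode:
  assumes "last (x # w) = x" "\<not> sublist [\<not> x, \<not> x] (x # w)"
  shows "\<exists>v. x # w = spread x v @ [x]"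
  using assms
proof (induction w rule: length_induct)
  case (1 w)
  show ?case
  proof (cases w)
    case Nil
    then have "x # w = spread x [] @ [x]" by simp
    then show ?thesis by blast
  next
    case (Cons y u)
    show ?thesis
    proof (cases "y = x")
      case True
      have "\<not> sublist [\<not> x, \<not> x] (x # u)"
        using 1(3) unfolding Cons True by (auto simp: sublist_Cons_right)
      moreover have "last (x # u) = x" using 1(2) unfolding Cons True by simp
      ultimately obtain v where "x # u = spread x v @ [x]" using 1(1) Cons by auto
      then have "x # w = spread x (x # v) @ [x]" unfolding Cons True by simp
      then show ?thesis by blast
    next
      case False
      then have y: "y = (\<not> x)" by auto
      then have "u \<noteq> []" using 1(2) Cons by auto
      then obtain z u' where u: "u = z # u'" by (cases u) auto
      have "z = x"
      proof (rule ccontr)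
        assume "z \<noteq> x"
        then have "x # w = [x] @ [\<not> x, \<not> x] @ u'" unfolding Cons u y by auto
        then show False using 1(3) by (metis sublist_appendI)
      qed
      have "\<not> sublist [\<not> x, \<not> x] (x # u')"
        using 1(3) unfolding Cons u \<open>z = x\<close> y by (auto simp: sublist_Cons_right)
      moreover have "last (x # u') = x" using 1(2) unfolding Cons u \<open>z = x\<close> by simp
      moreover have "length u' < length w" unfolding Cons u by simp
      ultimately obtain v where "x # u' = spread x v @ [x]" using 1(1) by blast
      then have "x # w = spread x (y # v) @ [x]" unfolding Cons u \<open>z = x\<close> y by simp
      then show ?thesis by blast
    qed
  qed
qed

text \<open>Decoding removes one \<open>x\<close> in front of each \<open>\<not> x\<close>; this is
  the decrease that drives the induction in \<open>markov_language_linear\<close>.\<close>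

lemma length_spread: "length (spread x w) = length w + count_list (spread x w) (\<not> x)"
  by (induction w) auto

text \<open>A forbidden factor built on \<open>m\<close> is mapped to one built on
  \<open>spread x m @ [x]\<close>, whose two copies are mirror images by \<open>spread_rev\<close>.
  For extendability, a neighbouring \<open>\<not> x\<close> is followed outwards by
  \<open>x\<close>, so one or two letters of \<open>L\<close> always complete a letter of the
  decoded language.\<close>

lemma markov_language_spread:
  assumes L: "markov_language L" and nodouble: "\<And>w. w \<in> L \<Longrightarrow> \<not> sublist [\<not> x, \<not> x] w"
  shows "markov_language {w. spread x w @ [x] \<in> L}"
proof (rule markov_languageI)
  fix v w assume "w \<in> {w. spread x w @ [x] \<in> L}" and "sublist v w"
  then have w: "spread x w @ [x] \<in> L" by simp
  obtain p s where ps: "w = p @ v @ s" using \<open>sublist v w\<close> by (auto simp: sublist_def)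
  obtain r where r: "spread x s @ [x] = x # r" using spread_snoc_starts by blast
  have "spread x w @ [x] = spread x p @ spread x v @ (spread x s @ [x])" unfolding ps by simp
  also have "\<dots> = spread x p @ (spread x v @ [x]) @ r" unfolding r by simp
  finally have "spread x v @ [x] \<in> L"
    using markov_languageD(1)[OF L w] by (metis sublist_appendI)
  then show "v \<in> {w. spread x w @ [x] \<in> L}" by simp
next
  fix w assume "w \<in> {w. spread x w @ [x] \<in> L}"
  then have w: "spread x w @ [x] \<in> L" by simp
  obtain y where y: "y # spread x w @ [x] \<in> L" using markov_languageD(2)[OF L w] by blast
  show "\<exists>y. y # w \<in> {w. spread x w @ [x] \<in> L}"
  proof (cases "y = x")
    case True
    then have "x # w \<in> {w. spread x w @ [x] \<in> L}" using y by simp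
    then show ?thesis by blast
  next
    case False
    then have y': "y = (\<not> x)" by auto
    obtain z where z: "z # y # spread x w @ [x] \<in> L" using markov_languageD(2)[OF L y] by blast
    have "z = x"
    proof (rule ccontr)
      assume "z \<noteq> x"
      then have "z # y # spread x w @ [x] = [\<not> x, \<not> x] @ spread x w @ [x]" unfolding y' by auto
      then show False using nodouble[OF z] by (metis sublist_append_rightI)
    qed
    then have "(\<not> x) # w \<in> {w. spread x w @ [x] \<in> L}" using z y' by simp
    then show ?thesis by blast
  qed
next
  fix w assume "w \<in> {w. spread x w @ [x] \<in> L}"
  then have w: "spread x w @ [x] \<in> L" by simp
  obtain y where y: "(spread x w @ [x]) @ [y] \<in> L" using markov_languageD(3)[OF L w] by blast
  show "\<exists>y. w @ [y] \<in> {w. spread x w @ [x] \<in> L}"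
  proof (cases "y = x")
    case True
    then have "w @ [x] \<in> {w. spread x w @ [x] \<in> L}" using y by simp
    then show ?thesis by blast
  next
    case False
    then have y': "y = (\<not> x)" by auto
    obtain z where z: "((spread x w @ [x]) @ [y]) @ [z] \<in> L" using markov_languageD(3)[OF L y] by blast
    have "z = x"
    proof (rule ccontr)
      assume "z \<noteq> x"
      then have "((spread x w @ [x]) @ [y]) @ [z] = (spread x w @ [x]) @ [\<not> x, \<not> x]" unfolding y' by auto
      then show False using nodouble[OF z] by (metis sublist_append_leftI)
    qed
    then have "w @ [\<not> x] \<in> {w. spread x w @ [x] \<in> L}" using z y' by simp
    then show ?thesis by blast
  qed
next
  fix y m assume "y # rev m @ [y, \<not> y] @ m @ [\<not> y] \<in> {w. spread x w @ [x] \<in> L}"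
  then have in_L: "spread x (y # rev m @ [y, \<not> y] @ m @ [\<not> y]) @ [x] \<in> L" by blast
  define m' where "m' = spread x m @ [x]"
  have rev_m': "spread x (rev m) @ [x] = rev m'" unfolding m'_def spread_rev by simp
  show False
  proof (cases "y = x")
    case True
    have "spread x (y # rev m @ [y, \<not> y] @ m @ [\<not> y]) @ [x]
        = [x] @ (spread x (rev m) @ [x]) @ [x, \<not> x] @ m' @ [\<not> x, x]"
      unfolding m'_def True by simp
    also have "\<dots> = [] @ (x # rev m' @ [x, \<not> x] @ m' @ [\<not> x]) @ [x]" unfolding rev_m' by simp
    finally have "sublist (x # rev m' @ [x, \<not> x] @ m' @ [\<not> x])
        (spread x (y # rev m @ [y, \<not> y] @ m @ [\<not> y]) @ [x])"
      by (simp only: sublist_appendI)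
    then show False
      using markov_languageD(1)[OF L in_L] markov_languageD(4)[OF L, of "x" m'] by blast
  next
    case False
    then have y': "y = (\<not> x)" by auto
    have "spread x (y # rev m @ [y, \<not> y] @ m @ [\<not> y]) @ [x]
        = [x, \<not> x] @ (spread x (rev m) @ [x]) @ [\<not> x, x] @ m' @ [x]"
      unfolding m'_def y' by simp
    also have "\<dots> = [x] @ ((\<not> x) # rev m' @ [\<not> x, \<not> \<not> x] @ m' @ [\<not> \<not> x]) @ []" unfolding rev_m' by simp
    finally have "sublist ((\<not> x) # rev m' @ [\<not> x, \<not> \<not> x] @ m' @ [\<not> \<not> x])
        (spread x (y # rev m @ [y, \<not> y] @ m @ [\<not> y]) @ [x])"
      by (simp only: sublist_appendI)
    then show False
      using markov_languageD(1)[OF L in_L] markov_languageD(4)[OF L, of "\<not> x" m'] by blast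
  qed
qed

text \<open>\<open>markov_language_doubles\<close> speaks of a single word, whereas the choice of
  substitution must be the same for a whole language. Restricting to words that occur together with
  \<open>w\<close> transfers the double letter of \<open>w\<close> to all of them.\<close>

lemma markov_language_around:
  assumes L: "markov_language L" 
  shows "markov_language {v. \<exists>V\<in>L. sublist v V \<and> sublist w V}"
proof (rule markov_languageI)
  fix v u assume "u \<in> {v. \<exists>V\<in>L. sublist v V \<and> sublist w V}" "sublist v u"
  then show "v \<in> {v. \<exists>V\<in>L. sublist v V \<and> sublist w V}" using sublist_order.order_trans by blast
next
  fix v assume "v \<in> {v. \<exists>V\<in>L. sublist v V \<and> sublist w V}"
  then obtain V where V': "V \<in> L" "sublist v V" "sublist w V" by blast
  then obtain p s where V: "V \<in> L" "V = p @ v @ s" "sublist w V" unfolding sublist_def[of v] by blast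
  obtain y where y: "y # V \<in> L" using markov_languageD(2)[OF L V(1)] by blast
  have "sublist w (y # V)" using V(3) by (simp add: sublist_Cons_right)
  moreover obtain q z where "y # p = q @ [z]" by (metis list.distinct(1) rev_exhaust)
  then have "y # V = q @ (z # v) @ s" unfolding V(2) by (metis append.assoc append_Cons append_Nil)
  then have "sublist (z # v) (y # V)" by (simp only: sublist_appendI)
  ultimately show "\<exists>y. y # v \<in> {v. \<exists>V\<in>L. sublist v V \<and> sublist w V}" using y by blast
next
  fix v assume "v \<in> {v. \<exists>V\<in>L. sublist v V \<and> sublist w V}"
  then obtain V where V': "V \<in> L" "sublist v V" "sublist w V" by blast
  then obtain p s where V: "V \<in> L" "V = p @ v @ s" "sublist w V" unfolding sublist_def[of v] by blast
  obtain y where y: "V @ [y] \<in> L" using markov_languageD(3)[OF L V(1)] by blast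
  have "sublist w (V @ [y])" using V(3) sublist_append by blast
  moreover obtain q z where "s @ [y] = z # q" by (metis append_is_Nil_conv list.distinct(1) list.exhaust)
  then have "V @ [y] = p @ (v @ [z]) @ q" unfolding V(2) by simp
  then have "sublist (v @ [z]) (V @ [y])" by (simp only: sublist_appendI)
  ultimately show "\<exists>y. v @ [y] \<in> {v. \<exists>V\<in>L. sublist v V \<and> sublist w V}" using y by blast
next
  fix y m assume "y # rev m @ [y, \<not> y] @ m @ [\<not> y] \<in> {v. \<exists>V\<in>L. sublist v V \<and> sublist w V}"
  then show False using markov_languageD(1,4)[OF L] by blast
qed

lemma linear_word_no_doubles:
  assumes "\<And>x. \<not> sublist [x, x] w"
  shows "linear_word w"
proof -
  \<comment> \<open>A word without doubles alternates, hence moves back and forth between 1/2 and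
    3/2 on a circle of length 2.\<close>
  have "walk 1 1 (if hd w then 3/2 else 1/2) w" if "\<And>x. \<not> sublist [x, x] w" for w
    using that
  proof (induction w)
    case (Cons y v)
    have *: "\<not> sublist [x, x] v" for x using Cons.prems[of x] by (auto simp: sublist_Cons_right)
    show ?case
    proof (cases v)
      case (Cons z u)
      have "z \<noteq> y" using Cons.prems[of y] unfolding Cons by (auto simp: sublist_Cons_right)
      then show ?thesis using Cons.IH[OF *] unfolding Cons by (cases y; cases z) auto
    qed auto
  qed auto
  then show ?thesis using assms unfolding linear_word_def by (metis zero_less_one)
qed

theorem markov_language_linear:
  assumes "markov_language L" "w \<in> L"
  shows "linear_word w"
  using assms
proof (induction "length w" arbitrary: w L rule: less_induct)
  case less
  show ?case
  proof (cases "\<exists>x. sublist [x, x] w")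
    case False
    then show ?thesis using linear_word_no_doubles by blast
  next
    case True
    then obtain x where x: "sublist [x, x] w" by blast
    define K where "K = {v. \<exists>V\<in>L. sublist v V \<and> sublist w V}"
    have K: "markov_language K" unfolding K_def using less.prems(1) by (rule markov_language_around)
    have wK: "w \<in> K" unfolding K_def using less.prems(2) by auto
    have nodouble: "\<not> sublist [\<not> x, \<not> x] v" if v: "v \<in> K" for v
    proof
      assume d: "sublist [\<not> x, \<not> x] v"
      obtain V where V: "V \<in> L" "sublist v V" "sublist w V" using v unfolding K_def by blast
      then show False using markov_language_doubles[OF less.prems(1) V(1), of x]
          sublist_order.order_trans x d by blast
    qed
    have "w \<noteq> []" using x by auto
    \<comment> \<open>Decoding needs \<open>x\<close> at both ends. If \<open>w\<close> begins or
      ends with \<open>\<not> x\<close>, the next letter outside is forced to be \<open>x\<close>,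
      as no double \<open>\<not> x\<close> occurs.\<close>
    define p where "p = (if hd w = x then [] else [x])"
    define s where "s = (if last w = x then [] else [x])"
    have "p @ w \<in> K"
    proof (cases "hd w = x")
      case False
      then obtain v where v: "w = (\<not> x) # v" using \<open>w \<noteq> []\<close> by (cases w) auto
      obtain y where y: "y # w \<in> K" using markov_languageD(2)[OF K wK] by blast
      have "y = x"
      proof (rule ccontr)
        assume "y \<noteq> x"
        then have "y # w = [\<not> x, \<not> x] @ v" unfolding v by auto
        then show False using nodouble[OF y] by (metis sublist_append_rightI)
      qed
      then show ?thesis using y False unfolding p_def by simp
    qed (use wK p_def in simp)
    have W: "p @ w @ s \<in> K"
    proof (cases "last w = x")
      case False
      then obtain v where v: "w = v @ [\<not> x]" using \<open>w \<noteq> []\<close> by (cases w rule: rev_cases) auto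
      obtain y where y: "(p @ w) @ [y] \<in> K" using markov_languageD(3)[OF K \<open>p @ w \<in> K\<close>] by blast
      have "y = x"
      proof (rule ccontr)
        assume "y \<noteq> x"
        then have "(p @ w) @ [y] = (p @ v) @ [\<not> x, \<not> x]" unfolding v by auto
        then show False using nodouble[OF y] by (metis sublist_append_leftI)
      qed
      then show ?thesis using y False unfolding s_def by simp
    qed (use \<open>p @ w \<in> K\<close> s_def in simp)
    have "hd (p @ w @ s) = x" using \<open>w \<noteq> []\<close> unfolding p_def by simp
    then obtain u where u: "p @ w @ s = x # u"
      using \<open>w \<noteq> []\<close> by (cases "p @ w @ s") simp_all
    have "last (p @ w @ s) = x" using \<open>w \<noteq> []\<close> unfolding s_def by auto
    then have "last (x # u) = x" "\<not> sublist [\<not> x, \<not> x] (x # u)"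
      using nodouble[OF W] unfolding u .
    from spread_decode[OF this] obtain v where v: "p @ w @ s = spread x v @ [x]"
      unfolding u by blast
    have mem: "v \<in> {w. spread x w @ [x] \<in> K}" using W unfolding v by simp
    \<comment> \<open>Each padded end is paid for by a \<open>\<not> x\<close> at that end. Two
      padded ends use two different occurrences, because \<open>w\<close> contains a double
      \<open>x\<close> and is not a single letter; the final \<open>x\<close> of the code gives the
      strict inequality.\<close>
    have "length v < length w"
    proof -
      have "length (p @ w @ s) = length v + count_list (p @ w @ s) (\<not> x) + 1"
        unfolding v using length_spread[of x v] by simp
      also have "count_list (p @ w @ s) (\<not> x) = count_list w (\<not> x)"
        unfolding p_def s_def by simp
      finally have len: "length p + length w + length s = length v + count_list w (\<not> x) + 1" by simp
      show ?thesis
      proof (cases "hd w = x")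
        case True
        then have p: "length p = 0" unfolding p_def by simp
        show ?thesis
        proof (cases "last w = x")
          case False
          then have "last w = (\<not> x)" by auto
          then have "(\<not> x) \<in> set w" using last_in_set[OF \<open>w \<noteq> []\<close>] by simp
          then have "count_list w (\<not> x) \<noteq> 0" by (simp add: count_list_0_iff)
          then show ?thesis using len p unfolding s_def by (auto split: if_splits)
        qed (use len p in \<open>simp add: s_def\<close>)
      next
        case False
        then obtain r where r: "w = (\<not> x) # r" using \<open>w \<noteq> []\<close> by (cases w) auto
        have "r \<noteq> []" using x unfolding r by (auto simp: sublist_Cons_right)
        show ?thesis
        proof (cases "last w = x")
          case True
          then show ?thesis using len False unfolding p_def s_def r by simp
        next
          case last: False
          then have "last r = (\<not> x)" using \<open>r \<noteq> []\<close> unfolding r by auto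
          then have "(\<not> x) \<in> set r" using last_in_set[OF \<open>r \<noteq> []\<close>] by simp
          then have "count_list r (\<not> x) \<noteq> 0" by (simp add: count_list_0_iff)
          then show ?thesis using len False last unfolding p_def s_def r by simp
        qed
      qed
    qed
    then have "linear_word v"
      using less.hyps markov_language_spread[OF K nodouble] mem by blast
    then have "linear_word (p @ w @ s)" unfolding v by (rule linear_word_spread)
    then show ?thesis using linear_word_sublist by (metis sublist_appendI)
  qed
qed

section \<open>Pairs of digits\<close>

text \<open>The absence of the forbidden factor, expressed at the first difference \<open>l\<close>
  of the mirror comparison and for both kinds of switch at once.\<close>

definition markov_word :: "(int \<Rightarrow> bool) \<Rightarrow> bool" where
  "markov_word s \<longleftrightarrow> (\<forall>k l. s k \<noteq> s (k + 1) \<longrightarrow> (\<forall>i<l. s (k + 2 + int i) = s (k - 1 - int i)) \<longrightarrow>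
     s (k + 2 + int l) \<noteq> s (k - 1 - int l) \<longrightarrow> s (k - 1 - int l) = s (k + 1))"

text \<open>A first differing pair with index \<open>l\<close> starts at digit index 2 * l. That
  index is even, so the parity in \<open>markov_bounded_first_difference\<close> always resolves to
  1.\<close>

lemma markov_bounded_first_difference_pairs:
  assumes a: "markov_bounded a" and pairs: "\<And>k. a (e + 2 * k) = a (e + 2 * k + 1)"
    and "a (e + 2 * k) \<noteq> 1" "a (e + 2 * (k + 1)) = 1"
    and eq: "\<And>i. i < l \<Longrightarrow> (a (e + 2 * (k + 2 + int i)) = 1) = (a (e + 2 * (k - 1 - int i)) = 1)"
    and neq: "(a (e + 2 * (k + 2 + int l)) = 1) \<noteq> (a (e + 2 * (k - 1 - int l)) = 1)"
  shows "a (e + 2 * (k - 1 - int l)) = 1"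
proof -
  define K where "K = e + 2 * k + 1"
  have K: "a K = 2" "a (K + 1) = 1"
    using assms(3,4) pairs[of k] markov_bounded_digits[OF a, of K] unfolding K_def
    by (simp_all add: algebra_simps)
  have right: "a (K + 3 + int i) = a (e + 2 * (k + 2 + int (i div 2)))" for i
  proof (cases "even i")
    case True
    then obtain j where "i = 2 * j" by blast
    then show ?thesis unfolding K_def by (simp add: algebra_simps)
  next
    case False
    then obtain j where "i = 2 * j + 1" by (elim oddE)
    then show ?thesis using pairs[of "k + 2 + int j"] unfolding K_def by (simp add: algebra_simps)
  qed
  have left: "a (K - 2 - int i) = a (e + 2 * (k - 1 - int (i div 2)))" for i
  proof (cases "even i")
    case True
    then obtain j where "i = 2 * j" by blast
    then show ?thesis using pairs[of "k - 1 - int j"] unfolding K_def by (simp add: algebra_simps)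
  next
    case False
    then obtain j where "i = 2 * j + 1" by (elim oddE)
    then show ?thesis unfolding K_def by (simp add: algebra_simps)
  qed
  have "a (K - 2 - int (2 * l)) = (if even (2 * l) then 1 else 2)"
  proof (rule markov_bounded_first_difference[OF a K])
    fix i assume "i < 2 * l"
    then have "(a (e + 2 * (k + 2 + int (i div 2))) = 1) = (a (e + 2 * (k - 1 - int (i div 2))) = 1)"
      by (intro eq) auto
    then show "a (K + 3 + int i) = a (K - 2 - int i)"
      unfolding right left using markov_bounded_digits[OF a] by metis
  next
    show "a (K + 3 + int (2 * l)) \<noteq> a (K - 2 - int (2 * l))"
      unfolding right left using neq by auto
  qed
  then show ?thesis unfolding left by simp
qed

lemma markov_bounded_word:
  assumes a: "markov_bounded a" and pairs: "\<And>k. a (e + 2 * k) = a (e + 2 * k + 1)"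
  shows "markov_word (\<lambda>k. a (e + 2 * k) = 1)"
  unfolding markov_word_def
proof (intro allI impI)
  fix k l
  assume sw: "(a (e + 2 * k) = 1) \<noteq> (a (e + 2 * (k + 1)) = 1)"
    and eq: "\<forall>i<l. (a (e + 2 * (k + 2 + int i)) = 1) = (a (e + 2 * (k - 1 - int i)) = 1)"
    and neq: "(a (e + 2 * (k + 2 + int l)) = 1) \<noteq> (a (e + 2 * (k - 1 - int l)) = 1)"
  show "(a (e + 2 * (k - 1 - int l)) = 1) = (a (e + 2 * (k + 1)) = 1)"
  proof (cases "a (e + 2 * (k + 1)) = 1")
    case True
    then show ?thesis
      using markov_bounded_first_difference_pairs[OF a pairs, of k l] sw eq neq by blast
  next
    case False
    define b where "b n = a (- n)" for n
    have b: "markov_bounded b" using markov_bounded_reflect[OF a] unfolding b_def .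
    \<comment> \<open>A switch 11|22 becomes 22|11 under reflection. The pair at e - 2 * j and e - 2
      * j + 1 is reflected to one starting at - e - 1 + 2 * j.\<close>
    have bs: "b (- e - 1 + 2 * j) = a (e + 2 * (- j))" for j
      using pairs[of "- j"] unfolding b_def by (simp add: algebra_simps)
    have bp: "b (- e - 1 + 2 * j) = b (- e - 1 + 2 * j + 1)" for j
      unfolding bs unfolding b_def by (simp add: algebra_simps)
    have "b (- e - 1 + 2 * ((- k - 1) - 1 - int l)) = 1"
    proof (rule markov_bounded_first_difference_pairs[OF b bp])
      show "b (- e - 1 + 2 * (- k - 1)) \<noteq> 1" using False unfolding bs by (simp add: algebra_simps)
      show "b (- e - 1 + 2 * (- k - 1 + 1)) = 1" using False sw unfolding bs by simp
      show "(b (- e - 1 + 2 * (- k - 1 + 2 + int i)) = 1) = (b (- e - 1 + 2 * (- k - 1 - 1 - int i)) = 1)"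
        if "i < l" for i
        using eq[rule_format, OF that] unfolding bs by (simp add: algebra_simps)
      show "(b (- e - 1 + 2 * (- k - 1 + 2 + int l)) = 1) \<noteq> (b (- e - 1 + 2 * (- k - 1 - 1 - int l)) = 1)"
        using neq unfolding bs by (simp add: algebra_simps)
    qed
    then have "a (e + 2 * (k + 2 + int l)) = 1" unfolding bs by (simp add: algebra_simps)
    then show ?thesis using False neq by blast
  qed
qed

section \<open>From words back to Markov-bounded sequences\<close>

definition digit :: "bool \<Rightarrow> nat" where "digit x = (if x then 1 else 2)"

lemma digit_pos: "digit x > 0" unfolding digit_def by simp

text \<open>Doubling every letter puts the first difference at an even digit index, where the
  smaller digit, coded by \<open>True\<close>, gives the larger value.\<close>

lemma cf_tail_pairs_le:
  assumes "\<And>l. (\<And>i. i < l \<Longrightarrow> f i = g i) \<Longrightarrow> f l \<noteq> g l \<Longrightarrow> g l"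
  shows "cf_tail (\<lambda>i. digit (f (i div 2))) \<le> cf_tail (\<lambda>i. digit (g (i div 2)))"
proof (cases "f = g")
  case False
  then obtain l where l: "\<And>i. i < l \<Longrightarrow> f i = g i" "f l \<noteq> g l" by (rule first_difference) blast
  then have "g l" using assms by blast
  then have gl: "digit (g l) < digit (f l)" using l(2) unfolding digit_def by simp
  have "if even (2 * l) then cf_tail (\<lambda>i. digit (f (i div 2))) < cf_tail (\<lambda>i. digit (g (i div 2)))
      else cf_tail (\<lambda>i. digit (g (i div 2))) < cf_tail (\<lambda>i. digit (f (i div 2)))"
  proof (rule cf_tail_less_iff_parity)
    fix i assume "i < 2 * l"
    then have "i div 2 < l" by auto
    then show "digit (g (i div 2)) = digit (f (i div 2))" using l(1) by simp
  qed (use gl in \<open>simp_all add: digit_pos\<close>)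
  then show ?thesis by simp
qed simp

text \<open>A digit 1 has two tails below 1, and a digit 2 between twos has two tails below 1/2. The
  only critical place is a 2 next to a 1; there the identity behind \<open>sum1\<close> reduces the
  bound to a comparison of tails, which is the Markov condition at that switch. The two parities of
  \<open>K\<close> are the two kinds of switch.\<close>

lemma markov_word_bounded:
  assumes s: "markov_word s"
  shows "markov_bounded (\<lambda>n. digit (s (n div 2)))"
proof -
  define a where "a n = digit (s (n div 2))" for n
  define R where "R k = cf_tail (\<lambda>n. a (k + 1 + int n))" for k
  define L where "L k = cf_tail (\<lambda>n. a (k - 1 - int n))" for k
  have pos: "a n > 0" for n unfolding a_def by (rule digit_pos)
  have R_bounds: "0 < R k" "R k < 1" for k
    unfolding R_def by (auto intro!: cf_tail_pos cf_tail_less_1 pos)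
  have L_bounds: "0 < L k" "L k < 1" for k
    unfolding L_def by (auto intro!: cf_tail_pos cf_tail_less_1 pos)
  have R_rec: "R k = 1 / (real (a (k + 1)) + R (k + 1))" for k
    unfolding R_def by (subst cf_tail_Suc) (simp_all add: pos algebra_simps)
  have L_rec: "L k = 1 / (real (a (k - 1)) + L (k - 1))" for k
    unfolding L_def by (subst cf_tail_Suc) (simp_all add: pos algebra_simps)
  have R_rec2: "R k = 1 / (real (a (k + 1)) + 1 / (real (a (k + 2)) + R (k + 2)))" for k
    using R_rec[of k] R_rec[of "k + 1"] by (simp add: add.assoc)
  have L_rec2: "L k = 1 / (real (a (k - 1)) + 1 / (real (a (k - 2)) + L (k - 2)))" for k
    using L_rec[of k] L_rec[of "k - 1"] by simp
  have half: "1 / (2 + x) < 1 / 2" if "0 < x" for x :: real using that by (simp add: field_simps)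
  have sum1: "1 / (1 + 1 / (1 + x)) + 1 / (2 + y) \<le> 1" if "0 < x" "x \<le> y" for x y :: real
  proof -
    have "1 / (1 + 1 / (1 + x)) = 1 - 1 / (2 + x)" using that by (simp add: field_simps)
    moreover have "1 / (2 + y) \<le> 1 / (2 + x)" using that by (intro divide_left_mono) auto
    ultimately show ?thesis by linarith
  qed
  have "real (a K) + R K + L K \<le> 3" for K
  proof (cases "s (K div 2)")
    case True
    then have "a K = 1" unfolding a_def digit_def by simp
    then show ?thesis using R_bounds[of K] L_bounds[of K] by simp
  next
    case False
    define k where "k = K div 2"
    have K2: "a K = 2" using False unfolding a_def digit_def by simp
    have sk: "\<not> s k" using False unfolding k_def .
    show ?thesis
    proof (cases "odd K")
      case True
      then have K: "K = 2 * k + 1" unfolding k_def by simp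
      have "a (K - 1) = 2" unfolding a_def K digit_def using sk by simp
      then have LK: "L K = 1 / (2 + L (K - 1))" using L_rec[of K] by simp
      have a12: "a (K + 1) = digit (s (k + 1))" "a (K + 2) = digit (s (k + 1))"
        unfolding a_def K by (simp_all add: algebra_simps) 
      show ?thesis
      proof (cases "s (k + 1)")
        case False
        then have "R K = 1 / (2 + R (K + 1))" using R_rec[of K] a12 unfolding digit_def by simp
        then show ?thesis
          using K2 LK half[OF R_bounds(1)[of "K + 1"]] half[OF L_bounds(1)[of "K - 1"]] by simp
      next
        case True
        then have RK: "R K = 1 / (1 + 1 / (1 + R (K + 2)))" using R_rec2[of K] a12 unfolding digit_def by simp
        define f where "f i = s (k + 2 + int i)" for i :: nat
        define g where "g i = s (k - 1 - int i)" for i :: nat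
        have "(K + 2 + 1 + int n) div 2 = k + 2 + int (n div 2)"
             "(K - 1 - 1 - int n) div 2 = k - 1 - int (n div 2)" for n
          unfolding K by presburger+
        then have "R (K + 2) = cf_tail (\<lambda>i. digit (f (i div 2)))"
             "L (K - 1) = cf_tail (\<lambda>i. digit (g (i div 2)))"
          unfolding R_def L_def a_def f_def g_def by simp_all
        moreover have "cf_tail (\<lambda>i. digit (f (i div 2))) \<le> cf_tail (\<lambda>i. digit (g (i div 2)))"
          using s sk True unfolding markov_word_def f_def g_def
          by (intro cf_tail_pairs_le) metis
        ultimately have "R (K + 2) \<le> L (K - 1)" by simp
        from sum1[OF R_bounds(1) this] show ?thesis using RK LK K2 by simp
      qed
    next
      case even: False
      then have K: "K = 2 * k" unfolding k_def by simp
      have "a (K + 1) = 2" unfolding a_def K digit_def using sk by simp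
      then have RK: "R K = 1 / (2 + R (K + 1))" using R_rec[of K] by simp
      have "(K - 1) div 2 = k - 1" "(K - 2) div 2 = k - 1" unfolding K by presburger+
      then have a12: "a (K - 1) = digit (s (k - 1))" "a (K - 2) = digit (s (k - 1))"
        unfolding a_def by simp_all
      show ?thesis
      proof (cases "s (k - 1)")
        case False
        then have "L K = 1 / (2 + L (K - 1))" using L_rec[of K] a12 unfolding digit_def by simp
        then show ?thesis
          using K2 RK half[OF R_bounds(1)[of "K + 1"]] half[OF L_bounds(1)[of "K - 1"]] by simp
      next
        case True
        then have LK: "L K = 1 / (1 + 1 / (1 + L (K - 2)))" using L_rec2[of K] a12 unfolding digit_def by simp
        define f where "f i = s (k - 2 - int i)" for i :: nat
        define g where "g i = s (k + 1 + int i)" for i :: nat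
        have "(K + 1 + 1 + int n) div 2 = k + 1 + int (n div 2)"
             "(K - 2 - 1 - int n) div 2 = k - 2 - int (n div 2)" for n
          unfolding K by presburger+
        then have "R (K + 1) = cf_tail (\<lambda>i. digit (g (i div 2)))"
             "L (K - 2) = cf_tail (\<lambda>i. digit (f (i div 2)))"
          unfolding R_def L_def a_def f_def g_def by simp_all
        moreover have "cf_tail (\<lambda>i. digit (f (i div 2))) \<le> cf_tail (\<lambda>i. digit (g (i div 2)))"
        proof (rule cf_tail_pairs_le)
          fix l assume eq: "\<And>i. i < l \<Longrightarrow> f i = g i" and neq: "f l \<noteq> g l"
          have shift: "k - 1 + 2 + int i = k + 1 + int i" "k - 1 - 1 - int i = k - 2 - int i" for i by simp_all
          have "s (k - 1) \<noteq> s (k - 1 + 1)" using True sk by simp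
          then have "s (k - 1 - 1 - int l) = s (k - 1 + 1)"
            using s eq neq unfolding markov_word_def f_def g_def shift[symmetric] by metis
          then have "\<not> f l" using sk unfolding f_def shift by simp
          then show "g l" using neq by blast
        qed
        ultimately have "L (K - 2) \<le> R (K + 1)" by simp
        from sum1[OF L_bounds(1) this] show ?thesis using RK LK K2 by simp
      qed
    qed
  qed
  then show ?thesis using pos unfolding markov_bounded_def R_def L_def a_def by blast
qed

section \<open>The language of factors of a bi-infinite word\<close>

definition factor :: "(int \<Rightarrow> bool) \<Rightarrow> int \<Rightarrow> nat \<Rightarrow> bool list" where
  "factor s k n = map (\<lambda>i. s (k + int i)) [0..<n]"

lemma length_factor [simp]: "length (factor s k n) = n"
  unfolding factor_def by simp

lemma nth_factor [simp]: "i < n \<Longrightarrow> factor s k n ! i = s (k + int i)"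
  unfolding factor_def by simp

lemma markov_word_language:
  assumes s: "markov_word s"
  shows "markov_language {factor s k n |k n. True}"
proof (rule markov_languageI)
  fix v w assume "w \<in> {factor s k n |k n. True}" "sublist v w"
  then obtain k n p q where w: "factor s k n = p @ v @ q" by (auto simp: sublist_def)
  have n: "length (p @ v @ q) = n" using w by (metis length_factor)
  have "v ! i = s (k + int (length p) + int i)" if "i < length v" for i
  proof -
    have "v ! i = (p @ v @ q) ! (length p + i)" using that by (simp add: nth_append)
    also have "\<dots> = factor s k n ! (length p + i)" by (simp only: w)
    also have "\<dots> = s (k + int (length p + i))" using that n by (intro nth_factor) simp
    finally show ?thesis by (simp add: add.assoc)
  qed
  then have "v = factor s (k + int (length p)) (length v)"
    by (intro nth_equalityI) simp_all
  then show "v \<in> {factor s k n |k n. True}" by blast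
next
  fix w assume "w \<in> {factor s k n |k n. True}"
  then obtain k n where w: "w = factor s k n" by blast
  have "s (k - 1) # w = factor s (k - 1) (Suc n)"
    unfolding w by (intro nth_equalityI) (auto simp: nth_Cons algebra_simps split: nat.splits)
  then show "\<exists>y. y # w \<in> {factor s k n |k n. True}" by blast
next
  fix w assume "w \<in> {factor s k n |k n. True}"
  then obtain k n where w: "w = factor s k n" by blast
  have "w @ [s (k + int n)] = factor s k (Suc n)"
    unfolding w factor_def by simp
  then show "\<exists>y. w @ [y] \<in> {factor s k n |k n. True}" by blast
next
  fix y m assume "y # rev m @ [y, \<not> y] @ m @ [\<not> y] \<in> {factor s k n |k n. True}"
  then obtain k n where kn: "factor s k n = y # rev m @ [y, \<not> y] @ m @ [\<not> y]" by auto
  define l where "l = length m"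
  \<comment> \<open>The switch lies between \<open>c\<close> and \<open>c + 1\<close>: one outer
    letter and the reversed copy of \<open>m\<close> precede the inner \<open>y\<close>.\<close>
  define c where "c = k + 1 + int l"
  have n: "n = 2 * l + 4" using arg_cong[OF kn, of length] unfolding l_def by simp
  have nth: "s (k + int i) = (y # rev m @ [y, \<not> y] @ m @ [\<not> y]) ! i" if "i < n" for i
    using that kn by (metis nth_factor)
  have "s c = y" using nth[of "l + 1"] n unfolding c_def l_def by (simp add: nth_append algebra_simps)
  moreover have "s (c + 1) = (\<not> y)"
    using nth[of "l + 2"] n unfolding c_def l_def by (simp add: nth_append algebra_simps)
  moreover have "s (c + 2 + int i) = m ! i" if "i < l" for i
    using nth[of "l + 3 + i"] that n unfolding c_def l_def by (simp add: nth_append algebra_simps)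
  moreover have "s (c - 1 - int i) = m ! i" if "i < l" for i
  proof -
    have less: "l - Suc i < l" using that by simp
    have "s (k + int (Suc (l - Suc i))) = rev m ! (l - Suc i)"
      using nth[of "Suc (l - Suc i)"] less n by (simp add: nth_append l_def)
    also have "\<dots> = m ! i" using that by (simp add: rev_nth l_def)
    also have "k + int (Suc (l - Suc i)) = c - 1 - int i" using that unfolding c_def by (simp add: of_nat_diff)
    finally show ?thesis .
  qed
  moreover have "s (c + 2 + int l) = (\<not> y)"
    using nth[of "2 * l + 3"] n unfolding c_def l_def by (simp add: nth_append algebra_simps)
  moreover have "s (c - 1 - int l) = y"
    using nth[of 0] n unfolding c_def by simp
  ultimately show False using s unfolding markov_word_def by metis
qed

lemma markov_word_linear:
  assumes "markov_word s"
  shows "linear_word (factor s k n)"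
  using markov_language_linear[OF markov_word_language[OF assms]] by blast

section \<open>Counting codings of lines\<close>

lemma walk_take:
  assumes "walk \<beta> \<gamma> t w" "i \<le> length w"
  shows "0 < walk_end \<beta> \<gamma> t (take i w) \<and> walk_end \<beta> \<gamma> t (take i w) < \<beta> + \<gamma>"
  using assms
proof (induction w arbitrary: t i)
  case (Cons x w)
  then show ?case by (cases i) auto
qed simp

lemma walk_end_eq:
  "walk_end \<beta> \<gamma> t w = t + \<beta> * real (length w) - (\<beta> + \<gamma>) * real (count_list w True)"
proof (induction w arbitrary: t)
  case (Cons x w)
  show ?case unfolding walk_end.simps Cons by (simp add: algebra_simps)
qed simp

text \<open>After i letters the walk is at t + \<beta> i minus (\<beta> + \<gamma>) times the number
  of \<open>True\<close> letters. As this stays in the open interval, dividing by \<beta> + \<gamma>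
  exhibits the number as a floor.\<close>

lemma linear_word_floor:
  assumes "linear_word w"
  obtains \<beta> t where "0 < \<beta>" "\<beta> < 1" "0 < t" "t < 1"
    "\<And>i. i \<le> length w \<Longrightarrow> int (count_list (take i w) True) = \<lfloor>t + \<beta> * real i\<rfloor>"
proof -
  from assms obtain \<beta> \<gamma> t where w: "\<beta> > 0" "\<gamma> > 0" "walk \<beta> \<gamma> t w"
    unfolding linear_word_def by blast
  define s where "s = \<beta> + \<gamma>"
  have s: "s > 0" "\<beta> < s" using w unfolding s_def by auto
  show thesis
  proof (rule that[of "\<beta> / s" "t / s"])
    show "0 < t / s" "t / s < 1" using walk_start[OF w(3)] s unfolding s_def by auto
    show "0 < \<beta> / s" "\<beta> / s < 1" using w s by auto
    fix i assume i: "i \<le> length w"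
    define c where "c = count_list (take i w) True"
    have "0 < t + \<beta> * real i - s * real c" "t + \<beta> * real i - s * real c < s"
      using walk_take[OF w(3) i] i unfolding walk_end_eq s_def c_def by simp_all
    then have "real c < t / s + \<beta> / s * real i" "t / s + \<beta> / s * real i < real c + 1"
      using s(1) by (simp_all add: field_simps)
    then show "int (count_list (take i w) True) = \<lfloor>t / s + \<beta> / s * real i\<rfloor>"
      unfolding c_def[symmetric] by linarith
  qed
qed

lemma word_eq_of_counts:
  assumes "length v = length w"
    and "\<And>i. i \<le> length w \<Longrightarrow> count_list (take i v) True = count_list (take i w) True"
  shows "v = w"
proof (rule nth_equalityI)
  fix i assume "i < length v"
  then have i: "i < length w" "i < length v" using assms(1) by auto
  have "count_list (take (Suc i) u) True = count_list (take i u) True + (if u ! i then 1 else 0)"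
    if "i < length u" for u
    using that by (simp add: take_Suc_conv_app_nth)
  from this[OF i(1)] this[OF i(2)] assms(2)[of i] assms(2)[of "Suc i"] i
  show "v ! i = w ! i" by (auto split: if_splits)
qed (use assms in simp)

text \<open>With \<open>p/q\<close> a Dirichlet approximation of the slope, the floors \<open>\<lfloor>t + \<beta> i\<rfloor>\<close> are
  \<open>(r + p i + \<epsilon>\<^sub>i) div q\<close> with \<open>\<epsilon>\<^sub>i \<in> {0, 1}\<close> monotone in \<open>i\<close>. As \<open>\<epsilon>\<^sub>i\<close> only matters for \<open>i\<close> in one
  residue class modulo \<open>q\<close>, only about \<open>n/q\<close> positions of the jump have to be distinguished.\<close>

definition jump_height :: "bool \<Rightarrow> int \<Rightarrow> nat \<Rightarrow> int \<Rightarrow> nat \<Rightarrow> nat \<Rightarrow> int" where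
  "jump_height up p q r j i = (r + p * int i + (if (i div q \<ge> j) = up then 1 else 0)) div int q"

lemma div_succ_eq:
  fixes m q :: int
  assumes "q > 0" "\<not> q dvd m + 1"
  shows "(m + 1) div q = m div q"
proof -
  have "(m + 1) mod q \<noteq> 0" using assms(2) by auto
  then have "1 \<le> (m + 1) mod q" using assms(1) pos_mod_sign[of q "m + 1"] by linarith
  have "m = (m + 1) div q * q + ((m + 1) mod q - 1)" by (simp add: algebra_simps)
  moreover have "(m + 1) mod q - 1 < q" using assms(1) pos_mod_bound[of q "m + 1"] by linarith
  ultimately show ?thesis using \<open>1 \<le> (m + 1) mod q\<close>
    by (metis diff_ge_0_iff_ge div_pos_pos_trivial div_mult_self3 add.commute add_0 assms(1) less_irrefl)
qed

lemma monotone_jump: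
  fixes E :: "nat \<Rightarrow> bool"
  assumes "q > 0" "coprime p (int q)"
    and mono: "\<And>i k. i \<le> k \<Longrightarrow> k \<le> n \<Longrightarrow> E i \<Longrightarrow> E k"
  obtains j where "j \<le> n div q + 1"
    "\<And>i. i \<le> n \<Longrightarrow> int q dvd r + p * int i + 1 \<Longrightarrow> E i \<longleftrightarrow> i div q \<ge> j"
proof (cases "\<exists>i\<le>n. int q dvd r + p * int i + 1 \<and> E i")
  case False
  have "\<not> n div q + 1 \<le> i div q" if "i \<le> n" for i using div_le_mono[OF that, of q] by simp
  \<comment> \<open>The threshold n div q + 1 lies beyond every block and encodes that no jump is
    visible.\<close>
  then show thesis using that[of "n div q + 1"] False by blast
next
  case True
  define P where "P i \<longleftrightarrow> i \<le> n \<and> int q dvd r + p * int i + 1 \<and> E i" for i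
  define i0 where "i0 = (LEAST i. P i)"
  have P0: "P i0" unfolding i0_def using True LeastI_ex[of P] unfolding P_def by blast
  have least: "i0 \<le> i" if "P i" for i unfolding i0_def using that by (rule Least_le)
  show thesis
  proof (rule that[of "i0 div q"])
    show "i0 div q \<le> n div q + 1" using P0 div_le_mono[of i0 n q] unfolding P_def by simp
    fix i assume i: "i \<le> n" "int q dvd r + p * int i + 1"
    have "int q dvd (r + p * int i + 1) - (r + p * int i0 + 1)"
      using i(2) P0 unfolding P_def by (intro dvd_diff) auto
    then have "int q dvd p * (int i - int i0)" by (simp add: algebra_simps)
    then have dvd: "int q dvd int i - int i0"
      using assms(2) by (simp add: coprime_dvd_mult_right_iff coprime_commute)
    show "E i \<longleftrightarrow> i div q \<ge> i0 div q"
    proof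
      assume "E i"
      then have "i0 \<le> i" using least i unfolding P_def by blast
      then show "i div q \<ge> i0 div q" by (rule div_le_mono)
    next
      assume le: "i div q \<ge> i0 div q"
      have "i mod q = i0 mod q"
        using dvd by (metis mod_eq_dvd_iff of_nat_eq_iff zmod_int)
      then have "i0 \<le> i" using le by (metis add_le_mono1 div_mult_mod_eq mult_le_mono1)
      then show "E i" using mono P0 i(1) unfolding P_def by blast
    qed
  qed
qed

lemma floor_jump_height:
  fixes \<beta> t :: real and N :: nat
  assumes "0 < \<beta>" "\<beta> < 1" "0 < t" "t < 1" "N > 0"
  obtains up p q r j where "1 \<le> q" "q \<le> N" "0 \<le> p" "p \<le> int q" "-1 \<le> r" "r < int q" "j \<le> N div q + 1"
    "\<And>i. i \<le> N \<Longrightarrow> \<lfloor>t + \<beta> * real i\<rfloor> = jump_height up p q r j i"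
proof -
  obtain p k where pk: "coprime p k" "0 < k" "k \<le> int N" "\<bar>of_int k * \<beta> - of_int p\<bar> < 1 / real N"
    using Dirichlet_approx_coprime[OF \<open>N > 0\<close>] by blast
  define q where "q = nat k"
  have q: "int q = k" "1 \<le> q" "q \<le> N" "real q > 0" using pk unfolding q_def by auto
  have appr: "\<bar>real q * \<beta> - of_int p\<bar> < 1 / real N" using pk(4) q(1) by (metis of_int_of_nat_eq)
  have N1: "1 / real N \<le> 1" using \<open>N > 0\<close> by simp
  have "real q * \<beta> > 0" "real q * \<beta> < real q" using assms q by auto
  then have "of_int p > (-1::real)" "of_int p < real q + 1" using appr N1 by linarith+
  then have p: "0 \<le> p" "p \<le> int q" by linarith+
  define \<delta> where "\<delta> = real q * \<beta> - of_int p"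
  have \<delta>: "\<bar>\<delta> * real i\<bar> < 1" if "i \<le> N" for i
  proof (cases "i = 0")
    case False
    have "\<bar>\<delta> * real i\<bar> = \<bar>\<delta>\<bar> * real i" by (simp add: abs_mult)
    also have "\<dots> < 1 / real N * real i" using appr False unfolding \<delta>_def by (intro mult_strict_right_mono) auto
    also have "\<dots> \<le> 1" using that \<open>N > 0\<close> by (simp add: divide_le_eq)
    finally show ?thesis .
  qed simp
  \<comment> \<open>Over the whole range \<open>x\<close> drifts monotonically by less than 1, so
    its floor takes at most two values and changes at most once.\<close>
  define x where "x i = real q * t + \<delta> * real i" for i :: nat
  have fl: "\<lfloor>t + \<beta> * real i\<rfloor> = (p * int i + \<lfloor>x i\<rfloor>) div int q" for i
  proof -
    have "t + \<beta> * real i = (of_int (p * int i) + x i) / real q"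
      using q(4) unfolding x_def \<delta>_def by (simp add: field_simps)
    also have "\<lfloor>\<dots>\<rfloor> = \<lfloor>of_int (p * int i) + x i\<rfloor> div int q"
      using floor_divide_real_eq_div[of "int q" "of_int (p * int i) + x i"] by simp
    also have "\<lfloor>of_int (p * int i) + x i\<rfloor> = p * int i + \<lfloor>x i\<rfloor>" by linarith
    finally show ?thesis .
  qed
  define r0 where "r0 = \<lfloor>real q * t\<rfloor>"
  have r0: "0 \<le> r0" "r0 < int q"
    using assms q(4) unfolding r0_def by (auto simp: floor_less_iff)
  have r0x: "of_int r0 \<le> real q * t" "real q * t < of_int r0 + 1" unfolding r0_def by linarith+
  show thesis
  proof (cases "\<delta> \<ge> 0")
    case True
    define E where "E i \<longleftrightarrow> x i \<ge> of_int r0 + 1" for i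
    have xr: "\<lfloor>x i\<rfloor> = r0 + (if E i then 1 else 0)" if "i \<le> N" for i
    proof -
      have "0 \<le> \<delta> * real i" "\<delta> * real i < 1" using True \<delta>[OF that] by auto
      then show ?thesis using r0x unfolding E_def x_def by (auto intro!: floor_unique)
    qed
    have mono: "E k" if "i \<le> k" "k \<le> N" "E i" for i k
    proof -
      have "\<delta> * real i \<le> \<delta> * real k" using True that(1) by (intro mult_left_mono) auto
      then show ?thesis using that(3) unfolding E_def x_def by linarith
    qed
    obtain j where j: "j \<le> N div q + 1"
      "\<And>i. i \<le> N \<Longrightarrow> int q dvd r0 + p * int i + 1 \<Longrightarrow> E i \<longleftrightarrow> i div q \<ge> j"
      using monotone_jump[of q p N E r0] mono q pk(1) by auto
    show thesis
    proof (rule that[OF q(2,3) p _ r0(2) j(1), of True])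
      fix i assume i: "i \<le> N"
      show "\<lfloor>t + \<beta> * real i\<rfloor> = jump_height True p q r0 j i"
      proof (cases "int q dvd r0 + p * int i + 1")
        case True
        then show ?thesis unfolding fl xr[OF i] jump_height_def using j(2)[OF i True]
          by (simp add: algebra_simps)
      next
        case False
        then show ?thesis unfolding fl xr[OF i] jump_height_def
          using div_succ_eq[of "int q" "r0 + p * int i"] q by (auto simp: algebra_simps)
      qed
    qed (use r0 in auto)
  next
    case False
    \<comment> \<open>For a falling drift the floor is first \<open>r0\<close> and then r0 - 1. The
      base height is the lower value, which may be -1; here the extra 1 is present before the
      threshold.\<close>
    define r where "r = r0 - 1"
    define E where "E i \<longleftrightarrow> x i < of_int r0" for i
    have xr: "\<lfloor>x i\<rfloor> = r + (if E i then 0 else 1)" if "i \<le> N" for i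
    proof -
      have "\<delta> * real i \<le> 0" "-1 < \<delta> * real i" using False \<delta>[OF that] by (auto simp: mult_le_0_iff)
      then show ?thesis using r0x unfolding E_def x_def r_def by (auto intro!: floor_unique)
    qed
    have mono: "E k" if "i \<le> k" "k \<le> N" "E i" for i k
    proof -
      have "\<delta> * real k \<le> \<delta> * real i" using False that(1) by (intro mult_left_mono_neg) auto
      then show ?thesis using that(3) unfolding E_def x_def by linarith
    qed
    obtain j where j: "j \<le> N div q + 1"
      "\<And>i. i \<le> N \<Longrightarrow> int q dvd r + p * int i + 1 \<Longrightarrow> E i \<longleftrightarrow> i div q \<ge> j"
      using monotone_jump[of q p N E r] mono q pk(1) by auto
    show thesis
    proof (rule that[OF q(2,3) p _ _ j(1), of r False])
      fix i assume i: "i \<le> N"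
      show "\<lfloor>t + \<beta> * real i\<rfloor> = jump_height False p q r j i"
      proof (cases "int q dvd r + p * int i + 1")
        case True
        then show ?thesis unfolding fl xr[OF i] jump_height_def using j(2)[OF i True]
          by (simp add: algebra_simps)
      next
        case False
        then show ?thesis unfolding fl xr[OF i] jump_height_def
          using div_succ_eq[of "int q" "r + p * int i"] q by (auto simp: algebra_simps)
      qed
    qed (use r0 r_def in auto)
  qed
qed

definition linear_words :: "nat \<Rightarrow> bool list set" where
  "linear_words n = {w. length w = n \<and> linear_word w}"

lemma finite_linear_words: "finite (linear_words n)"
  unfolding linear_words_def
  by (rule finite_subset[OF _ finite_lists_length_eq[of "UNIV :: bool set" n]]) auto

text \<open>For each q there are at most q + 1 values of p, q + 1 of r and n div q + 2 of j, and two
  directions: a total of order q n \<le> n^2. A chosen tuple determines all prefix counts and hence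
  the word, so the choice of codes is injective.\<close>

lemma card_linear_words:
  assumes "n > 0"
  shows "card (linear_words n) \<le> 36 * n ^ 3"
proof -
  define Q where "Q q = (UNIV :: bool set) \<times> {0..int q} \<times> {-1..<int q} \<times> {0..n div q + 1}" for q
  define S where "S = (SIGMA q:{1..n}. Q q)"
  define code where "code w = (SOME z. z \<in> S \<and> (case z of (q, up, p, r, j) \<Rightarrow>
      (\<forall>i\<le>n. int (count_list (take i w) True) = jump_height up p q r j i)))" for w
  have code: "code w \<in> S \<and> (case code w of (q, up, p, r, j) \<Rightarrow>
      (\<forall>i\<le>n. int (count_list (take i w) True) = jump_height up p q r j i))" if "w \<in> linear_words n" for w
  proof -
    have lw: "length w = n" "linear_word w" using that unfolding linear_words_def by auto
    obtain \<beta> t where bt: "0 < \<beta>" "\<beta> < 1" "0 < t" "t < 1"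
      "\<And>i. i \<le> n \<Longrightarrow> int (count_list (take i w) True) = \<lfloor>t + \<beta> * real i\<rfloor>"
      using linear_word_floor[OF lw(2)] lw(1) by metis
    obtain up p q r j where par: "1 \<le> q" "q \<le> n" "0 \<le> p" "p \<le> int q" "-1 \<le> r" "r < int q" "j \<le> n div q + 1"
      "\<And>i. i \<le> n \<Longrightarrow> \<lfloor>t + \<beta> * real i\<rfloor> = jump_height up p q r j i"
      using floor_jump_height[OF bt(1-4) assms] by metis
    have "(q, up, p, r, j) \<in> S \<and> (\<forall>i\<le>n. int (count_list (take i w) True) = jump_height up p q r j i)"
      using par bt(5) unfolding S_def Q_def by auto
    then show ?thesis unfolding code_def
      by (intro someI[of "\<lambda>z. z \<in> S \<and> (case z of (q, up, p, r, j) \<Rightarrow>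
        (\<forall>i\<le>n. int (count_list (take i w) True) = jump_height up p q r j i))" "(q, up, p, r, j)"]) simp
  qed
  have fin: "finite S" unfolding S_def Q_def by auto
  have "inj_on code (linear_words n)"
  proof (rule inj_onI)
    fix v w assume v: "v \<in> linear_words n" and w: "w \<in> linear_words n" and eq: "code v = code w"
    have "length v = n" "length w = n" using v w unfolding linear_words_def by auto
    moreover have "count_list (take i v) True = count_list (take i w) True" if "i \<le> n" for i
    proof -
      obtain q up p r j where z: "code w = (q, up, p, r, j)" by (metis prod_cases5)
      have "int (count_list (take i v) True) = int (count_list (take i w) True)"
        using code[OF v] code[OF w] that unfolding eq z by simp
      then show ?thesis by simp
    qed
    ultimately show "v = w" by (intro word_eq_of_counts) auto
  qed
  moreover have "code ` linear_words n \<subseteq> S" using code by blast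
  ultimately have "card (linear_words n) \<le> card S" using fin by (metis card_image card_mono)
  also have "card S = (\<Sum>q=1..n. card (Q q))" unfolding S_def Q_def by simp
  also have "\<dots> \<le> (\<Sum>q=1..n. 36 * n ^ 2)"
  proof (rule sum_mono)
    fix q assume "q \<in> {1..n}"
    then have q: "1 \<le> q" "q \<le> n" by auto
    have "card (Q q) = 2 * ((q + 1) * ((q + 1) * (n div q + 2)))"
      unfolding Q_def by (simp add: card_cartesian_product nat_add_distrib)
    also have "\<dots> \<le> 2 * ((2 * n) * (6 * n))"
    proof -
      have "q * (n div q) \<le> n" by (rule times_div_less_eq_dividend)
      then have "2 * q * (n div q + 2) \<le> 6 * n" using q(2) unfolding distrib_left by linarith
      moreover have "(q + 1) * (n div q + 2) \<le> 2 * q * (n div q + 2)" using q by (intro mult_le_mono1) simp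
      ultimately have "(q + 1) * (n div q + 2) \<le> 6 * n" by (rule order_trans[rotated])
      moreover have "q + 1 \<le> 2 * n" using q by simp
      ultimately show ?thesis using mult_le_mono by (intro mult_le_mono2) blast
    qed
    also have "\<dots> \<le> 36 * n ^ 2" by (simp add: power2_eq_square)
    finally show "card (Q q) \<le> 36 * n ^ 2" .
  qed
  also have "\<dots> = 36 * n ^ 3" by (simp add: power3_eq_cube power2_eq_square)
  finally show ?thesis .
qed

section \<open>The upper bound\<close>

lemma hausdorff_premeasure_le_finite_cover:
  assumes "finite F" "E \<subseteq> \<Union>F" "\<And>U. U \<in> F \<Longrightarrow> bounded U \<and> diameter U < \<delta>" "\<delta> > 0" "h 0 = 0"
  shows "hausdorff_premeasure h \<delta> E \<le> (\<Sum>U\<in>F. ennreal (h (diameter U)))"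
proof -
  obtain f where f: "bij_betw f {0..<card F} F" using ex_bij_betw_nat_finite[OF assms(1)] by blast
  define U where "U i = (if i < card F then f i else {})" for i
  have "\<Union>F \<subseteq> (\<Union>i. U i)"
  proof
    fix x assume "x \<in> \<Union>F"
    then obtain V where "V \<in> F" "x \<in> V" by blast
    moreover have "V \<in> f ` {0..<card F}" using \<open>V \<in> F\<close> bij_betw_imp_surj_on[OF f] by metis
    then obtain i where "i < card F" "V = f i" by (metis imageE atLeastLessThan_iff)
    ultimately have "x \<in> U i" unfolding U_def by simp
    then show "x \<in> (\<Union>i. U i)" by blast
  qed
  moreover have "bounded (U i) \<and> diameter (U i) < \<delta>" for i
  proof (cases "i < card F")
    case True
    then have "f i \<in> F" using bij_betwE[OF f] by simp
    then show ?thesis using assms(3) True unfolding U_def by simp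
  next
    case False
    then show ?thesis using assms(4) unfolding U_def by simp
  qed
  ultimately have "U \<in> {U. E \<subseteq> (\<Union>i. U i) \<and> (\<forall>i. bounded (U i) \<and> diameter (U i) < \<delta>)}"
    using order_trans[OF assms(2)] by simp
  then have "hausdorff_premeasure h \<delta> E \<le> (\<Sum>i. ennreal (h (diameter (U i))))"
    unfolding hausdorff_premeasure_def by (rule INF_lower)
  also have "\<dots> = (\<Sum>i\<in>{0..<card F}. ennreal (h (diameter (U i))))"
    using assms(5) unfolding U_def by (intro suminf_finite) auto
  also have "\<dots> = (\<Sum>i\<in>{0..<card F}. ennreal (h (diameter (f i))))"
    unfolding U_def by simp
  also have "\<dots> = (\<Sum>V\<in>F. ennreal (h (diameter V)))"
    using sum.reindex_bij_betw[OF f, of "\<lambda>V. ennreal (h (diameter V))"] .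
  finally show ?thesis .
qed

definition cylinder :: "nat \<Rightarrow> int \<times> bool list \<Rightarrow> real set" where
  "cylinder n = (\<lambda>(e, w). {cf_tail (\<lambda>m. a (1 + int m)) |a. markov_bounded a \<and>
     (\<forall>k. a (e + 2 * k) = a (e + 2 * k + 1)) \<and> factor (\<lambda>k. a (e + 2 * k) = 1) 0 n = w})"

text \<open>For both offsets \<open>e\<close> the n pairs cover the digits with indices 1 to 2 * (n
  - 1), an even number as \<open>cfrac_close\<close> requires. The digits to the left do not enter
  the point.\<close>

lemma cylinder_close:
  assumes "x \<in> cylinder n (e, w)" "y \<in> cylinder n (e, w)" "e = 0 \<or> e = 1" "n \<ge> 1"
  shows "\<bar>x - y\<bar> \<le> 2 * (1/4) ^ (n - 1)"
proof -
  obtain a b where a: "markov_bounded a" "\<And>k. a (e + 2 * k) = a (e + 2 * k + 1)"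
      "factor (\<lambda>k. a (e + 2 * k) = 1) 0 n = w" "x = cf_tail (\<lambda>m. a (1 + int m))"
    and b: "markov_bounded b" "\<And>k. b (e + 2 * k) = b (e + 2 * k + 1)"
      "factor (\<lambda>k. b (e + 2 * k) = 1) 0 n = w" "y = cf_tail (\<lambda>m. b (1 + int m))"
    using assms(1,2) unfolding cylinder_def by auto
  have even: "a (e + 2 * int i) = b (e + 2 * int i)" if "i < n" for i
  proof -
    have "(a (e + 2 * int i) = 1) = (b (e + 2 * int i) = 1)"
      using nth_factor[OF that, of "\<lambda>k. a (e + 2 * k) = 1" 0]
        nth_factor[OF that, of "\<lambda>k. b (e + 2 * k) = 1" 0] a(3) b(3) by simp
    then show ?thesis using markov_bounded_digits[OF a(1)] markov_bounded_digits[OF b(1)] by metis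
  qed
  have eq: "a (int j) = b (int j)" if "1 \<le> j" "j \<le> 2 * (n - 1)" for j
  proof -
    define i where "i = nat ((int j - e) div 2)"
    have i: "int i = (int j - e) div 2" using assms(3) that unfolding i_def by auto
    have "i < n" using i that assms(3,4) by auto
    have "int j = e + 2 * int i \<or> int j = e + 2 * int i + 1" unfolding i by presburger
    then show ?thesis using even[OF \<open>i < n\<close>] a(2)[of "int i"] b(2)[of "int i"] by metis
  qed
  have *: "cf_tail (\<lambda>m. c (1 + int m)) = cfrac (\<lambda>n. if n = 0 then 0 else c (int n))"
    if "\<And>k. c k > 0" for c :: "int \<Rightarrow> nat"
    using that by (subst cfrac_Suc) simp_all
  have xy: "x = cfrac (\<lambda>n. if n = 0 then 0 else a (int n))" "y = cfrac (\<lambda>n. if n = 0 then 0 else b (int n))"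
    using *[of a] *[of b] markov_bounded_pos[OF a(1)] markov_bounded_pos[OF b(1)] a(4) b(4) by simp_all
  show ?thesis
    unfolding xy by (rule cfrac_close) (use eq markov_bounded_pos[OF a(1)] markov_bounded_pos[OF b(1)] in auto)
qed

lemma K3_subset_cylinders: "K3 \<subseteq> \<Union>(cylinder n ` ({0, 1} \<times> linear_words n))"
proof
  fix x assume "x \<in> K3"
  then obtain a where a: "markov_bounded a" "x = cf_tail (\<lambda>m. a (1 + int m))"
    unfolding mem_K3_iff by blast
  obtain e where e: "e = 0 \<or> e = 1" "\<And>k. a (e + 2 * k) = a (e + 2 * k + 1)"
    using markov_bounded_pairs[OF a(1)] by blast
  define w where "w = factor (\<lambda>k. a (e + 2 * k) = 1) 0 n"
  have "x \<in> cylinder n (e, w)" unfolding cylinder_def w_def using a e(2) by auto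
  moreover have "w \<in> linear_words n"
    unfolding linear_words_def w_def using markov_word_linear[OF markov_bounded_word[OF a(1) e(2)]] by simp
  ultimately show "x \<in> \<Union>(cylinder n ` ({0, 1} \<times> linear_words n))" using e(1) by blast
qed

text \<open>One cylinder for each word and each of the two offsets, hence 72 = 2 * 36; all of them
  are charged h \<epsilon>.\<close>

lemma hausdorff_premeasure_K3_le:
  assumes h: "dimension_function h" and n: "n \<ge> 1" and "2 * (1/4) ^ (n - 1) \<le> \<epsilon>" "\<epsilon> < \<delta>"
  shows "hausdorff_premeasure h \<delta> K3 \<le> ennreal (72 * real n ^ 3 * h \<epsilon>)"
proof -
  have pos: "\<epsilon> > 0" using assms(3) by (meson less_le_trans mult_pos_pos zero_less_divide_1_iff zero_less_numeral zero_less_power)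
  define F where "F = cylinder n ` ({0, 1} \<times> linear_words n)"
  have diam: "bounded U \<and> diameter U \<le> \<epsilon>" if "U \<in> F" for U
  proof -
    obtain e w where U: "U = cylinder n (e, w)" "e = 0 \<or> e = 1" using \<open>U \<in> F\<close> unfolding F_def by auto
    have close: "\<bar>x - y\<bar> \<le> \<epsilon>" if "x \<in> U" "y \<in> U" for x y
      using cylinder_close[of x n e w y] that U n assms(3) by simp
    then have "bounded U" unfolding bounded_any_center bounded_def dist_real_def by blast
    moreover have "diameter U \<le> \<epsilon>" using pos close by (intro diameter_le) auto
    ultimately show ?thesis by blast
  qed
  have finF: "finite F" unfolding F_def using finite_linear_words by auto
  have h\<epsilon>: "h \<epsilon> > 0" using h pos unfolding dimension_function_def by blast
  have h_le: "h (diameter U) \<le> h \<epsilon>" if "U \<in> F" for U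
  proof (cases "diameter U = 0")
    case True
    then show ?thesis using h h\<epsilon> unfolding dimension_function_def by simp
  next
    case False
    then have "diameter U > 0" using diameter_ge_0[of U] diam[OF that] by simp
    then show ?thesis using h diam[OF that] pos unfolding dimension_function_def mono_on_def by auto
  qed
  have "hausdorff_premeasure h \<delta> K3 \<le> (\<Sum>U\<in>F. ennreal (h (diameter U)))"
  proof (rule hausdorff_premeasure_le_finite_cover[OF finF])
    show "K3 \<subseteq> \<Union>F" unfolding F_def by (rule K3_subset_cylinders)
    show "bounded U \<and> diameter U < \<delta>" if "U \<in> F" for U
      using diam[OF that] le_less_trans[OF _ assms(4)] by blast
    show "\<delta> > 0" using pos assms(4) by linarith
    show "h 0 = 0" using h unfolding dimension_function_def by blast
  qed
  also have "\<dots> \<le> (\<Sum>U\<in>F. ennreal (h \<epsilon>))" by (intro sum_mono ennreal_leI h_le)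
  also have "\<dots> = ennreal (real (card F) * h \<epsilon>)"
    using h\<epsilon> by (simp add: ennreal_mult ennreal_of_nat_eq_real_of_nat)
  also have "\<dots> \<le> ennreal (72 * real n ^ 3 * h \<epsilon>)"
  proof (intro ennreal_leI mult_right_mono)
    have "card F \<le> card ({0 :: int, 1} \<times> linear_words n)"
      unfolding F_def using finite_linear_words by (intro card_image_le) auto
    also have "\<dots> = 2 * card (linear_words n)" by (simp add: card_cartesian_product)
    also have "\<dots> \<le> 72 * n ^ 3" using card_linear_words[of n] n by simp
    finally have "real (card F) \<le> real (72 * n ^ 3)" by (rule of_nat_mono)
    then show "real (card F) \<le> 72 * real n ^ 3" by simp
  qed (use h\<epsilon> in simp)
  finally show ?thesis .
qed

lemma hausdorff_measure_K3_eq_0: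
  assumes h: "dimension_function h"
    and lim: "Limsup (at_right 0) (\<lambda>\<epsilon>. ereal (\<bar>ln (h \<epsilon>)\<bar> / ln \<bar>ln \<epsilon>\<bar>)) > 3"
  shows "hausdorff_measure h K3 = 0"
proof -
  obtain s where s: "3 < s" "ereal s < Limsup (at_right 0) (\<lambda>\<epsilon>. ereal (\<bar>ln (h \<epsilon>)\<bar> / ln \<bar>ln \<epsilon>\<bar>))"
    using ereal_dense2[OF lim] by auto
  \<comment> \<open>The upper limit makes \<open>h\<close> small only along some scales tending to
    0. That suffices, as the premeasure at \<delta> is bounded by a cover at a single scale below
    \<delta>.\<close>
  have freq: "\<exists>\<^sub>F \<epsilon> in at_right 0. s < \<bar>ln (h \<epsilon>)\<bar> / ln \<bar>ln \<epsilon>\<bar>"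
  proof (rule ccontr)
    assume "\<not> ?thesis"
    then have "\<forall>\<^sub>F \<epsilon> in at_right 0. ereal (\<bar>ln (h \<epsilon>)\<bar> / ln \<bar>ln \<epsilon>\<bar>) \<le> ereal s"
      by (simp add: not_frequently not_less)
    then have "Limsup (at_right 0) (\<lambda>\<epsilon>. ereal (\<bar>ln (h \<epsilon>)\<bar> / ln \<bar>ln \<epsilon>\<bar>)) \<le> ereal s"
      by (rule Limsup_bounded)
    then show False using s(2) by simp
  qed
  have ln_top: "filterlim (\<lambda>\<epsilon>. - ln \<epsilon>) at_top (at_right (0::real))"
    using ln_at_0 by (simp add: filterlim_uminus_at_top)
  have small: "((\<lambda>\<epsilon>. 576 * (- ln \<epsilon>) powr (3 - s)) \<longlongrightarrow> 576 * 0) (at_right 0)"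
    using s(1) by (intro tendsto_mult_left tendsto_neg_powr ln_top) simp
  have "hausdorff_premeasure h \<delta> K3 \<le> 0 + ennreal \<eta>" if "\<delta> > 0" "\<eta> > 0" for \<delta> \<eta> :: real
  proof -
    have "\<forall>\<^sub>F \<epsilon> in at_right 0. 576 * (- ln \<epsilon>) powr (3 - s) < \<eta>"
      using small that(2) by (intro order_tendstoD) auto
    moreover have "\<forall>\<^sub>F \<epsilon> in at_right (0::real). - ln \<epsilon> \<ge> 3" using ln_top by (simp add: filterlim_at_top)
    moreover have "\<forall>\<^sub>F \<epsilon> in at_right (0::real). \<epsilon> < \<delta>" using that(1) by (intro order_tendstoD(2)[OF tendsto_ident_at])
    moreover have "\<forall>\<^sub>F \<epsilon> in at_right (0::real). \<epsilon> > 0" by (rule eventually_at_right_less)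
    moreover have "\<forall>\<^sub>F \<epsilon> in at_right 0. h \<epsilon> < 1"
      using h unfolding dimension_function_def by (intro order_tendstoD(2)[of h 0]) auto
    ultimately have "\<forall>\<^sub>F \<epsilon> in at_right 0. 576 * (- ln \<epsilon>) powr (3 - s) < \<eta> \<and> - ln \<epsilon> \<ge> 3 \<and> \<epsilon> < \<delta> \<and> \<epsilon> > 0 \<and> h \<epsilon> < 1"
      by eventually_elim simp
    from frequently_eventually_conj[OF freq this] obtain \<epsilon> where \<epsilon>:
      "s < \<bar>ln (h \<epsilon>)\<bar> / ln \<bar>ln \<epsilon>\<bar>" "576 * (- ln \<epsilon>) powr (3 - s) < \<eta>" "- ln \<epsilon> \<ge> 3" "\<epsilon> < \<delta>" "\<epsilon> > 0" "h \<epsilon> < 1"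
      by (auto dest: frequently_ex)
    define T where "T = - ln \<epsilon>"
    have T: "T \<ge> 3" "\<epsilon> = exp (- T)" using \<epsilon> unfolding T_def by auto
    have h\<epsilon>: "h \<epsilon> > 0" using h \<epsilon>(5) unfolding dimension_function_def by blast
    have "ln T > 0" using T by simp
    have "\<bar>ln \<epsilon>\<bar> = T" "\<bar>ln (h \<epsilon>)\<bar> = - ln (h \<epsilon>)" using T h\<epsilon> \<epsilon>(6) unfolding T_def by auto
    then have "s < - ln (h \<epsilon>) / ln T" using \<epsilon>(1) by simp
    then have "s * ln T < - ln (h \<epsilon>)" using \<open>ln T > 0\<close> by (simp only: pos_less_divide_eq)
    then have "ln (h \<epsilon>) < (- s) * ln T" by simp
    then have "exp (ln (h \<epsilon>)) < exp ((- s) * ln T)" by (simp only: exp_less_cancel_iff)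
    then have "h \<epsilon> < exp ((- s) * ln T)" by (simp only: exp_ln[OF h\<epsilon>])
    also have "exp ((- s) * ln T) = T powr (- s)" using T(1) unfolding powr_def by simp
    finally have h_less: "h \<epsilon> < T powr (- s)" .
    \<comment> \<open>The shift by 2 gives n - 1 \<ge> T + 1, so that 2 * (1/4)^(n-1) \<le> exp 1 *
      exp (- T - 1) = \<epsilon>. With T \<ge> 3 also n \<le> 2 T, whence 576 = 72 * 2^3.\<close>
    define n where "n = nat \<lceil>T\<rceil> + 2"
    have n: "n \<ge> 1" "real (n - 1) \<ge> T + 1" "real n \<le> 2 * T" unfolding n_def using T by linarith+
    have e1: "(2::real) \<le> exp 1" using exp_ge_add_one_self[of 1] by simp
    have "(1/4 :: real) \<le> exp (- 1)" using exp_le by (simp add: exp_minus field_simps)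
    then have "(1/4 :: real) ^ (n - 1) \<le> exp (- 1) ^ (n - 1)" by (intro power_mono) auto
    also have "\<dots> = exp (- real (n - 1))" by (simp add: exp_of_nat_mult[symmetric])
    also have "\<dots> \<le> exp (- T - 1)" using n(2) by simp
    finally have "2 * (1/4 :: real) ^ (n - 1) \<le> exp 1 * exp (- T - 1)"
      using e1 by (intro mult_mono) auto
    also have "\<dots> = \<epsilon>" unfolding T(2) by (simp add: exp_add[symmetric])
    finally have "2 * (1/4 :: real) ^ (n - 1) \<le> \<epsilon>" .
    from hausdorff_premeasure_K3_le[OF h n(1) this \<epsilon>(4)]
    have "hausdorff_premeasure h \<delta> K3 \<le> ennreal (72 * real n ^ 3 * h \<epsilon>)" .
    also have "\<dots> \<le> ennreal \<eta>"
    proof (rule ennreal_leI)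
      have "72 * real n ^ 3 * h \<epsilon> \<le> 72 * (2 * T) ^ 3 * T powr (- s)"
        using n(3) less_imp_le[OF h_less] less_imp_le[OF h\<epsilon>] T(1) by (intro mult_mono power_mono) simp_all
      also have "\<dots> = 576 * (T powr 3 * T powr (- s))"
      proof -
        have "T powr 3 = T ^ 3" using T(1) powr_realpow[of T 3] by simp
        then show ?thesis by (simp add: power_mult_distrib)
      qed
      also have "T powr 3 * T powr (- s) = T powr (3 - s)"
        using powr_add[of T 3 "- s"] by (simp only: diff_conv_add_uminus)
      also have "576 * T powr (3 - s) \<le> \<eta>" using \<epsilon>(2) unfolding T_def by (rule less_imp_le)
      finally show "72 * real n ^ 3 * h \<epsilon> \<le> \<eta>" .
    qed
    finally show ?thesis by simp
  qed
  then have "hausdorff_premeasure h \<delta> K3 \<le> 0" if "\<delta> > 0" for \<delta>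
    by (rule ennreal_le_epsilon) (rule that)
  then have "hausdorff_measure h K3 \<le> 0"
    unfolding hausdorff_measure_eq_SUP by (intro SUP_least) simp
  then show ?thesis by simp
qed

section \<open>Lines sharing a long coding\<close>

text \<open>Hermite's identity. Raising m by 1 replaces the first summand by itself plus 1 at the
  other end.\<close>

lemma sum_div_consecutive:
  fixes m :: int and q :: nat
  assumes "q > 0"
  shows "(\<Sum>j<q. (m + int j) div int q) = m"
proof -
  define f where "f m = (\<Sum>j<q. (m + int j) div int q)" for m
  have step: "f (m + 1) = f m + 1" for m
  proof -
    have "f (m + 1) + m div int q = (\<Sum>j<Suc q. (m + int j) div int q)"
      unfolding f_def by (subst sum.lessThan_Suc_shift) (simp add: algebra_simps)
    also have "\<dots> = f m + (m + int q) div int q" unfolding f_def by simp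
    also have "(m + int q) div int q = m div int q + 1" using assms by simp
    finally show ?thesis by simp
  qed
  have "f m = m"
  proof (induction m rule: int_induct[of _ 0])
    case base
    show ?case unfolding f_def by simp
  next
    case (step1 i)
    then show ?case using step[of i] by simp
  next
    case (step2 i)
    then show ?case using step[of "i - 1"] by simp
  qed
  then show ?thesis unfolding f_def .
qed

lemma bij_betw_mult_mod:
  fixes p :: int and q :: nat
  assumes "q > 0" "coprime p (int q)"
  shows "bij_betw (\<lambda>i. nat (p * int i mod int q)) {..<q} {..<q}"
proof -
  let ?f = "\<lambda>i. nat (p * int i mod int q)"
  have "inj_on ?f {..<q}"
  proof (rule inj_onI)
    fix i j assume ij: "i \<in> {..<q}" "j \<in> {..<q}" "?f i = ?f j"
    have "p * int i mod int q = p * int j mod int q"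
      using ij(3) assms(1) by (simp add: nat_eq_iff)
    then have "int q dvd p * (int i - int j)" by (simp add: mod_eq_dvd_iff algebra_simps)
    then have "int q dvd int i - int j"
      using assms(2) by (simp add: coprime_dvd_mult_right_iff coprime_commute)
    then have "int i mod int q = int j mod int q" by (simp add: mod_eq_dvd_iff)
    then show "i = j" using ij(1,2) by simp
  qed
  moreover have "?f ` {..<q} \<subseteq> {..<q}" using assms(1) by (auto simp: nat_less_iff)
  ultimately show ?thesis unfolding bij_betw_def using endo_inj_surj[of "{..<q}" ?f] by simp
qed

text \<open>The residues of p i modulo q are permuted, so Hermite's identity applies: over a full
  period the floors measure the intercept y with precision 1/q.\<close>

lemma sum_floor_rational_slope:
  fixes p :: int and q :: nat and y :: real
  assumes "q > 0" "coprime p (int q)"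
  shows "(\<Sum>i<q. \<lfloor>y + of_int p * real i / real q\<rfloor>) = \<lfloor>real q * y\<rfloor> + (\<Sum>i<q. p * int i div int q)"
proof -
  define m where "m = \<lfloor>real q * y\<rfloor>"
  have *: "\<lfloor>y + of_int p * real i / real q\<rfloor>
      = (m + int (nat (p * int i mod int q))) div int q + p * int i div int q" for i
  proof -
    have "y + of_int p * real i / real q = (real q * y + of_int (p * int i)) / real q"
      using assms(1) by (simp add: field_simps)
    also have "\<lfloor>\<dots>\<rfloor> = \<lfloor>real q * y + of_int (p * int i)\<rfloor> div int q"
      using floor_divide_real_eq_div[of "int q" "real q * y + of_int (p * int i)"] by simp
    also have "\<lfloor>real q * y + of_int (p * int i)\<rfloor> = m + p * int i" unfolding m_def by linarith
    also have "(m + p * int i) div int q = ((m + p * int i mod int q) + p * int i div int q * int q) div int q"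
    proof -
      have "m + p * int i = (m + p * int i mod int q) + p * int i div int q * int q"
        using div_mult_mod_eq[of "p * int i" "int q"] by linarith
      then show ?thesis by (rule arg_cong)
    qed
    also have "\<dots> = p * int i div int q + (m + p * int i mod int q) div int q"
      using assms(1) by (intro div_mult_self1) simp
    finally show ?thesis using assms(1) by simp
  qed
  have "(\<Sum>i<q. (m + int (nat (p * int i mod int q))) div int q) = (\<Sum>j<q. (m + int j) div int q)"
    using sum.reindex_bij_betw[OF bij_betw_mult_mod[OF assms], of "\<lambda>j. (m + int j) div int q"] .
  also have "\<dots> = m" using assms(1) by (rule sum_div_consecutive)
  finally show ?thesis unfolding * sum.distrib m_def by simp
qed

text \<open>Within one period the slopes \<beta> and p/q differ by at most q times their distance.
  Moving the intercept down and up by this amount encloses the sum between two sums of rational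
  slope.\<close>

lemma sum_floor_approx:
  fixes p :: int and q :: nat and y \<beta> :: real
  assumes "q > 0" "coprime p (int q)"
  shows "\<bar>of_int (\<Sum>i<q. \<lfloor>y + \<beta> * real i\<rfloor>) - of_int (\<Sum>i<q. p * int i div int q) - real q * y\<bar>
    \<le> (real q)\<^sup>2 * \<bar>\<beta> - of_int p / real q\<bar> + 1"
proof -
  define \<eta> where "\<eta> = \<bar>\<beta> - of_int p / real q\<bar>"
  define c where "c = (\<Sum>i<q. p * int i div int q)"
  have close: "\<bar>\<beta> * real i - of_int p * real i / real q\<bar> \<le> real q * \<eta>" if "i < q" for i
  proof -
    have "\<beta> * real i - of_int p * real i / real q = real i * (\<beta> - of_int p / real q)"
      by (simp add: algebra_simps)
    then have "\<bar>\<beta> * real i - of_int p * real i / real q\<bar> = real i * \<eta>"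
      unfolding \<eta>_def by (simp only: abs_mult abs_of_nat)
    also have "\<dots> \<le> real q * \<eta>" using that unfolding \<eta>_def by (intro mult_right_mono) auto
    finally show ?thesis .
  qed
  have "(\<Sum>i<q. \<lfloor>y + \<beta> * real i\<rfloor>) \<le> (\<Sum>i<q. \<lfloor>(y + real q * \<eta>) + of_int p * real i / real q\<rfloor>)"
    using close by (intro sum_mono floor_mono) force
  also have "\<dots> = \<lfloor>real q * (y + real q * \<eta>)\<rfloor> + c"
    unfolding c_def by (rule sum_floor_rational_slope[OF assms])
  finally have "of_int (\<Sum>i<q. \<lfloor>y + \<beta> * real i\<rfloor>) \<le> real q * (y + real q * \<eta>) + of_int c" by linarith
  moreover have "(\<Sum>i<q. \<lfloor>(y - real q * \<eta>) + of_int p * real i / real q\<rfloor>) \<le> (\<Sum>i<q. \<lfloor>y + \<beta> * real i\<rfloor>)"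
    using close by (intro sum_mono floor_mono) force
  then have "\<lfloor>real q * (y - real q * \<eta>)\<rfloor> + c \<le> (\<Sum>i<q. \<lfloor>y + \<beta> * real i\<rfloor>)"
    unfolding c_def sum_floor_rational_slope[OF assms] .
  then have "real q * (y - real q * \<eta>) - 1 + of_int c \<le> of_int (\<Sum>i<q. \<lfloor>y + \<beta> * real i\<rfloor>)" by linarith
  ultimately show ?thesis unfolding \<eta>_def[symmetric] c_def[symmetric]
    by (simp add: abs_le_iff algebra_simps power2_eq_square)
qed

text \<open>The first period fixes q t up to a constant, the last full period fixes q (t + K q
  \<beta>). Their difference measures the slope with a lever K q of order n. The deviation of
  \<beta>' from p/q is bounded by that of \<beta> plus \<bar>\<beta> - \<beta>'\<bar>, and the
  latter is absorbed on the left.\<close>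

lemma equal_floors_close:
  fixes p :: int and q n :: nat and t t' \<beta> \<beta>' :: real
  assumes q: "q > 0" "8 * q \<le> n" and pq: "coprime p (int q)"
    and appr: "\<bar>\<beta> - of_int p / real q\<bar> \<le> 8 / (real q * real n)"
    and eq: "\<And>i. i \<le> n \<Longrightarrow> \<lfloor>t + \<beta> * real i\<rfloor> = \<lfloor>t' + \<beta>' * real i\<rfloor>"
  shows "\<bar>\<beta> - \<beta>'\<bar> \<le> 16 / (real q * real n)" "\<bar>t - t'\<bar> \<le> 6 / real q"
proof -
  define \<eta> \<eta>' D where "\<eta> = \<bar>\<beta> - of_int p / real q\<bar>" and "\<eta>' = \<bar>\<beta>' - of_int p / real q\<bar>" and "D = \<bar>\<beta> - \<beta>'\<bar>"
  note defs = this
  define K where "K = n div q - 1"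
  define c where "c = real_of_int (\<Sum>i<q. p * int i div int q)"
  define S0 where "S0 = real_of_int (\<Sum>i<q. \<lfloor>t + \<beta> * real i\<rfloor>)"
  define S1 where "S1 = real_of_int (\<Sum>i<q. \<lfloor>(t + real (K * q) * \<beta>) + \<beta> * real i\<rfloor>)"
  have n: "n div q * q \<le> n" "n < n div q * q + q"
    using div_mult_mod_eq[of n q] mod_less_divisor[OF q(1), of n] by linarith+
  have n8: "n div q \<ge> 8" using q by (simp add: less_eq_div_iff_mult_less_eq)
  have Kq: "K * q + q = n div q * q" unfolding K_def using n8 by (simp add: algebra_simps)
  have S0': "S0 = real_of_int (\<Sum>i<q. \<lfloor>t' + \<beta>' * real i\<rfloor>)"
    unfolding S0_def using eq q by (intro arg_cong[where f = real_of_int] sum.cong) auto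
  have S1': "S1 = real_of_int (\<Sum>i<q. \<lfloor>(t' + real (K * q) * \<beta>') + \<beta>' * real i\<rfloor>)"
    unfolding S1_def
  proof (intro arg_cong[where f = real_of_int] sum.cong refl)
    fix i assume "i \<in> {..<q}"
    then have "i < q" by simp
    then have "i + K * q \<le> n" using Kq n(1) by linarith
    from eq[OF this] show "\<lfloor>(t + real (K * q) * \<beta>) + \<beta> * real i\<rfloor> = \<lfloor>(t' + real (K * q) * \<beta>') + \<beta>' * real i\<rfloor>"
      by (simp add: algebra_simps)
  qed
  note b0 = sum_floor_approx[OF q(1) pq, of t \<beta>, folded S0_def c_def \<eta>_def]
  note b0' = sum_floor_approx[OF q(1) pq, of t' \<beta>', folded S0' c_def \<eta>'_def]
  note b1 = sum_floor_approx[OF q(1) pq, of "t + real (K * q) * \<beta>" \<beta>, folded S1_def c_def \<eta>_def]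
  note b1' = sum_floor_approx[OF q(1) pq, of "t' + real (K * q) * \<beta>'" \<beta>', folded S1' c_def \<eta>'_def]
  define A where "A = (real q)\<^sup>2 * real K"
  have e1: "real q * (t + real (K * q) * \<beta>) = real q * t + A * \<beta>"
    "real q * (t' + real (K * q) * \<beta>') = real q * t' + A * \<beta>'"
    unfolding A_def by (simp_all add: algebra_simps power2_eq_square)
  have rq: "real q > 0" "real n > 0" "8 * real q \<le> real n" using q of_nat_mono[OF q(2), where 'a = real] by simp_all
  define Q where "Q = (real q)\<^sup>2"
  have "Q > 0" using rq unfolding Q_def by simp
  have \<eta>: "Q * \<eta> \<le> 1"
  proof -
    have "Q * \<eta> \<le> Q * (8 / (real q * real n))" using appr \<open>Q > 0\<close> unfolding \<eta>_def by (intro mult_left_mono) auto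
    also have "\<dots> = 8 * real q / real n" using rq unfolding Q_def by (simp add: power2_eq_square field_simps)
    also have "\<dots> \<le> 1" using rq by simp
    finally show ?thesis .
  qed
  have "\<eta>' \<le> \<eta> + D" unfolding defs by linarith
  then have \<eta>': "Q * \<eta>' \<le> Q * \<eta> + Q * D" using \<open>Q > 0\<close> by (metis distrib_left mult_left_mono less_imp_le)
  have "A \<ge> 0" unfolding A_def by simp
  have "A * \<beta> - A * \<beta>' = A * (\<beta> - \<beta>')" by (rule right_diff_distrib[symmetric])
  then have AD: "\<bar>A * \<beta> - A * \<beta>'\<bar> = A * D" using \<open>A \<ge> 0\<close> unfolding D_def by (simp only: abs_mult abs_of_nonneg)
  have "\<bar>A * \<beta> - A * \<beta>'\<bar> \<le> 2 * (Q * \<eta>) + 2 * (Q * \<eta>') + 4"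
    using b0 b0' b1 b1' unfolding e1 Q_def[symmetric] by linarith
  then have main: "A * D - 2 * (Q * D) \<le> 8" using \<eta> \<eta>' unfolding AD by linarith
  have "real (K * q + q) = real (n div q * q)" unfolding Kq ..
  then have "real (K * q + q) + real q > real n" using n(2) by linarith
  then have "real K * real q + real q > real n - real q" by simp
  \<comment> \<open>K q > n - 2 q, and 8 q \<le> n leaves (K - 2) q > n - 4 q \<ge> n / 2: this is
    what the 8 is for.\<close>
  then have "real n / 2 \<le> (real K - 2) * real q" using rq(3) by (simp add: algebra_simps)
  then have "real n / 2 * (real q * D) \<le> ((real K - 2) * real q) * (real q * D)"
    unfolding D_def by (intro mult_right_mono) auto
  also have "\<dots> = A * D - 2 * (Q * D)" unfolding A_def Q_def by (simp add: algebra_simps power2_eq_square)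
  finally have "real n / 2 * (real q * D) \<le> 8" using main by linarith
  then have D: "D \<le> 16 / (real q * real n)" using rq by (simp add: field_simps)
  then show "\<bar>\<beta> - \<beta>'\<bar> \<le> 16 / (real q * real n)" unfolding D_def .
  have "Q * D \<le> Q * (16 / (real q * real n))" using D \<open>Q > 0\<close> by (intro mult_left_mono) auto
  also have "\<dots> = 16 * real q / real n" using rq unfolding Q_def by (simp add: power2_eq_square field_simps)
  also have "\<dots> \<le> 2" using rq by (simp add: field_simps)
  finally have "Q * D \<le> 2" .
  then have "\<bar>real q * t - real q * t'\<bar> \<le> 6" using b0 b0' \<eta> \<eta>' unfolding Q_def[symmetric] by linarith
  then have "real q * \<bar>t - t'\<bar> \<le> 6" by (simp add: right_diff_distrib[symmetric] abs_mult)
  then show "\<bar>t - t'\<bar> \<le> 6 / real q" using rq(1) by (simp add: field_simps)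
qed

section \<open>Mechanical words and the points of K3 that they code\<close>

definition mechanical :: "real \<Rightarrow> real \<Rightarrow> int \<Rightarrow> bool" where
  "mechanical \<beta> t k \<longleftrightarrow> \<lfloor>t + \<beta> * of_int (k + 1)\<rfloor> \<noteq> \<lfloor>t + \<beta> * of_int k\<rfloor>"

lemma mechanical_step:
  assumes "0 \<le> \<beta>" "\<beta> < 1"
  shows "\<lfloor>t + \<beta> * of_int (k + 1)\<rfloor> = \<lfloor>t + \<beta> * of_int k\<rfloor> + of_bool (mechanical \<beta> t k)"
proof -
  have "\<lfloor>t + \<beta> * of_int (k + 1)\<rfloor> \<ge> \<lfloor>t + \<beta> * of_int k\<rfloor>" 
    using assms by (intro floor_mono) (simp add: algebra_simps)
  moreover have "t + \<beta> * of_int (k + 1) < t + \<beta> * of_int k + 1" using assms by (simp add: algebra_simps)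
  then have "\<lfloor>t + \<beta> * of_int (k + 1)\<rfloor> \<le> \<lfloor>t + \<beta> * of_int k\<rfloor> + 1" by linarith
  ultimately show ?thesis unfolding mechanical_def by auto
qed

text \<open>A violation would give two windows of length \<open>l + 2\<close> whose letter counts differ by two, while all
  such counts lie within distance less than one of \<open>\<beta> (l + 2)\<close>.\<close>

lemma markov_word_mechanical:
  assumes "0 \<le> \<beta>" "\<beta> < 1"
  shows "markov_word (mechanical \<beta> t)"
  unfolding markov_word_def
proof (intro allI impI)
  fix k l
  let ?s = "mechanical \<beta> t"
  define H where "H k = \<lfloor>t + \<beta> * of_int k\<rfloor>" for k
  have step: "H (j + 1) = H j + of_bool (?s j)" for j
    unfolding H_def by (rule mechanical_step[OF assms])
  assume sw: "?s k \<noteq> ?s (k + 1)" and eq: "\<forall>i<l. ?s (k + 2 + int i) = ?s (k - 1 - int i)"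
    and neq: "?s (k + 2 + int l) \<noteq> ?s (k - 1 - int l)"
  have mid: "H (k + 2 + int l) - H (k + 2) = H k - H (k - int l)" using eq
  proof (induction l)
    case (Suc l)
    have "H (k + 2 + int (Suc l)) = H (k + 2 + int l) + of_bool (?s (k + 2 + int l))"
      using step[of "k + 2 + int l"] by (simp add: algebra_simps)
    moreover have "H (k - int l) = H (k - int (Suc l)) + of_bool (?s (k - 1 - int l))"
      using step[of "k - 1 - int l"] by (simp add: algebra_simps)
    ultimately show ?case using Suc by simp
  qed simp
  show "?s (k - 1 - int l) = ?s (k + 1)"
  proof (rule ccontr)
    assume c: "?s (k - 1 - int l) \<noteq> ?s (k + 1)"
    have e: "H (k + 1) = H k + of_bool (?s k)" "H (k + 2) = H (k + 1) + of_bool (?s (k + 1))"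
      "H (k + 3 + int l) = H (k + 2 + int l) + of_bool (?s (k + 2 + int l))"
      "H (k - int l) = H (k - 1 - int l) + of_bool (?s (k - 1 - int l))"
      using step[of k] step[of "k + 1"] step[of "k + 2 + int l"] step[of "k - 1 - int l"]
      by (simp_all add: algebra_simps)
    have "\<bar>(H (k + 3 + int l) - H (k + 1)) - (H (k + 1) - H (k - 1 - int l))\<bar> = 2"
      using mid e sw c neq by (auto simp: of_bool_def split: if_splits)
    moreover have window: "real_of_int (H j) \<le> t + \<beta> * of_int j"
       "real_of_int (H j) > t + \<beta> * of_int j - 1" for j
      unfolding H_def by linarith+
    have "real_of_int (H (k + 3 + int l)) \<le> t + \<beta> * (of_int (k + 1) + (2 + real l))"
      "real_of_int (H (k + 3 + int l)) > t + \<beta> * (of_int (k + 1) + (2 + real l)) - 1"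
      "real_of_int (H (k - 1 - int l)) \<le> t + \<beta> * (of_int (k + 1) - (2 + real l))"
      "real_of_int (H (k - 1 - int l)) > t + \<beta> * (of_int (k + 1) - (2 + real l)) - 1"
      "real_of_int (H (k + 1)) \<le> t + \<beta> * of_int (k + 1)"
      "real_of_int (H (k + 1)) > t + \<beta> * of_int (k + 1) - 1"
      using window[of "k + 3 + int l"] window[of "k - 1 - int l"] window[of "k + 1"]
      by (simp_all add: algebra_simps)
    then have "\<bar>(real_of_int (H (k + 3 + int l)) - H (k + 1)) - (H (k + 1) - H (k - 1 - int l))\<bar> < 2"
      unfolding distrib_left right_diff_distrib by linarith
    ultimately show False by linarith
  qed
qed

text \<open>The digits from index 1 on of the sequence in \<open>markov_word_bounded\<close>; the
  letter at 0 therefore contributes one digit and each later letter two.\<close>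

definition markov_point :: "real \<Rightarrow> real \<Rightarrow> real" where
  "markov_point \<beta> t = cf_tail (\<lambda>n. digit (mechanical \<beta> t ((1 + int n) div 2)))"

lemma markov_point_in_K3:
  assumes "0 \<le> \<beta>" "\<beta> < 1"
  shows "markov_point \<beta> t \<in> K3"
  using markov_word_bounded[OF markov_word_mechanical[OF assms]] unfolding mem_K3_iff markov_point_def by blast

text \<open>The distance is below the separation at digit index 2 * n, so the digits up to that
  index agree, and with them the letters 0 to n. Summing letters recovers the floors, starting from
  the common floor 0 of the intercepts.\<close>

lemma markov_point_close:
  assumes "0 \<le> \<beta>" "\<beta> < 1" "0 \<le> t" "t < 1" "0 \<le> \<beta>'" "\<beta>' < 1" "0 \<le> t'" "t' < 1"
    and close: "\<bar>markov_point \<beta> t - markov_point \<beta>' t'\<bar> < 1/14 * (1/9) ^ (2 * n)"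
    and "i \<le> n"
  shows "\<lfloor>t + \<beta> * real i\<rfloor> = \<lfloor>t' + \<beta>' * real i\<rfloor>"
proof -
  let ?u = "\<lambda>n. digit (mechanical \<beta> t ((1 + int n) div 2))"
    and ?v = "\<lambda>n. digit (mechanical \<beta>' t' ((1 + int n) div 2))"
  have u: "?u m = ?v m" if "m \<le> 2 * n" for m
  proof (rule ccontr)
    assume "?u m \<noteq> ?v m"
    then obtain l where l: "l \<le> m" "?u l \<noteq> ?v l" "\<And>i. i < l \<Longrightarrow> ?u i = ?v i"
      using least_counterexample[of m "\<lambda>m. ?u m = ?v m"] by blast
    have "1/14 * (1/9) ^ l \<le> \<bar>cf_tail ?u - cf_tail ?v\<bar>"
      by (rule cf_tail_separated) (use l in \<open>auto simp: digit_def\<close>)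
    moreover have "(1/9 :: real) ^ (2 * n) \<le> (1/9) ^ l" using l(1) that by (intro power_decreasing) auto
    ultimately show False using close unfolding markov_point_def by linarith
  qed
  have s: "mechanical \<beta> t (int k) = mechanical \<beta>' t' (int k)" if "k \<le> n" for k
  proof -
    have "(1 + int (2 * k)) div 2 = int k" by simp
    then show ?thesis using u[of "2 * k"] that unfolding digit_def by (auto split: if_splits)
  qed
  show ?thesis using \<open>i \<le> n\<close>
  proof (induction i)
    case 0
    have "\<lfloor>t\<rfloor> = 0" "\<lfloor>t'\<rfloor> = 0" using assms by (auto simp: floor_eq_iff)
    then show ?case by simp
  next
    case (Suc i)
    then show ?case using mechanical_step[OF assms(1,2), of t "int i"] mechanical_step[OF assms(5,6), of t' "int i"] s[of i]
      by (simp add: algebra_simps)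
  qed
qed

section \<open>The lower bound\<close>

text \<open>The radius 1 / (q N) is the precision of Dirichlet's theorem at height N. For a slope
  outside this set, the approximation found there must have denominator at least N powr (1 - d /
  2).\<close>

definition near_rationals :: "real \<Rightarrow> nat \<Rightarrow> real set" where
  "near_rationals d N = (\<Union>q\<in>{q\<in>{1..N}. real q < real N powr (1 - d / 2)}. \<Union>p\<in>{0..int q}.
     {of_int p / real q - 1 / (real q * real N)..of_int p / real q + 1 / (real q * real N)})"

lemma near_rationals_measurable [measurable]: "near_rationals d N \<in> sets borel"
  unfolding near_rationals_def by (intro sets.finite_UN) auto

text \<open>Each q contributes at most 2 q intervals of length 2 / (q N), thus 4 / N, and there are
  at most N powr (1 - d / 2) denominators.\<close>

lemma emeasure_near_rationals:
  assumes "N \<ge> 1"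
  shows "emeasure lborel (near_rationals d N) \<le> ennreal (4 * real N powr (- d / 2))"
proof -
  define R where "R = real N powr (1 - d / 2)"
  define I where "I p q = {of_int p / real q - 1 / (real q * real N)..of_int p / real q + 1 / (real q * real N)}"
    for p :: int and q :: nat
  define S where "S = {q\<in>{1..N}. real q < R}"
  have fin: "finite S" unfolding S_def by simp
  have inner: "emeasure lborel (\<Union>p\<in>{0..int q}. I p q) \<le> ennreal (4 / real N)" if "q \<in> S" for q
  proof -
    have q: "real q \<ge> 1" using that unfolding S_def by simp
    have "emeasure lborel (\<Union>p\<in>{0..int q}. I p q) \<le> (\<Sum>p\<in>{0..int q}. emeasure lborel (I p q))"
      by (rule emeasure_subadditive_finite) (auto simp: I_def)
    also have "\<dots> = (\<Sum>p\<in>{0..int q}. ennreal (2 / (real q * real N)))"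
    proof (intro sum.cong refl)
      fix p
      have "emeasure lborel (I p q) = ennreal ((of_int p / real q + 1 / (real q * real N)) - (of_int p / real q - 1 / (real q * real N)))"
        unfolding I_def by (rule emeasure_lborel_Icc) (simp add: field_simps)
      then show "emeasure lborel (I p q) = ennreal (2 / (real q * real N))" by simp
    qed
    also have "\<dots> = ennreal (real (card {0..int q})) * ennreal (2 / (real q * real N))"
      unfolding ennreal_of_nat_eq_real_of_nat[symmetric] by (rule sum_constant)
    also have "\<dots> = ennreal (real (card {0..int q}) * (2 / (real q * real N)))"
      by (rule ennreal_mult[symmetric]) auto
    also have "real (card {0..int q}) = real q + 1" by simp
    also have "ennreal ((real q + 1) * (2 / (real q * real N))) \<le> ennreal (4 / real N)"
    proof (rule ennreal_leI)
      have "(real q + 1) * (2 / (real q * real N)) \<le> (2 * real q) * (2 / (real q * real N))"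
        using q by (intro mult_right_mono) auto
      then show "(real q + 1) * (2 / (real q * real N)) \<le> 4 / real N" using q by simp
    qed
    finally show ?thesis .
  qed
  have "emeasure lborel (near_rationals d N) \<le> (\<Sum>q\<in>S. emeasure lborel (\<Union>p\<in>{0..int q}. I p q))"
    unfolding near_rationals_def S_def[symmetric] R_def[symmetric] I_def[symmetric]
    using fin by (intro emeasure_subadditive_finite) (auto simp: I_def intro!: sets.finite_UN)
  also have "\<dots> \<le> (\<Sum>q\<in>S. ennreal (4 / real N))" by (intro sum_mono inner)
  also have "\<dots> = ennreal (real (card S)) * ennreal (4 / real N)"
    unfolding ennreal_of_nat_eq_real_of_nat[symmetric] by (rule sum_constant)
  also have "\<dots> = ennreal (real (card S) * (4 / real N))"
    by (rule ennreal_mult[symmetric]) auto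
  also have "\<dots> \<le> ennreal (R * (4 / real N))"
  proof (intro ennreal_leI mult_right_mono)
    have "S \<subseteq> {1..nat \<lfloor>R\<rfloor>}" unfolding S_def by (auto simp: le_nat_floor)
    then have "card S \<le> nat \<lfloor>R\<rfloor>" using card_mono[of "{1..nat \<lfloor>R\<rfloor>}" S] by simp
    moreover have "R \<ge> 0" unfolding R_def by simp
    ultimately show "real (card S) \<le> R" by linarith
  qed simp
  also have "R * (4 / real N) = 4 * real N powr (- d / 2)"
  proof -
    have "R = real N powr (- d / 2) * real N powr 1"
      unfolding R_def powr_add[symmetric] by (rule arg_cong[where f = "\<lambda>x. real N powr x"]) simp
    then show ?thesis using assms by simp
  qed
  finally show ?thesis .
qed

text \<open>With dyadic heights the removed measures form a convergent geometric series; over all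
  heights N the bounds N powr (- d / 2) would diverge for small d.\<close>

definition good_slopes :: "real \<Rightarrow> nat \<Rightarrow> real set" where
  "good_slopes d k0 = {0..<1} - (\<Union>j. near_rationals d (2 ^ (k0 + j)))"

lemma good_slopes_measurable [measurable]: "good_slopes d k0 \<in> sets borel"
  unfolding good_slopes_def by measurable

lemma emeasure_good_slopes:
  assumes "d > 0"
  obtains k0 where "emeasure lborel (good_slopes d k0) \<ge> ennreal (1/2)"
proof -
  define \<rho> :: real where "\<rho> = 2 powr (- d / 2)"
  have \<rho>: "0 < \<rho>" "\<rho> < 1" using assms powr_less_mono[of "- d / 2" 0 2] unfolding \<rho>_def by auto
  have pow: "real (2 ^ k) powr (- d / 2) = \<rho> ^ k" for k
  proof -
    have "real (2 ^ k) powr (- d / 2) = (2 powr real k) powr (- d / 2)" by (simp add: powr_realpow)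
    also have "\<dots> = (2 powr (- d / 2)) powr real k" by (simp add: powr_powr mult.commute)
    also have "\<dots> = \<rho> ^ k" unfolding \<rho>_def by (simp add: powr_realpow)
    finally show ?thesis .
  qed
  \<comment> \<open>The removed measure is at most 4 * \<rho> ^ k0 / (1 - \<rho>), which this choice
    brings below 1/2.\<close>
  obtain k0 where k0: "\<rho> ^ k0 < (1 - \<rho>) / 8"
    using real_arch_pow_inv[of "(1 - \<rho>) / 8" \<rho>] \<rho> by auto
  define B where "B = (\<Union>j. near_rationals d (2 ^ (k0 + j)))"
  have "emeasure lborel B \<le> (\<Sum>j. emeasure lborel (near_rationals d (2 ^ (k0 + j))))"
    unfolding B_def by (intro emeasure_subadditive_countably) auto
  also have "\<dots> \<le> (\<Sum>j. ennreal (4 * \<rho> ^ k0 * \<rho> ^ j))"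
  proof (intro suminf_le)
    fix j
    show "emeasure lborel (near_rationals d (2 ^ (k0 + j))) \<le> ennreal (4 * \<rho> ^ k0 * \<rho> ^ j)"
      using emeasure_near_rationals[of "2 ^ (k0 + j)" d] unfolding pow by (simp add: power_add mult.assoc)
  qed auto
  also have "\<dots> = ennreal (4 * \<rho> ^ k0 * (1 / (1 - \<rho>)))"
    using \<rho> by (intro suminf_ennreal_eq sums_mult geometric_sums) auto
  also have "\<dots> \<le> ennreal (1/2)"
  proof (rule ennreal_leI)
    have "4 * \<rho> ^ k0 * (1 / (1 - \<rho>)) \<le> 4 * ((1 - \<rho>) / 8) * (1 / (1 - \<rho>))"
      using k0 \<rho> by (intro mult_right_mono mult_left_mono) auto
    also have "\<dots> = 1/2" using \<rho> by simp
    finally show "4 * \<rho> ^ k0 * (1 / (1 - \<rho>)) \<le> 1/2" .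
  qed
  finally have B: "emeasure lborel B \<le> ennreal (1/2)" .
  have "ennreal 1 = emeasure lborel {0..<1::real}" by simp
  also have "\<dots> \<le> emeasure lborel (good_slopes d k0 \<union> B)"
    unfolding good_slopes_def B_def by (intro emeasure_mono) auto
  also have "\<dots> \<le> emeasure lborel (good_slopes d k0) + emeasure lborel B"
    unfolding B_def by (intro emeasure_subadditive) auto
  also have "\<dots> \<le> emeasure lborel (good_slopes d k0) + ennreal (1/2)" using B by (rule add_left_mono)
  finally have "ennreal 1 - ennreal (1/2) \<le> emeasure lborel (good_slopes d k0)"
    by (simp add: ennreal_minus_le_iff add.commute)
  also have "ennreal 1 - ennreal (1/2) = ennreal (1/2)" by (subst ennreal_minus) auto
  finally show thesis by (rule that)
qed

lemma good_slopes_approx: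
  assumes "\<beta> \<in> good_slopes d k0" "k \<ge> k0"
  obtains p :: int and q :: nat where "1 \<le> q" "q \<le> 2 ^ k" "coprime p (int q)"
    "\<bar>\<beta> - of_int p / real q\<bar> \<le> 1 / (real q * 2 ^ k)" "real q \<ge> real (2 ^ k) powr (1 - d / 2)"
proof -
  define N :: nat where "N = 2 ^ k"
  have N: "N > 0" unfolding N_def by simp
  obtain p h where ph: "coprime p h" "0 < h" "h \<le> int N" "\<bar>of_int h * \<beta> - of_int p\<bar> < 1 / real N"
    using Dirichlet_approx_coprime[OF N] by blast
  define q where "q = nat h"
  have q: "int q = h" "1 \<le> q" "q \<le> N" "real q > 0" using ph unfolding q_def by auto
  have appr: "\<bar>real q * \<beta> - of_int p\<bar> < 1 / real N" using ph(4) q(1) by (metis of_int_of_nat_eq)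
  have N1: "1 / real N \<le> 1" using N by simp
  have \<beta>: "0 \<le> \<beta>" "\<beta> < 1" using assms(1) unfolding good_slopes_def by auto
  have "real q * \<beta> \<ge> 0" "real q * \<beta> < real q" using \<beta> q by auto
  then have "of_int p > (-1::real)" "of_int p < real q + 1" using appr N1 by linarith+
  then have p: "p \<in> {0..int q}" by auto
  have "\<beta> - of_int p / real q = (real q * \<beta> - of_int p) / real q" using q(4) by (simp add: field_simps)
  then have "\<bar>\<beta> - of_int p / real q\<bar> = \<bar>real q * \<beta> - of_int p\<bar> / real q" using q(4) by simp
  also have "\<dots> \<le> (1 / real N) / real q" using appr q(4) by (intro divide_right_mono) auto
  also have "\<dots> = 1 / (real q * real N)" by simp
  finally have close: "\<bar>\<beta> - of_int p / real q\<bar> \<le> 1 / (real q * real N)" .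
  have "real q \<ge> real N powr (1 - d / 2)"
  proof (rule ccontr)
    assume "\<not> ?thesis"
    then have "q \<in> {q\<in>{1..N}. real q < real N powr (1 - d / 2)}" using q by simp
    moreover have "\<beta> \<in> {of_int p / real q - 1 / (real q * real N)..of_int p / real q + 1 / (real q * real N)}"
      using close unfolding atLeastAtMost_iff by linarith
    ultimately have "\<beta> \<in> near_rationals d N" unfolding near_rationals_def using p by blast
    moreover obtain j where "k = k0 + j" using assms(2) le_Suc_ex by blast
    ultimately show False using assms(1) unfolding good_slopes_def N_def by blast
  qed
  then show thesis using that[of q p] q(2,3) ph(1) close unfolding q(1) N_def by simp
qed

section \<open>Parameters whose points fall into a small set\<close>

definition parameters :: "real \<Rightarrow> nat \<Rightarrow> real set \<Rightarrow> (real \<times> real) set" where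
  "parameters d k0 U = {(\<beta>, t). \<beta> \<in> good_slopes d k0 \<and> 0 \<le> t \<and> t < 1 \<and> markov_point \<beta> t \<in> U}"

text \<open>One parameter pair with its point in \<open>U\<close> is fixed, and every other lies in
  a box around it. A Borel superset is asked for because its area is what gets summed later. The
  area 4 * 16 * 6 / (q^2 * 8 N) = 48 / (q^2 N) and the lower bound on q give the exponent d -
  3.\<close>

lemma parameters_cover:
  assumes "bounded U" "diameter U < 1/14 * (1/9) ^ (16 * 2 ^ k)" "k \<ge> k0"
  shows "\<exists>B\<in>sets borel. parameters d k0 U \<subseteq> B \<and> emeasure lborel B \<le> ennreal (48 * (2 ^ k) powr (d - 3))"
proof (cases "parameters d k0 U = {}")
  case True
  then show ?thesis by (intro bexI[of _ "{}"]) auto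
next
  case False
  then obtain \<beta> t where bt: "\<beta> \<in> good_slopes d k0" "0 \<le> t" "t < 1" "markov_point \<beta> t \<in> U"
    unfolding parameters_def by auto
  obtain p q where q: "1 \<le> q" "q \<le> 2 ^ k" "coprime p (int q)"
    "\<bar>\<beta> - of_int p / real q\<bar> \<le> 1 / (real q * 2 ^ k)" "real q \<ge> real (2 ^ k) powr (1 - d / 2)"
    using good_slopes_approx[OF bt(1) assms(3)] by blast
  define N :: real where "N = 2 ^ k"
  have N: "N > 0" unfolding N_def by simp
  have rq: "real q > 0" using q(1) by simp
  \<comment> \<open>\<open>equal_floors_close\<close> asks for 8 q \<le> n, and q \<le> 2 ^ k. The
    hypothesis on the diameter is the separation at 2 * n = 16 * 2 ^ k digits.\<close>
  define n :: nat where "n = 8 * 2 ^ k"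
  have n: "real n = 8 * N" unfolding n_def N_def by simp
  define a b where "a = 16 / (real q * real n)" and "b = 6 / real q"
  have ab: "a > 0" "b > 0" using rq N unfolding a_def b_def n by auto
  define B where "B = {\<beta> - a..\<beta> + a} \<times> {t - b..t + b}"
  have B_meas: "B \<in> sets borel" unfolding B_def by (intro borel_closed closed_Times) auto
  have sub: "parameters d k0 U \<subseteq> B"
  proof
    fix z assume "z \<in> parameters d k0 U"
    then obtain \<beta>' t' where z: "z = (\<beta>', t')" "\<beta>' \<in> good_slopes d k0" "0 \<le> t'" "t' < 1" "markov_point \<beta>' t' \<in> U"
      unfolding parameters_def by auto
    have ran: "0 \<le> \<beta>" "\<beta> < 1" "0 \<le> \<beta>'" "\<beta>' < 1" using bt(1) z(2) unfolding good_slopes_def by auto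
    have "dist (markov_point \<beta> t) (markov_point \<beta>' t') \<le> diameter U"
      using assms(1) bt(4) z(5) by (rule diameter_bounded_bound)
    then have close: "\<bar>markov_point \<beta> t - markov_point \<beta>' t'\<bar> < 1/14 * (1/9) ^ (2 * n)"
      using assms(2) unfolding n_def dist_real_def by simp
    have eq: "\<lfloor>t + \<beta> * real i\<rfloor> = \<lfloor>t' + \<beta>' * real i\<rfloor>" if "i \<le> n" for i
      by (rule markov_point_close[OF ran(1,2) bt(2,3) ran(3,4) z(3,4) close that])
    have "\<bar>\<beta> - of_int p / real q\<bar> \<le> 8 / (real q * real n)" using q(4) unfolding n N_def by simp
    moreover have "q > 0" "8 * q \<le> n" using q(1,2) unfolding n_def by auto
    ultimately have "\<bar>\<beta> - \<beta>'\<bar> \<le> a" "\<bar>t - t'\<bar> \<le> b"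
      unfolding a_def b_def using equal_floors_close[OF _ _ q(3) _ eq] by blast+
    then have "\<beta> - a \<le> \<beta>'" "\<beta>' \<le> \<beta> + a" "t - b \<le> t'" "t' \<le> t + b" by linarith+
    then show "z \<in> B" unfolding B_def z(1) by simp
  qed
  have "emeasure lborel B = emeasure (lborel \<Otimes>\<^sub>M lborel) B" by (simp add: lborel_prod)
  also have "\<dots> = emeasure lborel {\<beta> - a..\<beta> + a} * emeasure lborel {t - b..t + b}"
    unfolding B_def by (intro lborel.emeasure_pair_measure_Times) auto
  also have "\<dots> = ennreal (2 * a) * ennreal (2 * b)" using ab by simp
  also have "\<dots> = ennreal (2 * a * (2 * b))" using ab by (intro ennreal_mult[symmetric]) auto
  also have "\<dots> \<le> ennreal (48 * N powr (d - 3))"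
  proof (rule ennreal_leI)
    have R: "0 < N powr (1 - d / 2)" "N powr (1 - d / 2) \<le> real q" using q(5) N unfolding N_def by auto
    have "2 * a * (2 * b) = 48 / ((real q)\<^sup>2 * N)"
      unfolding a_def b_def n using rq N by (simp add: field_simps power2_eq_square)
    also have "\<dots> \<le> 48 / ((N powr (1 - d / 2))\<^sup>2 * N)"
      using R N rq by (intro divide_left_mono mult_right_mono power_mono mult_pos_pos) auto
    also have "(N powr (1 - d / 2))\<^sup>2 * N = N powr (3 - d)"
    proof -
      have "(N powr (1 - d / 2))\<^sup>2 * N = N powr (1 - d / 2) * N powr (1 - d / 2) * N powr 1"
        using N by (simp add: power2_eq_square)
      also have "\<dots> = N powr (3 - d)" unfolding powr_add[symmetric] by (rule arg_cong[where f = "\<lambda>x. N powr x"]) simp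
      finally show ?thesis .
    qed
    also have "48 / N powr (3 - d) = 48 * N powr (d - 3)"
      using powr_minus_divide[of N "3 - d"] by simp
    finally show "2 * a * (2 * b) \<le> 48 * N powr (d - 3)" .
  qed
  finally show ?thesis using B_meas sub unfolding N_def by blast
qed

lemma exists_power_two_between:
  fixes x :: real
  assumes "x \<ge> 1"
  shows "\<exists>k. 2 ^ k \<le> x \<and> x < 2 ^ (k + 1)"
proof -
  obtain m where m: "x < 2 ^ m" using real_arch_pow[of 2 x] by auto
  define k where "k = (LEAST m. x < 2 ^ m)"
  have k: "x < 2 ^ k" unfolding k_def by (rule LeastI[of _ m]) (rule m)
  have "k \<noteq> 0" using k assms by (intro notI) simp
  then obtain j where j: "k = Suc j" using not0_implies_Suc by blast
  have "\<not> x < 2 ^ j" using not_less_Least[of j "\<lambda>m. x < 2 ^ m"] unfolding k_def[symmetric] j by simp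
  then show ?thesis using k unfolding j by (intro exI[of _ j]) simp
qed

text \<open>As 9 and 14 are at most 16 \<le> exp 4, it suffices that T > 4 + 64 * 2 ^ k, which T
  \<ge> 70 * 2 ^ k guarantees. The largest such k has 2 ^ k > T / 140.\<close>

lemma parameters_cover_diameter:
  assumes "bounded U" "diameter U > 0" "diameter U < exp (- 70 * 2 ^ k0)" "d \<le> 3"
  shows "\<exists>B\<in>sets borel. parameters d k0 U \<subseteq> B \<and>
    emeasure lborel B \<le> ennreal (48 * 140 powr (3 - d) * (- ln (diameter U)) powr (d - 3))"
proof -
  define T where "T = - ln (diameter U)"
  have diam: "diameter U = exp (- T)" using assms(2) unfolding T_def by simp
  have T: "T > 70 * 2 ^ k0" using assms(3) unfolding diam by simp
  have "(1::real) \<le> 2 ^ k0" by simp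
  then have "T / 70 \<ge> 1" using T by linarith
  then obtain k where k: "2 ^ k \<le> T / 70" "T / 70 < 2 ^ (k + 1)" using exists_power_two_between by blast
  have "(2::real) ^ k0 < 2 ^ (k + 1)" using T k(2) by linarith
  then have "k0 < k + 1" by (subst (asm) power_strict_increasing_iff) auto
  then have kk0: "k \<ge> k0" by simp
  have e2: "(2::real) \<le> exp 1" using exp_ge_add_one_self[of 1] by simp
  have "(2::real) ^ 4 \<le> exp 1 ^ 4" using e2 by (intro power_mono) auto
  then have e4: "(16::real) \<le> exp 4" by (simp add: exp_of_nat_mult[symmetric])
  have "exp (- 4 :: real) \<le> 1/9" "exp (- 4 :: real) \<le> 1/14" using e4 by (simp_all add: exp_minus field_simps)
  then have "exp (- 4 :: real) * exp (- 4) ^ (16 * 2 ^ k) \<le> 1/14 * (1/9) ^ (16 * 2 ^ k)"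
    by (intro mult_mono power_mono) auto
  moreover have "exp (- 4 :: real) * exp (- 4) ^ (16 * 2 ^ k) = exp (- 4 - 64 * 2 ^ k)"
    by (simp add: exp_of_nat_mult[symmetric] exp_add[symmetric])
  moreover have "(1::real) \<le> 2 ^ k" by simp
  then have "exp (- T) < exp (- 4 - 64 * 2 ^ k)" using k(1) by (subst exp_less_cancel_iff) linarith
  ultimately have "diameter U < 1/14 * (1/9) ^ (16 * 2 ^ k)" unfolding diam by linarith
  from parameters_cover[OF assms(1) this kk0, of d]
  obtain B where B: "B \<in> sets borel" "parameters d k0 U \<subseteq> B" "emeasure lborel B \<le> ennreal (48 * (2 ^ k) powr (d - 3))"
    by blast
  have "T > 0" using T by (smt (verit) zero_less_power)
  have "(2 ^ k) powr (d - 3) \<le> (T / 140) powr (d - 3)"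
    using k(2) \<open>T > 0\<close> assms(4) by (intro powr_mono2') auto
  also have "\<dots> = T powr (d - 3) * 140 powr (3 - d)"
    using \<open>T > 0\<close> powr_minus_divide[of 140 "3 - d"] by (simp add: powr_divide)
  finally have "48 * (2 ^ k) powr (d - 3) \<le> 48 * 140 powr (3 - d) * T powr (d - 3)" by (simp add: algebra_simps)
  then show ?thesis using B ennreal_leI order_trans unfolding T_def by blast
qed

text \<open>Sets of diameter 0 cost h 0 = 0, so their preimages must be null. They are covered at
  every scale, and the intersection of the covers has area 0.\<close>

lemma parameters_cover_singleton:
  assumes "bounded U" "diameter U = 0" "d < 3"
  shows "\<exists>B\<in>sets borel. parameters d k0 U \<subseteq> B \<and> emeasure lborel B = 0"
proof -
  have "\<exists>B\<in>sets borel. parameters d k0 U \<subseteq> B \<and> emeasure lborel B \<le> ennreal (48 * (2 ^ (k0 + j)) powr (d - 3))" for j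
    using assms by (intro parameters_cover) auto
  then obtain B where B: "\<And>j. B j \<in> sets borel" "\<And>j. parameters d k0 U \<subseteq> B j"
    "\<And>j. emeasure lborel (B j) \<le> ennreal (48 * (2 ^ (k0 + j)) powr (d - 3))"
    by metis
  have lim: "(\<lambda>j. ennreal (48 * (2 ^ (k0 + j)) powr (d - 3))) \<longlonglongrightarrow> ennreal (48 * 0)"
  proof (intro tendsto_ennrealI tendsto_mult_left tendsto_neg_powr)
    show "filterlim (\<lambda>j. 2 ^ (k0 + j) :: real) at_top sequentially"
    proof (rule filterlim_at_top_mono[OF filterlim_real_sequentially], intro always_eventually allI)
      fix j
      have "real j \<le> 2 ^ j" by (rule less_imp_le) (rule of_nat_less_two_power)
      also have "\<dots> \<le> 2 ^ (k0 + j)" by (simp add: power_add)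
      finally show "real j \<le> 2 ^ (k0 + j)" .
    qed
  qed (use assms(3) in simp)
  have "emeasure lborel (\<Inter>j. B j) \<le> ennreal (48 * (2 ^ (k0 + j)) powr (d - 3))" for j
  proof -
    have "emeasure lborel (\<Inter>j. B j) \<le> emeasure lborel (B j)"
      using B(1) by (intro emeasure_mono INF_lower) simp_all
    then show ?thesis using B(3)[of j] by (rule order_trans)
  qed
  then have "emeasure lborel (\<Inter>j. B j) \<le> ennreal (48 * 0)"
    by (intro LIMSEQ_le_const[OF lim]) auto
  then show ?thesis using B(1,2) by (intro bexI[of _ "\<Inter>j. B j"]) auto
qed

lemma hausdorff_measure_K3_eq_top:
  assumes h: "dimension_function h"
    and lim: "Limsup (at_right 0) (\<lambda>\<epsilon>. ereal (\<bar>ln (h \<epsilon>)\<bar> / ln \<bar>ln \<epsilon>\<bar>)) < 3"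
  shows "hausdorff_measure h K3 = \<infinity>"
proof -
  \<comment> \<open>The maximum with 0 makes \<open>s\<close> positive, from which d < 3
    follows.\<close>
  obtain s where s: "max 0 (Limsup (at_right 0) (\<lambda>\<epsilon>. ereal (\<bar>ln (h \<epsilon>)\<bar> / ln \<bar>ln \<epsilon>\<bar>))) < ereal s" "ereal s < 3"
    using ereal_dense2[of "max 0 (Limsup (at_right 0) (\<lambda>\<epsilon>. ereal (\<bar>ln (h \<epsilon>)\<bar> / ln \<bar>ln \<epsilon>\<bar>)))" 3] lim by auto
  have s03: "0 < s" "s < 3" using s by auto
  \<comment> \<open>Half of the gap between s and 3 is spent on removing slopes. The other half
    survives as a factor T powr (- d) tending to 0, which makes the measure infinite and not merely
    positive.\<close>
  define d where "d = (3 - s) / 2"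
  have d: "0 < d" "d < 3" "d - 3 = - s - d" using s03 unfolding d_def by (auto simp: field_simps)
  obtain k0 where k0: "emeasure lborel (good_slopes d k0) \<ge> ennreal (1/2)"
    using emeasure_good_slopes[OF d(1)] by blast
  define C :: real where "C = 48 * 140 powr (3 - d)"
  have C: "C > 0" unfolding C_def by simp
  have ln_top: "filterlim (\<lambda>\<epsilon>. - ln \<epsilon>) at_top (at_right (0::real))"
    using ln_at_0 by (simp add: filterlim_uminus_at_top)
  have ln_large: "\<forall>\<^sub>F \<epsilon> in at_right (0::real). - ln \<epsilon> > x" for x
    using ln_top by (simp add: filterlim_at_top_dense)
  have "\<forall>\<^sub>F \<epsilon> in at_right 0. ereal (\<bar>ln (h \<epsilon>)\<bar> / ln \<bar>ln \<epsilon>\<bar>) < ereal s"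
    by (rule Limsup_lessD) (use s in simp)
  then have "\<forall>\<^sub>F \<epsilon> in at_right 0. h \<epsilon> \<ge> (- ln \<epsilon>) powr (- s)"
    using ln_large[of 3] eventually_at_right_less[of 0]
  proof eventually_elim
    case (elim \<epsilon>)
    define T where "T = - ln \<epsilon>"
    have T: "T > 3" using elim unfolding T_def by simp
    have h\<epsilon>: "h \<epsilon> > 0" using h elim(3) unfolding dimension_function_def by blast
    have "ln T > 0" using T by simp
    have "\<bar>ln \<epsilon>\<bar> = T" using T unfolding T_def by simp
    then have "\<bar>ln (h \<epsilon>)\<bar> / ln T < s" using elim(1) by simp
    then have "\<bar>ln (h \<epsilon>)\<bar> < s * ln T" using \<open>ln T > 0\<close> by (simp only: pos_divide_less_eq)
    then have "(- s) * ln T \<le> ln (h \<epsilon>)" by simp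
    then have "exp ((- s) * ln T) \<le> exp (ln (h \<epsilon>))" by (simp only: exp_le_cancel_iff)
    then have "exp ((- s) * ln T) \<le> h \<epsilon>" by (simp only: exp_ln[OF h\<epsilon>])
    moreover have "exp ((- s) * ln T) = T powr (- s)" using T unfolding powr_def by simp
    ultimately show ?case unfolding T_def by simp
  qed
  then obtain b where b: "b > 0" "\<And>\<epsilon>. 0 < \<epsilon> \<Longrightarrow> \<epsilon> < b \<Longrightarrow> h \<epsilon> \<ge> (- ln \<epsilon>) powr (- s)"
    unfolding eventually_at_right_field by auto
  have small: "((\<lambda>\<epsilon>. C * (- ln \<epsilon>) powr (- d)) \<longlongrightarrow> C * 0) (at_right 0)"
    using d(1) by (intro tendsto_mult_left tendsto_neg_powr ln_top) simp
  have "\<exists>\<delta>\<in>{0<..}. of_nat M \<le> hausdorff_premeasure h \<delta> K3" for M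
  proof -
    \<comment> \<open>The parameters have area at least 1/2, so with this constant every cover costs
      at least M + 1.\<close>
    define \<kappa>0 :: real where "\<kappa>0 = 1 / (2 * (real M + 1))"
    have \<kappa>0: "\<kappa>0 > 0" unfolding \<kappa>0_def by simp
    have "\<forall>\<^sub>F \<epsilon> in at_right 0. C * (- ln \<epsilon>) powr (- d) < \<kappa>0"
      using small \<kappa>0 by (intro order_tendstoD(2)) auto
    moreover have "\<forall>\<^sub>F \<epsilon> in at_right (0::real). \<epsilon> < min b (exp (- 70 * 2 ^ k0))"
      using b(1) by (intro order_tendstoD(2)[OF tendsto_ident_at]) auto
    ultimately have "\<forall>\<^sub>F \<epsilon> in at_right 0. C * (- ln \<epsilon>) powr (- d) < \<kappa>0 \<and> \<epsilon> < min b (exp (- 70 * 2 ^ k0)) \<and> - ln \<epsilon> > 3 \<and> \<epsilon> > 0"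
      using ln_large[of 3] eventually_at_right_less[of 0] by eventually_elim simp
    then obtain \<delta> where \<delta>: "C * (- ln \<delta>) powr (- d) < \<kappa>0" "\<delta> < min b (exp (- 70 * 2 ^ k0))" "- ln \<delta> > 3" "\<delta> > 0"
      using eventually_happens'[OF trivial_limit_at_right_real] by blast
    have piece: "\<exists>B\<in>sets borel. parameters d k0 U \<subseteq> B \<and> emeasure lborel B \<le> ennreal (\<kappa>0 * h (diameter U))"
      if U: "bounded U" "diameter U < \<delta>" for U
    proof (cases "diameter U = 0")
      case True
      obtain B where "B \<in> sets borel" "parameters d k0 U \<subseteq> B" "emeasure lborel B = 0"
        using parameters_cover_singleton[OF U(1) True d(2)] by blast
      then show ?thesis by (intro bexI[of _ B]) simp_all
    next
      case False
      then have pos: "diameter U > 0" using diameter_ge_0[OF U(1)] by simp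
      define T where "T = - ln (diameter U)"
      have "ln (diameter U) < ln \<delta>" using U(2) pos \<delta>(4) by (subst ln_less_cancel_iff) auto
      then have T: "T > - ln \<delta>" unfolding T_def by simp
      have "diameter U < exp (- 70 * 2 ^ k0)" "diameter U < b" using U(2) \<delta>(2) by auto
      then obtain B where B: "B \<in> sets borel" "parameters d k0 U \<subseteq> B"
        "emeasure lborel B \<le> ennreal (C * T powr (d - 3))"
        using parameters_cover_diameter[OF U(1) pos, of k0 d] d(2) unfolding C_def T_def by auto
      have "C * T powr (d - 3) = (C * T powr (- d)) * T powr (- s)"
      proof -
        have "d - 3 = - d + - s" using d(3) by simp
        then show ?thesis by (simp only: powr_add mult.assoc)
      qed
      also have "\<dots> \<le> \<kappa>0 * h (diameter U)"
      proof (intro mult_mono)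
        have "T powr (- d) \<le> (- ln \<delta>) powr (- d)" using T \<delta>(3) d(1) by (intro powr_mono2') auto
        then have "C * T powr (- d) \<le> C * (- ln \<delta>) powr (- d)" using C by simp
        then show "C * T powr (- d) \<le> \<kappa>0" using \<delta>(1) by linarith
        show "T powr (- s) \<le> h (diameter U)" unfolding T_def using b(2) pos \<open>diameter U < b\<close> by blast
      qed (use \<kappa>0 in auto)
      finally show ?thesis using B ennreal_leI order_trans by blast
    qed
    have "of_nat M \<le> (\<Sum>i. ennreal (h (diameter (U i))))"
      if cover: "K3 \<subseteq> (\<Union>i. U i)" and U: "\<And>i. bounded (U i) \<and> diameter (U i) < \<delta>" for U :: "nat \<Rightarrow> real set"
    proof -
      have "\<exists>B\<in>sets borel. parameters d k0 (U i) \<subseteq> B \<and> emeasure lborel B \<le> ennreal (\<kappa>0 * h (diameter (U i)))" for i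
        using piece U by blast
      then obtain B where B: "\<And>i. B i \<in> sets borel" "\<And>i. parameters d k0 (U i) \<subseteq> B i"
        "\<And>i. emeasure lborel (B i) \<le> ennreal (\<kappa>0 * h (diameter (U i)))"
        by metis
      have sub: "good_slopes d k0 \<times> {0..<1::real} \<subseteq> (\<Union>i. B i)"
      proof
        fix z assume "z \<in> good_slopes d k0 \<times> {0..<1::real}"
        then obtain \<beta> t where z: "z = (\<beta>, t)" "\<beta> \<in> good_slopes d k0" "0 \<le> t" "t < 1" by auto
        have "markov_point \<beta> t \<in> K3" using z(2) unfolding good_slopes_def by (intro markov_point_in_K3) auto
        then obtain i where "markov_point \<beta> t \<in> U i" using cover by blast
        then have "z \<in> parameters d k0 (U i)" unfolding parameters_def using z by simp
        then show "z \<in> (\<Union>i. B i)" using B(2) by blast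
      qed
      have "ennreal (1/2) \<le> emeasure lborel (good_slopes d k0) * emeasure lborel {0..<1::real}" using k0 by simp
      also have "\<dots> = emeasure (lborel \<Otimes>\<^sub>M lborel) (good_slopes d k0 \<times> {0..<1::real})"
        by (intro lborel.emeasure_pair_measure_Times[symmetric]) auto
      also have "\<dots> = emeasure lborel (good_slopes d k0 \<times> {0..<1::real})" by (simp add: lborel_prod)
      also have "\<dots> \<le> emeasure lborel (\<Union>i. B i)" using sub B(1) by (intro emeasure_mono) auto
      also have "\<dots> \<le> (\<Sum>i. emeasure lborel (B i))" using B(1) by (intro emeasure_subadditive_countably) auto
      also have "\<dots> \<le> (\<Sum>i. ennreal \<kappa>0 * ennreal (h (diameter (U i))))"
        using B(3) \<kappa>0 by (intro suminf_le) (auto simp: ennreal_mult'[symmetric])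
      also have "\<dots> = ennreal \<kappa>0 * (\<Sum>i. ennreal (h (diameter (U i))))" by (rule ennreal_suminf_cmult)
      finally have half: "ennreal (1/2) \<le> ennreal \<kappa>0 * (\<Sum>i. ennreal (h (diameter (U i))))" .
      have "of_nat M \<le> ennreal (2 * (real M + 1) * (1/2))"
        unfolding ennreal_of_nat_eq_real_of_nat by (rule ennreal_leI) simp
      also have "\<dots> = ennreal (2 * (real M + 1)) * ennreal (1/2)"
        by (rule ennreal_mult) simp_all
      also have "\<dots> \<le> ennreal (2 * (real M + 1)) * (ennreal \<kappa>0 * (\<Sum>i. ennreal (h (diameter (U i)))))"
        using half by (rule mult_left_mono) simp
      also have "\<dots> = ennreal (2 * (real M + 1) * \<kappa>0) * (\<Sum>i. ennreal (h (diameter (U i))))"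
      proof -
        have "ennreal (2 * (real M + 1) * \<kappa>0) = ennreal (2 * (real M + 1)) * ennreal \<kappa>0"
          using \<kappa>0 by (intro ennreal_mult) simp_all
        then show ?thesis by (simp only: mult.assoc)
      qed
      also have "2 * (real M + 1) * \<kappa>0 = 1" unfolding \<kappa>0_def by simp
      finally show ?thesis by simp
    qed
    then have "of_nat M \<le> hausdorff_premeasure h \<delta> K3"
      unfolding hausdorff_premeasure_def by (intro INF_greatest) blast
    then show ?thesis using \<delta>(4) by auto
  qed
  then show ?thesis unfolding hausdorff_measure_eq_SUP by (simp add: ennreal_SUP_eq_top)
qed

theorem theorem1p4:
  fixes h :: "real \<Rightarrow> real"
  assumes "dimension_function h"
  shows "(Limsup (at_right 0) (\<lambda>\<epsilon>. ereal (\<bar>ln (h \<epsilon>)\<bar> / ln \<bar>ln \<epsilon>\<bar>)) < 3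
            \<longrightarrow> hausdorff_measure h K3 = \<infinity>) \<and>
         (Limsup (at_right 0) (\<lambda>\<epsilon>. ereal (\<bar>ln (h \<epsilon>)\<bar> / ln \<bar>ln \<epsilon>\<bar>)) > 3
            \<longrightarrow> hausdorff_measure h K3 = 0)"
  using hausdorff_measure_K3_eq_top[OF assms] hausdorff_measure_K3_eq_0[OF assms] by blast

end
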